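(* Let $\alpha_1,\alpha_2\in(0,1)$, $c>0$, $n\ge1$, and assume that $s\mapsto\Psi(s)^{-1}=s^{(\alpha_2c+\alpha_1s)/(c+s)}$ is a Bernstein function on $(0,\infty)$. For every nonzero $0\le\varphi\in X=L^1(\mathbb R^n)\cap L^\infty(\mathbb R^n)$ and every $p>1$, let $T_A$ denote the maximal existence time of the nonnegative maximal mild solution with initial datum $u_0=A\varphi$, $A>0$. Then there are constants $A_0,C_1,C_2>0$ such that $$K^{-1}(C_1A^{1-p})\le T_A\le K^{-1}(C_2A^{1-p}),\qquad A\ge A_0.$$ In particular, $$T_A\asymp A^{-(p-1)/\alpha_1}\qquad\text{as }A\to\infty.$$
   Context: $f\asymp g$ as $A\to\infty$ means that there are constants $0<C\le C'$ with $Cg\le f\le C'g$ for all sufficiently large $A$. A Bernstein function is a $C^\infty$ function $F:(0,\infty)\to[0,\infty)$ with $(-1)^{m-1}F^{(m)}\ge0$ for all $m\ge1$. $\Psi(z)=z^{-B(z)}$ with $B(z)=\frac{\alpha_2c+\alpha_1z}{c+z}$ (principal branch), $\psi\in L^1_{\rm loc}(0,\infty)$ is the continuous function on $(0,\infty)$ of exponential order whose Laplace transform is $\Psi$, and $K(t)=\int_0^t\psi(s)\,ds$, which under the Bernstein condition is a strictly increasing continuous bijection of $[0,\infty)$ with inverse $K^{-1}$. The families are $S_{\mathcal A}(t)g=Z(t)*g$, $P_{\mathcal A}(t)g=Y(t)*g$, where, under the Bernstein condition, $Z(t)$ ($t>0$, weakly continuous in $t$) are probability measures and $Y(t)$ (a.e.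 $t>0$, measurable in $t$) are finite positive measures on $\mathbb R^n$ determined by $$\int_0^\infty e^{-zt}\int_{\mathbb R^n}e^{-ix\cdot\xi}Z(t,dx)\,dt=\frac{\Psi(z)^{-1}}{z(\Psi(z)^{-1}+|\xi|^2)},\qquad\int_0^\infty e^{-zt}\int_{\mathbb R^n}e^{-ix\cdot\xi}Y(t,dx)\,dt=\frac1{\Psi(z)^{-1}+|\xi|^2}\quad(z>0);$$ $S_{\mathcal A}(0)=I$. A mild solution on $[0,T]$ is a function in $C([0,T];L^1(\mathbb R^n))\cap L^\infty((0,T);L^\infty(\mathbb R^n))$ satisfying $$u(t)=S_{\mathcal A}(t)u_0+\int_0^tP_{\mathcal A}(t-s)(u(s)_+)^p\,ds$$ in $L^1$ for every $t\in[0,T]$ and in $L^\infty$ for a.e. $t>0$ (this is the mild form of ${}^{S}D_0^{\alpha(t)}u=\Delta u+u^p$, $u(0)=u_0$, with $\alpha(t)=\alpha_2+(\alpha_1-\alpha_2)e^{-ct}$). For each $0\le u_0\in X$ there is a unique nonnegative maximal mild solution $u$ on $[0,T_{\max})$, $0<T_{\max}\le\infty$, i.e. one that is a mild solution on $[0,T]$ for all $T<T_{\max}$ and cannot be extended to a mild solution on a strictly larger interval. *)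

theory Defs
  imports "HOL-Probability.Probability"
begin

text \<open>
  \<open>\<Psi>\<close> is used both on the positive half-line and, with the principal branch, in the complex
  plane. The polymorphic definition covers both: \<open>powr\<close> on \<open>complex\<close> is \<open>exp (w * Ln z)\<close>
  with the principal logarithm.
\<close>

definition B_exp :: "real \<Rightarrow> real \<Rightarrow> real \<Rightarrow> 'a::real_field \<Rightarrow> 'a" where
  "B_exp \<alpha>1 \<alpha>2 c z = (of_real (\<alpha>2 * c) + of_real \<alpha>1 * z) / (of_real c + z)"

definition Psi :: "real \<Rightarrow> real \<Rightarrow> real \<Rightarrow> 'a::{ln, real_field} \<Rightarrow> 'a" where
  "Psi \<alpha>1 \<alpha>2 c z = z powr (- B_exp \<alpha>1 \<alpha>2 c z)"

lemma Psi_of_real: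
  assumes "s > 0"
  shows "Psi \<alpha>1 \<alpha>2 c (complex_of_real s) = complex_of_real (Psi \<alpha>1 \<alpha>2 c s)"
proof -
  have "- B_exp \<alpha>1 \<alpha>2 c (complex_of_real s) = complex_of_real (- B_exp \<alpha>1 \<alpha>2 c s)"
    by (simp add: B_exp_def)
  then show ?thesis
    using assms powr_of_real[of s "- B_exp \<alpha>1 \<alpha>2 c s"] by (simp add: Psi_def)
qed

lemma inverse_Psi_real:
  "inverse (Psi \<alpha>1 \<alpha>2 c (s::real)) = s powr ((\<alpha>2 * c + \<alpha>1 * s) / (c + s))"
  by (simp add: Psi_def B_exp_def powr_minus)

definition bernstein_function :: "(real \<Rightarrow> real) \<Rightarrow> bool" where
  "bernstein_function F \<longleftrightarrow>
     (\<forall>x>0. 0 \<le> F x) \<and>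
     (\<forall>m. \<forall>x>0. (deriv ^^ m) F field_differentiable at x) \<and>
     (\<forall>m\<ge>1. \<forall>x>0. 0 \<le> (-1) ^ (m - 1) * (deriv ^^ m) F x)"

text \<open>
  Integrals in time are taken with respect to the completed measure \<open>lebesgue\<close>, because some
  integrands below are determined only for almost every time. Elements of \<open>L\<^sup>1\<close> and
  \<open>L\<^sup>\<infinity>\<close> in space are represented by Borel functions (\<open>lborel\<close>), so that they can be
  convolved with arbitrary, possibly singular, Borel measures.
\<close>

text \<open>
  Integrability of \<open>\<psi>\<close> is required up to \<open>t = 0\<close>, as needed for the Laplace transform and for
  \<open>K\<close>. The values of \<open>\<psi>\<close> outside \<open>{0<..}\<close> play no role.
\<close>

definition Psi_kernel :: "real \<Rightarrow> real \<Rightarrow> real \<Rightarrow> (real \<Rightarrow> real) \<Rightarrow> bool" where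
  "Psi_kernel \<alpha>1 \<alpha>2 c \<psi> \<longleftrightarrow>
     continuous_on {0<..} \<psi> \<and>
     (\<forall>t>0. set_integrable lebesgue {0<..t} \<psi>) \<and>
     (\<exists>M \<sigma> t0. (\<forall>t\<ge>t0. \<bar>\<psi> t\<bar> \<le> M * exp (\<sigma> * t)) \<and>
       (\<forall>z::complex. Re z > \<sigma> \<longrightarrow>
          (LINT t:{0<..}|lebesgue. exp (- (z * of_real t)) * of_real (\<psi> t)) = Psi \<alpha>1 \<alpha>2 c z))"

definition K_fun :: "(real \<Rightarrow> real) \<Rightarrow> real \<Rightarrow> real" where
  "K_fun \<psi> t = (LINT s:{0<..t}|lebesgue. \<psi> s)"

definition K_inv :: "(real \<Rightarrow> real) \<Rightarrow> real \<Rightarrow> real" where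
  "K_inv \<psi> = inv_into {0..} (K_fun \<psi>)"

definition fourier_measure :: "(real ^ 'n) measure \<Rightarrow> real ^ 'n \<Rightarrow> complex" where
  "fourier_measure \<mu> \<xi> = (LINT x|\<mu>. exp (- (\<i> * of_real (x \<bullet> \<xi>))))"

definition Z_family ::
  "real \<Rightarrow> real \<Rightarrow> real \<Rightarrow> (real \<Rightarrow> (real ^ 'n) measure) \<Rightarrow> bool" where
  "Z_family \<alpha>1 \<alpha>2 c Z \<longleftrightarrow>
     (\<forall>t>0. prob_space (Z t) \<and> sets (Z t) = sets borel) \<and>
     (\<forall>f :: real ^ 'n \<Rightarrow> real. continuous_on UNIV f \<and> bounded (range f) \<longrightarrow>
        continuous_on {0<..} (\<lambda>t. LINT x|Z t. f x)) \<and>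
     (\<forall>z>0. \<forall>\<xi>.
        (LINT t:{0<..}|lebesgue. of_real (exp (- (z * t))) * fourier_measure (Z t) \<xi>) =
        of_real (inverse (Psi \<alpha>1 \<alpha>2 c z) / (z * (inverse (Psi \<alpha>1 \<alpha>2 c z) + (norm \<xi>)\<^sup>2))))"

text \<open>
  The measures \<open>Y t\<close> are specified for almost every \<open>t > 0\<close> only. In both transform identities
  the right-hand side is nonzero, which forces the integrand to be integrable.
\<close>

definition Y_family ::
  "real \<Rightarrow> real \<Rightarrow> real \<Rightarrow> (real \<Rightarrow> (real ^ 'n) measure) \<Rightarrow> bool" where
  "Y_family \<alpha>1 \<alpha>2 c Y \<longleftrightarrow>
     (AE t in lebesgue. 0 < t \<longrightarrow> finite_measure (Y t) \<and> sets (Y t) = sets borel) \<and>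
     (\<forall>E \<in> sets borel. (\<lambda>t. emeasure (Y t) E) \<in> borel_measurable (lebesgue_on {0<..})) \<and>
     (\<forall>z>0. \<forall>\<xi>.
        (LINT t:{0<..}|lebesgue. of_real (exp (- (z * t))) * fourier_measure (Y t) \<xi>) =
        of_real (1 / (inverse (Psi \<alpha>1 \<alpha>2 c z) + (norm \<xi>)\<^sup>2)))"

definition conv_measure :: "(real ^ 'n) measure \<Rightarrow> (real ^ 'n \<Rightarrow> real) \<Rightarrow> real ^ 'n \<Rightarrow> real" where
  "conv_measure \<mu> g x = (LINT y|\<mu>. g (x - y))"

definition S_op ::
  "(real \<Rightarrow> (real ^ 'n) measure) \<Rightarrow> real \<Rightarrow> (real ^ 'n \<Rightarrow> real) \<Rightarrow> real ^ 'n \<Rightarrow> real" where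
  "S_op Z t g = (if t = 0 then g else conv_measure (Z t) g)"

definition P_op ::
  "(real \<Rightarrow> (real ^ 'n) measure) \<Rightarrow> real \<Rightarrow> (real ^ 'n \<Rightarrow> real) \<Rightarrow> real ^ 'n \<Rightarrow> real" where
  "P_op Y t g = conv_measure (Y t) g"

definition in_L1 :: "(real ^ 'n \<Rightarrow> real) \<Rightarrow> bool" where
  "in_L1 f \<longleftrightarrow> integrable lborel f"

definition in_Linf :: "(real ^ 'n \<Rightarrow> real) \<Rightarrow> bool" where
  "in_Linf f \<longleftrightarrow> f \<in> borel_measurable lborel \<and> (\<exists>M. AE x in lborel. \<bar>f x\<bar> \<le> M)"

definition in_X :: "(real ^ 'n \<Rightarrow> real) \<Rightarrow> bool" where
  "in_X f \<longleftrightarrow> in_L1 f \<and> in_Linf f"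

definition mild_rhs ::
  "(real \<Rightarrow> (real ^ 'n) measure) \<Rightarrow> (real \<Rightarrow> (real ^ 'n) measure) \<Rightarrow> real \<Rightarrow>
   (real ^ 'n \<Rightarrow> real) \<Rightarrow> (real \<Rightarrow> real ^ 'n \<Rightarrow> real) \<Rightarrow> real \<Rightarrow> real ^ 'n \<Rightarrow> real" where
  "mild_rhs Z Y p u0 u t x =
     S_op Z t u0 x +
     (LINT s:{0<..<t}|lebesgue. P_op Y (t - s) (\<lambda>y. (max (u s y) 0) powr p) x)"

text \<open>
  A curve in \<open>L\<^sup>1\<close> on \<open>[0, T]\<close> is given by a jointly Borel measurable function of
  \<open>(t, x)\<close>; every element of \<open>C([0,T]; L\<^sup>1)\<close> has such a representative. For it, the vector-valued
  time integral is represented by the integral taken at almost every \<open>x\<close> (Fubini).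
\<close>

definition mild_solution ::
  "(real \<Rightarrow> (real ^ 'n) measure) \<Rightarrow> (real \<Rightarrow> (real ^ 'n) measure) \<Rightarrow> real \<Rightarrow>
   (real ^ 'n \<Rightarrow> real) \<Rightarrow> real \<Rightarrow> (real \<Rightarrow> real ^ 'n \<Rightarrow> real) \<Rightarrow> bool" where
  "mild_solution Z Y p u0 T u \<longleftrightarrow>
     (\<lambda>(t, x). u t x) \<in> borel_measurable (restrict_space borel ({0..T} \<times> UNIV)) \<and>
     (\<forall>t\<in>{0..T}. in_L1 (u t)) \<and>
     (\<forall>t\<in>{0..T}. ((\<lambda>s. LINT x|lborel. \<bar>u s x - u t x\<bar>) \<longlongrightarrow> 0) (at t within {0..T})) \<and>
     (\<exists>M. AE t in lebesgue. t \<in> {0<..<T} \<longrightarrow> (AE x in lborel. \<bar>u t x\<bar> \<le> M)) \<and>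
     (\<forall>t\<in>{0..T}. in_L1 (mild_rhs Z Y p u0 u t) \<and>
        (AE x in lborel. u t x = mild_rhs Z Y p u0 u t x)) \<and>
     (AE t in lebesgue. t \<in> {0<..<T} \<longrightarrow> in_Linf (mild_rhs Z Y p u0 u t) \<and>
        (AE x in lborel. u t x = mild_rhs Z Y p u0 u t x))"

text \<open>
  A mild solution on \<open>[0, T]\<close> with \<open>T = Tmax\<close> already lives on a strictly larger interval than
  \<open>[0, Tmax)\<close>, hence the non-strict inequality in the last clause.
\<close>

definition maximal_nonneg_mild_solution ::
  "(real \<Rightarrow> (real ^ 'n) measure) \<Rightarrow> (real \<Rightarrow> (real ^ 'n) measure) \<Rightarrow> real \<Rightarrow>
   (real ^ 'n \<Rightarrow> real) \<Rightarrow> ereal \<Rightarrow> (real \<Rightarrow> real ^ 'n \<Rightarrow> real) \<Rightarrow> bool" where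
  "maximal_nonneg_mild_solution Z Y p u0 Tmax u \<longleftrightarrow>
     0 < Tmax \<and>
     (\<forall>T. 0 < T \<and> ereal T < Tmax \<longrightarrow> mild_solution Z Y p u0 T u) \<and>
     (\<forall>t. 0 \<le> t \<and> ereal t < Tmax \<longrightarrow> (AE x in lborel. 0 \<le> u t x)) \<and>
     \<not> (\<exists>T v. Tmax \<le> ereal T \<and> mild_solution Z Y p u0 T v \<and>
          (\<forall>t. 0 \<le> t \<and> ereal t < Tmax \<longrightarrow> (AE x in lborel. v t x = u t x)))"

text \<open>
  The relation \<open>f \<asymp> g\<close> at infinity, for an extended-real \<open>f\<close> since existence times may be infinite.
\<close>

definition asymp_at_top :: "(real \<Rightarrow> ereal) \<Rightarrow> (real \<Rightarrow> real) \<Rightarrow> bool" where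
  "asymp_at_top f g \<longleftrightarrow>
     (\<exists>C C'. 0 < C \<and> C \<le> C' \<and>
        (\<forall>\<^sub>F A in at_top. ereal (C * g A) \<le> f A \<and> f A \<le> ereal (C' * g A)))"

end

theory Submission
  imports Defs "HOL-Real_Asymp.Real_Asymp"
begin

text \<open>
  The total mass of \<open>Y t\<close> has Laplace transform \<open>\<Psi>\<close>, so by uniqueness of Laplace transforms it is
  \<open>\<psi> t\<close> for almost every \<open>t\<close>. Hence \<open>\<psi> \<ge> 0\<close>, \<open>K\<close> is monotone, and \<open>\<Psi> z \<sim> z powr (- \<alpha>1)\<close> at infinity
  gives \<open>K t \<asymp> t powr \<alpha>1\<close> at \<open>0\<close>.

  Upper bound: by Laplace transform in time and Fourier transform in space, a mild solution satisfies
  \<open>u - \<psi> * \<Delta>u = u\<^sub>0 + \<psi> * u\<^sup>p\<close> weakly. Testing against a Gaussian \<open>\<chi>\<close>, for which \<open>\<Delta>\<chi> \<ge> - n \<chi>\<close>, and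
  using Jensen's inequality, \<open>G = \<integral> u \<chi>\<close> satisfies \<open>G + n \<psi> * G \<ge> G\<^sub>0 + \<kappa> \<psi> * G\<^sup>p\<close> with \<open>G\<^sub>0\<close>
  proportional to \<open>A\<close>. As long as \<open>G\<close> exists it doubles within time steps that decrease
  geometrically, so it blows up by a time of order \<open>A powr (- (p - 1) / \<alpha>1)\<close>.

  Lower bound: as long as \<open>K T\<close> is at most a small multiple of \<open>A powr (1 - p)\<close>, monotone Picard
  iteration yields a mild solution on \<open>[0, T]\<close> of size at most \<open>2 A \<parallel>\<phi>\<parallel>\<^sub>\<infinity>\<close>. By uniqueness it
  extends the maximal solution, which therefore lives beyond \<open>T\<close>.
\<close>

subsection \<open>Laplace transforms on the half-line\<close>

text \<open>The families \<open>Y\<close> and \<open>Z\<close> are given by their transforms only,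
  and \<open>Y t\<close> for almost every time and measurably in the completed sense. The obstacle
  is to obtain objects to which Fubini applies. Each Laplace identity is replaced by one for a Borel
  function, \<open>Y t\<close> is split into its mass and a subprobability kernel, and the Duhamel
  term becomes convolution with one finite Borel measure on (0,1] x R^n. The cutoff at time 1 costs
  nothing, since existence times tend to 0 as A grows. No derivative in space is taken: the identity
  in frequency is integrated against a Gaussian probability measure, whose Fourier transforms with
  weights 1 and |\<xi>|^2 are \<chi> and -\<Delta>\<chi>. A Gaussian is positive everywhere, so
  every nonzero datum is seen, and -\<Delta>\<chi> \<le> n \<chi> holds globally; the linear term
  this produces is absorbed by the power once G is large. The exponent comes from the time scale on
  which kernel and power balance: K(\<delta>) m^(p-1) of order 1 with m of order A means
  \<delta>^\<alpha>1 of order A^(1-p).\<close>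

lemma integral_mult_continuous_exp_eq_0:
  fixes H g :: "real \<Rightarrow> real"
  assumes H: "integrable lborel H" and supp: "\<And>t. t \<le> 0 \<Longrightarrow> H t = 0"
    and moments: "\<And>k::nat. (\<integral>t. H t * exp (-t) ^ k \<partial>lborel) = 0"
    and g: "continuous_on UNIV g"
  shows "(\<integral>t. H t * g (exp (-t)) \<partial>lborel) = 0"
proof -
  have [measurable]: "H \<in> borel_measurable borel" using H by auto
  have gm[measurable]: "g \<in> borel_measurable borel" using g by (rule borel_measurable_continuous_onI)
  define C where "C = (\<integral>t. \<bar>H t\<bar> \<partial>lborel)"
  have C0: "0 \<le> C" unfolding C_def by simp
  have mono_int: "integrable lborel (\<lambda>t. H t * exp (-t) ^ k)" for k
  proof (rule Bochner_Integration.integrable_bound[OF H])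
    show "AE t in lborel. norm (H t * exp (-t) ^ k) \<le> norm (H t)"
    proof (rule AE_I2)
      fix t show "norm (H t * exp (-t) ^ k) \<le> norm (H t)"
        by (cases "t \<le> 0") (auto simp: supp abs_mult intro!: mult_left_le power_le_one)
    qed
  qed simp
  have poly_int: "integrable lborel (\<lambda>t. H t * (\<Sum>i\<le>n. a i * exp (-t) ^ i))" for n :: nat and a
  proof -
    have "integrable lborel (\<lambda>t. \<Sum>i\<le>n. a i * (H t * exp (-t) ^ i))"
      by (intro Bochner_Integration.integrable_sum integrable_mult_right mono_int)
    then show ?thesis by (simp add: sum_distrib_left mult.left_commute)
  qed
  have poly_0: "(\<integral>t. H t * (\<Sum>i\<le>n. a i * exp (-t) ^ i) \<partial>lborel) = 0" for n :: nat and a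
  proof -
    have "(\<integral>t. H t * (\<Sum>i\<le>n. a i * exp (-t) ^ i) \<partial>lborel)
        = (\<integral>t. (\<Sum>i\<le>n. a i * (H t * exp (-t) ^ i)) \<partial>lborel)"
      by (simp add: sum_distrib_left mult.left_commute)
    also have "\<dots> = 0"
      by (subst Bochner_Integration.integral_sum) (auto intro: mono_int simp: moments)
    finally show ?thesis .
  qed
  have "\<bar>\<integral>t. H t * g (exp (-t)) \<partial>lborel\<bar> \<le> e" if "0 < e" for e
  proof -
    \<comment> \<open>By the Weierstrass theorem on [0,1], which contains exp (-t) for every t > 0,
      g is within \<open>e / (C + 1)\<close> of a polynomial q, and the polynomial part integrates
      to 0. The 1 in the denominator covers C = 0.\<close>
    have "0 < e / (C + 1)" using that C0 by simp
    moreover have "continuous_on {0..1} g" using g continuous_on_subset by blast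
    ultimately obtain q where "real_polynomial_function q" and q: "\<And>x. x \<in> {0..1} \<Longrightarrow> \<bar>g x - q x\<bar> < e / (C + 1)"
      using Stone_Weierstrass_real_polynomial_function[of "{0..1::real}" g "e / (C + 1)"] by auto
    then obtain a n where qa: "q = (\<lambda>x. \<Sum>i\<le>n. a i * x ^ i)"
      using real_polynomial_function_iff_sum by blast
    have bd: "norm (H t * g (exp (-t)) - H t * q (exp (-t))) \<le> norm (\<bar>H t\<bar> * (e / (C + 1)))" for t
    proof (cases "t \<le> 0")
      case False
      then have "exp (-t) \<in> {0..1}" by simp
      from less_imp_le[OF q[OF this]] show ?thesis using C0 \<open>0 < e\<close>
        by (simp add: right_diff_distrib[symmetric] abs_mult mult_left_mono del: times_divide_eq_right)
    qed (simp add: supp)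
    have i1: "integrable lborel (\<lambda>t. \<bar>H t\<bar> * (e / (C + 1)))"
      using H by (intro integrable_mult_left integrable_abs)
    have i3: "integrable lborel (\<lambda>t. H t * q (exp (-t)))" unfolding qa by (rule poly_int)
    then have [measurable]: "(\<lambda>t. H t * q (exp (-t))) \<in> borel_measurable borel" by auto
    have i2: "integrable lborel (\<lambda>t. H t * g (exp (-t)) - H t * q (exp (-t)))"
      by (rule Bochner_Integration.integrable_bound[OF i1]) (use bd in auto)
    have "(\<integral>t. H t * g (exp (-t)) \<partial>lborel)
        = (\<integral>t. (H t * g (exp (-t)) - H t * q (exp (-t))) + H t * q (exp (-t)) \<partial>lborel)" by simp
    also have "\<dots> = (\<integral>t. H t * g (exp (-t)) - H t * q (exp (-t)) \<partial>lborel)"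
      by (subst Bochner_Integration.integral_add[OF i2 i3]) (simp add: qa poly_0)
    finally have "\<bar>\<integral>t. H t * g (exp (-t)) \<partial>lborel\<bar> \<le> (\<integral>t. norm (H t * g (exp (-t)) - H t * q (exp (-t))) \<partial>lborel)"
      using integral_norm_bound[of lborel "\<lambda>t. H t * g (exp (-t)) - H t * q (exp (-t))"] by simp
    also have "\<dots> \<le> (\<integral>t. \<bar>H t\<bar> * (e / (C + 1)) \<partial>lborel)"
      using i1 i2 bd C0 \<open>0 < e\<close> by (intro integral_mono integrable_norm) (auto simp: abs_mult)
    also have "\<dots> = C * (e / (C + 1))" by (simp add: C_def)
    also have "\<dots> \<le> e" using C0 that by (simp add: divide_simps)
    finally show ?thesis .
  qed
  then have "\<bar>\<integral>t. H t * g (exp (-t)) \<partial>lborel\<bar> \<le> 0" by (metis dense not_less)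
  then show ?thesis by simp
qed

text \<open>Lerch's theorem. At the points z = b + 1 + k the transform gives the moments of a finite
  signed measure in the variable exp (-t), and these determine the measure.\<close>

lemma laplace_transform_unique:
  fixes h :: "real \<Rightarrow> real"
  assumes int: "\<And>z. b < z \<Longrightarrow> integrable lborel (\<lambda>t. exp (- (z * t)) * h t)"
    and zero: "\<And>z. b < z \<Longrightarrow> (\<integral>t. exp (- (z * t)) * h t \<partial>lborel) = 0"
    and supp: "\<And>t. t \<le> 0 \<Longrightarrow> h t = 0"
  shows "AE t in lborel. h t = 0"
proof -
  define H where "H t = exp (- ((b + 1) * t)) * h t" for t
  have Hi: "integrable lborel H" unfolding H_def using int[of "b + 1"] by simp
  then have [measurable]: "H \<in> borel_measurable borel" by auto
  have sH: "H t = 0" if "t \<le> 0" for t using supp that by (simp add: H_def)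
  have mom: "(\<integral>t. H t * exp (-t) ^ k \<partial>lborel) = 0" for k :: nat
  proof -
    have "(\<lambda>t. H t * exp (-t) ^ k) = (\<lambda>t. exp (- ((b + 1 + k) * t)) * h t)"
      by (auto simp: H_def fun_eq_iff exp_of_nat_mult[symmetric] exp_add[symmetric] algebra_simps)
    then show ?thesis using zero[of "b + 1 + k"] by simp
  qed
  have tail: "(\<integral>t. H t * indicator {x<..} t \<partial>lborel) = 0" for x
  proof -
    \<comment> \<open>A ramp in s = exp (-t): it is 0 for s \<ge> exp (-x) and rises with slope k to
      the value 1 below. After the substitution it tends to the indicator of t > x at every t,
      including t = x.\<close>
    define g where "g k s = max 0 (min 1 (real k * (exp (-x) - s)))" for k s
    have "continuous_on UNIV (g k)" for k unfolding g_def by (intro continuous_intros)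
    then have g0: "(\<integral>t. H t * g k (exp (-t)) \<partial>lborel) = 0" for k
      using integral_mult_continuous_exp_eq_0[OF Hi sH mom, where ?g="g k"] by blast
    have [measurable]: "g k \<in> borel_measurable borel" for k unfolding g_def by measurable
    have lim: "(\<lambda>k. H t * g k (exp (-t))) \<longlonglongrightarrow> H t * indicator {x<..} t" for t
    proof (rule tendsto_mult[OF tendsto_const])
      show "(\<lambda>k. g k (exp (-t))) \<longlonglongrightarrow> indicator {x<..} t"
      proof (cases "x < t")
        case True
        then have pos: "0 < exp (-x) - exp (-t)" by simp
        obtain k0 :: nat where k0: "1 / (exp (-x) - exp (-t)) < k0" using reals_Archimedean2 by blast
        have "g k (exp (-t)) = 1" if "k \<ge> k0" for k
        proof -
          have "1 / (exp (-x) - exp (-t)) < k" using k0 that by linarith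
          then have "1 < k * (exp (-x) - exp (-t))" using pos by (simp add: divide_simps)
          then show ?thesis by (simp add: g_def)
        qed
        then show ?thesis using True
          by (intro tendsto_eventually) (auto simp: eventually_sequentially)
      next
        case False
        then have "real k * (exp (-x) - exp (-t)) \<le> 0" for k by (intro mult_nonneg_nonpos) auto
        then have "g k (exp (-t)) = 0" for k unfolding g_def by (metis max_def min.coboundedI2 order_antisym)
        then show ?thesis using False by simp
      qed
    qed
    have "(\<lambda>k. \<integral>t. H t * g k (exp (-t)) \<partial>lborel) \<longlonglongrightarrow> (\<integral>t. H t * indicator {x<..} t \<partial>lborel)"
      by (rule integral_dominated_convergence[where w="\<lambda>t. \<bar>H t\<bar>"])
        (use Hi lim in \<open>auto simp: abs_mult g_def intro!: AE_I2 mult_left_le\<close>)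
    then show ?thesis using g0 by (simp add: LIMSEQ_const_iff)
  qed
  \<comment> \<open>All tail integrals of H vanish, so the positive and the negative part of H
    define the same finite measure; hence these densities agree almost everywhere.\<close>
  have "density lborel (\<lambda>t. ennreal (max 0 (H t))) = density lborel (\<lambda>t. ennreal (max 0 (- H t)))"
  proof (rule measure_eqI_lessThan)
    fix x
    have p: "integrable lborel (\<lambda>t. max 0 (H t) * indicator {x<..} t)"
      "integrable lborel (\<lambda>t. max 0 (- H t) * indicator {x<..} t)"
      by (auto intro!: integrable_real_mult_indicator integrable_max Hi)
    have e: "emeasure (density lborel (\<lambda>t. ennreal (max 0 (s * H t)))) {x<..}
        = ennreal (\<integral>t. max 0 (s * H t) * indicator {x<..} t \<partial>lborel)" for s
    proof -
      have "integrable lborel (\<lambda>t. max 0 (s * H t) * indicator {x<..} t)"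
        by (auto intro!: integrable_real_mult_indicator integrable_max Hi integrable_mult_right)
      then show ?thesis
        by (subst emeasure_density)
          (auto simp: nn_integral_eq_integral[symmetric] indicator_def intro!: nn_integral_cong)
    qed
    have "(\<integral>t. max 0 (H t) * indicator {x<..} t \<partial>lborel) - (\<integral>t. max 0 (- H t) * indicator {x<..} t \<partial>lborel)
        = (\<integral>t. H t * indicator {x<..} t \<partial>lborel)"
      by (subst Bochner_Integration.integral_diff[OF p, symmetric])
        (auto intro!: Bochner_Integration.integral_cong simp: max_def indicator_def)
    then show "emeasure (density lborel (\<lambda>t. ennreal (max 0 (H t)))) {x<..}
        = emeasure (density lborel (\<lambda>t. ennreal (max 0 (- H t)))) {x<..}"
      using e[of 1] e[of "-1"] tail[of x] by simp
    show "emeasure (density lborel (\<lambda>t. ennreal (max 0 (H t)))) {x<..} < \<infinity>"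
      using e[of 1] by simp
  qed auto
  then have "AE t in lborel. ennreal (max 0 (H t)) = ennreal (max 0 (- H t))"
    by (intro sigma_finite_measure.density_unique[OF sigma_finite_lborel]) auto
  then show ?thesis
  proof eventually_elim
    case (elim t)
    then have "max 0 (H t) = max 0 (- H t)" by (subst (asm) ennreal_inj) auto
    then show ?case by (auto simp: H_def max_def split: if_splits)
  qed
qed

lemma laplace_transform_unique_complex:
  fixes h :: "real \<Rightarrow> complex"
  assumes int: "\<And>z. b < z \<Longrightarrow> integrable lborel (\<lambda>t. of_real (exp (- (z * t))) * h t)"
    and zero: "\<And>z. b < z \<Longrightarrow> (\<integral>t. of_real (exp (- (z * t))) * h t \<partial>lborel) = 0"
    and supp: "\<And>t. t \<le> 0 \<Longrightarrow> h t = 0"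
  shows "AE t in lborel. h t = 0"
proof -
  have "AE t in lborel. Re (h t) = 0"
  proof (rule laplace_transform_unique[of b])
    fix z assume z: "b < z"
    show "integrable lborel (\<lambda>t. exp (- (z * t)) * Re (h t))"
      using integrable_Re[OF int[OF z]] by simp
    show "(\<integral>t. exp (- (z * t)) * Re (h t) \<partial>lborel) = 0"
      using integral_Re[OF int[OF z]] zero[OF z] by simp
  qed (simp add: supp)
  moreover have "AE t in lborel. Im (h t) = 0"
  proof (rule laplace_transform_unique[of b])
    fix z assume z: "b < z"
    show "integrable lborel (\<lambda>t. exp (- (z * t)) * Im (h t))"
      using integrable_Im[OF int[OF z]] by simp
    show "(\<integral>t. exp (- (z * t)) * Im (h t) \<partial>lborel) = 0"
      using integral_Im[OF int[OF z]] zero[OF z] by simp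
  qed (simp add: supp)
  ultimately show ?thesis by eventually_elim (simp add: complex_eq_iff)
qed

section \<open>Convolutions on the whole line\<close>

lemma
  fixes F G :: "real \<Rightarrow> complex"
  assumes F: "integrable lborel F" and G: "integrable lborel G"
  shows integrable_convolution: "integrable lborel (\<lambda>t. \<integral>s. F (t - s) * G s \<partial>lborel)"
    and integral_convolution:
      "(\<integral>t. (\<integral>s. F (t - s) * G s \<partial>lborel) \<partial>lborel) = (\<integral>t. F t \<partial>lborel) * (\<integral>t. G t \<partial>lborel)"
proof -
  have [measurable]: "F \<in> borel_measurable borel" "G \<in> borel_measurable borel" using F G by auto
  have trans: "integrable lborel (\<lambda>t. F (t - s))" "(\<integral>t. F (t - s) \<partial>lborel) = (\<integral>t. F t \<partial>lborel)" for s
    using lborel_integrable_real_affine[OF F, of 1 "-s"] lborel_integral_real_affine[of 1 F "-s"]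
    by (simp_all add: algebra_simps)
  have transn: "(\<integral>t. norm (F (t - s)) \<partial>lborel) = (\<integral>t. norm (F t) \<partial>lborel)" for s
    using lborel_integral_real_affine[of 1 "\<lambda>t. norm (F t)" "-s"] by (simp add: algebra_simps)
  have int: "integrable (lborel \<Otimes>\<^sub>M lborel) (\<lambda>(s, t). F (t - s) * G s)"
  proof (rule lborel_pair.Fubini_integrable)
    show "integrable lborel (\<lambda>s. \<integral>t. norm (case (s, t) of (s, t) \<Rightarrow> F (t - s) * G s) \<partial>lborel)"
      using G transn by (auto simp: norm_mult integrable_norm)
    show "AE s in lborel. integrable lborel (\<lambda>t. case (s, t) of (s, t) \<Rightarrow> F (t - s) * G s)"
      using trans by auto
  qed measurable
  show "integrable lborel (\<lambda>t. \<integral>s. F (t - s) * G s \<partial>lborel)"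
    using lborel_pair.integrable_snd[OF int] by simp
  have "(\<integral>t. (\<integral>s. F (t - s) * G s \<partial>lborel) \<partial>lborel) = (\<integral>s. (\<integral>t. F (t - s) * G s \<partial>lborel) \<partial>lborel)"
    by (rule lborel_pair.Fubini_integral[OF int])
  also have "\<dots> = (\<integral>t. F t \<partial>lborel) * (\<integral>t. G t \<partial>lborel)"
    by (simp add: trans)
  finally show "(\<integral>t. (\<integral>s. F (t - s) * G s \<partial>lborel) \<partial>lborel) = (\<integral>t. F t \<partial>lborel) * (\<integral>t. G t \<partial>lborel)" .
qed

text \<open>The weight splits as exp (-z t) = exp (-z (t - s)) exp (-z s), so the claim is the
  integral of a convolution of the two weighted functions. Integrals run over the whole line;
  causality is encoded by functions that vanish for t \<le> 0.\<close>

lemma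
  fixes f g :: "real \<Rightarrow> complex"
  assumes f: "integrable lborel (\<lambda>t. of_real (exp (- (z * t))) * f t)"
    and g: "integrable lborel (\<lambda>t. of_real (exp (- (z * t))) * g t)"
  shows integrable_laplace_convolution:
      "integrable lborel (\<lambda>t. of_real (exp (- (z * t))) * (\<integral>s. f (t - s) * g s \<partial>lborel))"
    and laplace_convolution:
      "(\<integral>t. of_real (exp (- (z * t))) * (\<integral>s. f (t - s) * g s \<partial>lborel) \<partial>lborel)
        = (\<integral>t. of_real (exp (- (z * t))) * f t \<partial>lborel) * (\<integral>t. of_real (exp (- (z * t))) * g t \<partial>lborel)"
proof -
  let ?F = "\<lambda>t. of_real (exp (- (z * t))) * f t" and ?G = "\<lambda>t. of_real (exp (- (z * t))) * g t"
  have "?F (t - s) * ?G s = of_real (exp (- (z * t))) * (f (t - s) * g s)" for s t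
  proof -
    have "complex_of_real (exp (- (z * (t - s)))) * of_real (exp (- (z * s))) = of_real (exp (- (z * t)))"
      by (simp flip: of_real_mult exp_add add: algebra_simps)
    then show ?thesis by (metis mult.assoc mult.commute)
  qed
  then have eq: "(\<integral>s. ?F (t - s) * ?G s \<partial>lborel) = of_real (exp (- (z * t))) * (\<integral>s. f (t - s) * g s \<partial>lborel)" for t
    by (simp only: integral_mult_right_zero)
  show "integrable lborel (\<lambda>t. of_real (exp (- (z * t))) * (\<integral>s. f (t - s) * g s \<partial>lborel))"
    using integrable_convolution[OF f g] unfolding eq .
  show "(\<integral>t. of_real (exp (- (z * t))) * (\<integral>s. f (t - s) * g s \<partial>lborel) \<partial>lborel)
        = (\<integral>t. ?F t \<partial>lborel) * (\<integral>t. ?G t \<partial>lborel)"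
    using integral_convolution[OF f g] unfolding eq .
qed

subsection \<open>The kernel and its primitive\<close>

lemma Psi_pos: "0 < z \<Longrightarrow> 0 < Psi \<alpha>1 \<alpha>2 c (z::real)"
  by (simp add: Psi_def)

text \<open>Multiplying by z^\<alpha>1 leaves the exponential of c (\<alpha>1 - \<alpha>2) ln z / (c
  + z), which tends to 1. So \<alpha>1 alone governs large z, that is, small times.\<close>

lemma Psi_asymptotics:
  fixes \<alpha>1 \<alpha>2 c :: real
  assumes "0 < c"
  shows "((\<lambda>z. z powr \<alpha>1 * Psi \<alpha>1 \<alpha>2 c z) \<longlongrightarrow> 1) at_top"
proof -
  have "((\<lambda>z. exp (c * (\<alpha>1 - \<alpha>2) * (ln z / (c + z)))) \<longlongrightarrow> exp (c * (\<alpha>1 - \<alpha>2) * 0)) at_top"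
    by (intro tendsto_intros) real_asymp
  moreover have "\<forall>\<^sub>F z in at_top. exp (c * (\<alpha>1 - \<alpha>2) * (ln z / (c + z))) = z powr \<alpha>1 * Psi \<alpha>1 \<alpha>2 c z"
    using eventually_gt_at_top[of 0]
  proof eventually_elim
    case (elim z)
    have "c * (\<alpha>1 - \<alpha>2) * (ln z / (c + z)) = \<alpha>1 * ln z - (\<alpha>2 * c + \<alpha>1 * z) / (c + z) * ln z"
      using elim assms by (simp add: field_simps)
    then show ?case using elim
      by (simp add: Psi_def B_exp_def powr_def exp_add[symmetric])
  qed
  ultimately show ?thesis by (simp add: filterlim_cong)
qed

text \<open>\<open>k\<close> is a representative of \<psi> that is Borel, nonnegative at every point
  and zero for t \<le> 0. These pointwise properties allow time convolutions to be written over the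
  whole line.\<close>

locale volterra_kernel =
  fixes \<alpha>1 \<alpha>2 c :: real and k :: "real \<Rightarrow> real"
  assumes \<alpha>1: "0 < \<alpha>1" "\<alpha>1 < 1" and c: "0 < c"
    and k_meas[measurable]: "k \<in> borel_measurable borel"
    and k_nonneg: "\<And>t. 0 \<le> k t"
    and k_nonpos: "\<And>t. t \<le> 0 \<Longrightarrow> k t = 0"
    and k_laplace_integrable: "\<And>z. 0 < z \<Longrightarrow> integrable lborel (\<lambda>t. exp (- (z * t)) * k t)"
    and k_laplace: "\<And>z. 0 < z \<Longrightarrow> (\<integral>t. exp (- (z * t)) * k t \<partial>lborel) = Psi \<alpha>1 \<alpha>2 c z"
begin

text \<open>Integrating over \<open>{..t}\<close> is the same as integrating over (0, t], because
  \<open>k\<close> vanishes on the nonpositive half-line.\<close>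

definition K :: "real \<Rightarrow> real" where
  "K t = (\<integral>s. indicator {..t} s * k s \<partial>lborel)"

lemma indicator_k_le: "indicator {..t} s * k s \<le> exp t * (exp (- s) * k s)"
proof (cases "s \<le> t")
  case True
  then have "1 \<le> exp t * exp (- s)" by (simp flip: exp_add)
  from mult_right_mono[OF this k_nonneg[of s]] show ?thesis using True by (simp add: mult.assoc)
qed (simp add: k_nonneg)

lemma integrable_indicator_k: "integrable lborel (\<lambda>s. indicator {..t} s * k s)"
  by (rule Bochner_Integration.integrable_bound[where f="\<lambda>s. exp t * (exp (- s) * k s)"])
    (use k_laplace_integrable[of 1] indicator_k_le k_nonneg in \<open>auto simp: abs_mult\<close>)

lemma K_nonneg: "0 \<le> K t"
  unfolding K_def by (intro Bochner_Integration.integral_nonneg) (auto simp: k_nonneg)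

lemma K_nonpos: "t \<le> 0 \<Longrightarrow> K t = 0"
proof -
  assume "t \<le> 0"
  then have "(\<lambda>s. indicator {..t} s * k s) = (\<lambda>s. 0)"
    by (auto simp: fun_eq_iff indicator_def k_nonpos)
  then show ?thesis by (simp add: K_def)
qed

lemma K_mono: "s \<le> t \<Longrightarrow> K s \<le> K t"
  unfolding K_def
  by (intro integral_mono integrable_indicator_k) (auto simp: indicator_def k_nonneg)

text \<open>Along a convergent sequence the integrands converge except at the single point s = t,
  and an upper bound b of the sequence supplies the dominating function.\<close>

lemma K_continuous: "continuous_on UNIV K"
proof (rule continuous_at_imp_continuous_on, rule ballI)
  fix t :: real
  show "isCont K t" unfolding continuous_at_sequentially
  proof (intro allI impI)
    fix x :: "nat \<Rightarrow> real" assume x: "x \<longlonglongrightarrow> t"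
    obtain b where b: "\<And>n. x n \<le> b"
      using convergent_imp_Bseq[OF convergentI[OF x]] by (metis Bseq_def abs_le_D1 real_norm_def)
    have "(\<lambda>n. K (x n)) \<longlonglongrightarrow> K t"
      unfolding K_def
    proof (rule integral_dominated_convergence[where w="\<lambda>s. indicator {..b} s * k s"])
      show "AE s in lborel. (\<lambda>n. indicator {..x n} s * k s) \<longlonglongrightarrow> indicator {..t} s * k s"
        using AE_lborel_singleton[of t]
      proof eventually_elim
        case (elim s)
        have "\<forall>\<^sub>F n in sequentially. indicator {..x n} s * k s = indicator {..t} s * k s"
        proof (cases "s < t")
          case True
          from order_tendstoD(1)[OF x this] show ?thesis
            by eventually_elim (use True in \<open>simp add: indicator_def\<close>)
        next
          case False
          with elim have "t < s" by simp
          from order_tendstoD(2)[OF x this] show ?thesis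
            by eventually_elim (use \<open>t < s\<close> in \<open>simp add: indicator_def\<close>)
        qed
        then show ?case by (rule tendsto_eventually)
      qed
      show "AE s in lborel. norm (indicator {..x n} s * k s) \<le> indicator {..b} s * k s" for n
        using b[of n] by (auto simp: indicator_def k_nonneg)
    qed (auto simp: integrable_indicator_k)
    then show "(K \<circ> x) \<longlonglongrightarrow> K t" by (simp add: comp_def)
  qed
qed

text \<open>The indicator of s \<le> t is at most e exp (-s / t). This is the easy half of a
  Tauberian comparison at z = 1 / t.\<close>

lemma K_le_Psi: "0 < t \<Longrightarrow> K t \<le> exp 1 * Psi \<alpha>1 \<alpha>2 c (1 / t)"
proof -
  assume t: "0 < t"
  have "K t \<le> (\<integral>s. exp 1 * (exp (- (1 / t * s)) * k s) \<partial>lborel)"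
    unfolding K_def
  proof (intro integral_mono integrable_indicator_k integrable_mult_right k_laplace_integrable)
    fix s
    show "indicator {..t} s * k s \<le> exp 1 * (exp (- (1 / t * s)) * k s)"
    proof (cases "s \<le> t")
      case True
      then have "s / t \<le> 1" using t by simp
      then have "1 \<le> exp 1 * exp (- (1 / t * s))" by (simp flip: exp_add)
      from mult_right_mono[OF this k_nonneg[of s]] show ?thesis using True by (simp add: mult.assoc)
    qed (simp add: k_nonneg)
  qed (use t in simp)
  then show ?thesis using k_laplace[of "1 / t"] t by simp
qed

text \<open>The tail \<open>s > t\<close> of the Laplace integral at \<open>z = M / t\<close> costs only
  \<open>exp (- M / 2) * Psi (z / 2)\<close>.\<close>

lemma Psi_le_K:
  assumes "0 < t" "0 < M"
  shows "Psi \<alpha>1 \<alpha>2 c (M / t) - exp (- (M / 2)) * Psi \<alpha>1 \<alpha>2 c (M / t / 2) \<le> K t"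
proof -
  let ?z = "M / t"
  have z: "0 < ?z" using assms by simp
  have "Psi \<alpha>1 \<alpha>2 c ?z
      \<le> (\<integral>s. indicator {..t} s * k s + exp (- (M / 2)) * (exp (- (?z / 2 * s)) * k s) \<partial>lborel)"
    unfolding k_laplace[OF z, symmetric]
  proof (intro integral_mono integrable_indicator_k integrable_mult_right
      Bochner_Integration.integrable_add k_laplace_integrable z)
    fix s
    have "exp (- (?z * s)) \<le> indicator {..t} s + exp (- (M / 2)) * exp (- (?z / 2 * s))" if "0 < s"
    proof (cases "s \<le> t")
      case True
      have "exp (- (?z * s)) \<le> 1" using assms that by simp
      then show ?thesis using True by (simp add: add_increasing2)
    next
      case False
      then have "M / 2 \<le> ?z / 2 * s" using assms by (simp add: field_simps)
      then show ?thesis using False by (simp flip: exp_add)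
    qed
    then show "exp (- (?z * s)) * k s
        \<le> indicator {..t} s * k s + exp (- (M / 2)) * (exp (- (?z / 2 * s)) * k s)"
    proof (cases "0 < s")
      case True
      from mult_right_mono[OF \<open>0 < s \<Longrightarrow> _\<close>[OF this] k_nonneg[of s]] show ?thesis
        by (simp add: algebra_simps)
    qed (simp add: k_nonpos)
  qed (use z in simp_all)
  also have "\<dots> = K t + exp (- (M / 2)) * Psi \<alpha>1 \<alpha>2 c (?z / 2)"
    using k_laplace[of "?z / 2"] k_laplace_integrable[of "?z / 2"] z
    by (subst Bochner_Integration.integral_add) (auto simp: integrable_indicator_k K_def)
  finally show ?thesis by simp
qed

lemma K_asymptotics:
  obtains c1 c2 t1 where "0 < c1" "0 < c2" "0 < t1"
    "\<And>t. 0 < t \<Longrightarrow> t \<le> t1 \<Longrightarrow> c1 * t powr \<alpha>1 \<le> K t"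
    "\<And>t. 0 < t \<Longrightarrow> t \<le> t1 \<Longrightarrow> K t \<le> c2 * t powr \<alpha>1"
proof -
  have "\<forall>\<^sub>F z in at_top. 1/2 < z powr \<alpha>1 * Psi \<alpha>1 \<alpha>2 c z \<and> z powr \<alpha>1 * Psi \<alpha>1 \<alpha>2 c z < 2"
    using order_tendstoD(1)[OF Psi_asymptotics[OF c, of \<alpha>1 \<alpha>2], of "1/2"]
      order_tendstoD(2)[OF Psi_asymptotics[OF c, of \<alpha>1 \<alpha>2], of 2] by (intro eventually_conj) auto
  then obtain z1 where z1: "\<And>z. z1 \<le> z \<Longrightarrow> 1/2 < z powr \<alpha>1 * Psi \<alpha>1 \<alpha>2 c z"
      "\<And>z. z1 \<le> z \<Longrightarrow> z powr \<alpha>1 * Psi \<alpha>1 \<alpha>2 c z < 2"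
    by (auto simp: eventually_at_top_linorder)
  define z0 where "z0 = max z1 1"
  have z0: "0 < z0" by (simp add: z0_def)
  have lo: "1/2 * z powr (- \<alpha>1) \<le> Psi \<alpha>1 \<alpha>2 c z"
    and up: "Psi \<alpha>1 \<alpha>2 c z \<le> 2 * z powr (- \<alpha>1)" if "z0 \<le> z" for z
  proof -
    have "z1 \<le> z" "0 < z" using that by (auto simp: z0_def)
    then have "1/2 < z powr \<alpha>1 * Psi \<alpha>1 \<alpha>2 c z" "z powr \<alpha>1 * Psi \<alpha>1 \<alpha>2 c z < 2" "0 < z powr \<alpha>1"
      using z1 by auto
    then show "1/2 * z powr (- \<alpha>1) \<le> Psi \<alpha>1 \<alpha>2 c z" "Psi \<alpha>1 \<alpha>2 c z \<le> 2 * z powr (- \<alpha>1)"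
      by (auto simp: powr_minus field_simps)
  qed
  \<comment> \<open>The value makes exp (-M / 2) = 1/16. From Psi z \<ge> z^(-\<alpha>1) / 2 and Psi
    (z / 2) \<le> 4 z^(-\<alpha>1), the tail takes at most half of the main term, and z^(-\<alpha>1)
    / 4 remains. Moreover M \<ge> 2, so z / 2 = M / (2 t) is still at least 1 / t.\<close>
  define M where "M = 2 * ln (16::real)"
  have M: "2 \<le> M" using ln_ge_iff[of 16 1] exp_le by (simp add: M_def)
  have eM: "exp (- (M / 2)) = 1 / 16" by (simp add: M_def exp_minus)
  show thesis
  proof (rule that[of "M powr (- \<alpha>1) / 4" "2 * exp 1" "1 / z0"])
    fix t assume t: "0 < t" "t \<le> 1 / z0"
    then have z: "z0 \<le> 1 / t" using z0 by (simp add: field_simps)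
    have "K t \<le> exp 1 * Psi \<alpha>1 \<alpha>2 c (1 / t)" by (rule K_le_Psi[OF t(1)])
    also have "\<dots> \<le> exp 1 * (2 * (1 / t) powr (- \<alpha>1))" by (rule mult_left_mono[OF up[OF z]]) simp
    also have "\<dots> = 2 * exp 1 * t powr \<alpha>1" using t by (simp add: powr_divide powr_minus)
    finally show "K t \<le> 2 * exp 1 * t powr \<alpha>1" .
    have zM: "z0 \<le> M / t" "z0 \<le> M / t / 2" using z M t by (auto intro: order_trans simp: divide_simps)
    have "(M / t / 2) powr (- \<alpha>1) = 2 powr \<alpha>1 * (M / t) powr (- \<alpha>1)"
      using M t by (simp add: powr_divide powr_minus powr_mult)
    moreover have "2 powr \<alpha>1 \<le> 2 powr (1::real)" using \<alpha>1 by (intro powr_mono) auto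
    ultimately have "(M / t / 2) powr (- \<alpha>1) \<le> 2 * (M / t) powr (- \<alpha>1)"
      by (simp add: mult_right_mono)
    then have "1/4 * (M / t) powr (- \<alpha>1) \<le> K t"
      using Psi_le_K[OF t(1), of M] M lo[OF zM(1)] up[OF zM(2)] unfolding eM by linarith
    moreover have "(M / t) powr (- \<alpha>1) = M powr (- \<alpha>1) * t powr \<alpha>1"
      using M t by (simp add: powr_divide powr_minus field_simps)
    ultimately show "M powr (- \<alpha>1) / 4 * t powr \<alpha>1 \<le> K t" by simp
  qed (use z0 M in auto)
qed

lemma K_pos: "0 < t \<Longrightarrow> 0 < K t"
proof -
  assume t: "0 < t"
  obtain c1 c2 t1 where "0 < c1" "0 < t1" "\<And>t. 0 < t \<Longrightarrow> t \<le> t1 \<Longrightarrow> c1 * t powr \<alpha>1 \<le> K t"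
    using K_asymptotics by metis
  moreover have "0 < min t t1" "min t t1 \<le> t1" using t \<open>0 < t1\<close> by auto
  ultimately have "c1 * min t t1 powr \<alpha>1 \<le> K (min t t1)" by blast
  moreover have "0 < c1 * min t t1 powr \<alpha>1" using \<open>0 < c1\<close> \<open>0 < min t t1\<close>
    by (intro mult_pos_pos) (simp_all add: less_le)
  ultimately have "0 < K (min t t1)" by linarith
  also have "\<dots> \<le> K t" by (rule K_mono) simp
  finally show ?thesis .
qed

text \<open>Supplies the exponential weight in the uniqueness argument for mild solutions.\<close>

lemma Psi_tendsto_0: "((Psi \<alpha>1 \<alpha>2 c :: real \<Rightarrow> real) \<longlongrightarrow> 0) at_top"
proof -
  have "((\<lambda>z. z powr (- \<alpha>1) * (z powr \<alpha>1 * Psi \<alpha>1 \<alpha>2 c z)) \<longlongrightarrow> 0 * 1) at_top"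
    by (intro tendsto_mult Psi_asymptotics c tendsto_neg_powr) (use \<alpha>1 in \<open>auto intro: filterlim_ident\<close>)
  moreover have "\<forall>\<^sub>F z in at_top. z powr (- \<alpha>1) * (z powr \<alpha>1 * Psi \<alpha>1 \<alpha>2 c z) = Psi \<alpha>1 \<alpha>2 c z"
    using eventually_gt_at_top[of 0] by eventually_elim (simp add: powr_minus field_simps)
  ultimately have "((Psi \<alpha>1 \<alpha>2 c :: real \<Rightarrow> real) \<longlongrightarrow> 0 * 1) at_top" by (rule Lim_transform_eventually)
  then show ?thesis by simp
qed

end

text \<open>Turns an identity between integrals over the completed measure into one for a Borel
  function on the line, so that product measures become available. The values \<open>r z\<close>
  have to be nonzero: the Bochner integral of a nonintegrable function is 0, so a nonzero value is
  what proves integrability.\<close>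

lemma laplace_borel_version:
  fixes g :: "real \<Rightarrow> complex" and r :: "real \<Rightarrow> complex"
  assumes lap: "\<forall>z>b. (LINT t:{0<..}|lebesgue. of_real (exp (- (z * t))) * g t) = r z \<and> r z \<noteq> 0"
  shows "\<exists>h \<in> borel_measurable borel. (\<forall>t\<le>0. h t = 0) \<and>
    (AE t in lebesgue. 0 < t \<longrightarrow> g t = h t) \<and>
    (\<forall>z>b. integrable lborel (\<lambda>t. of_real (exp (- (z * t))) * h t) \<and>
      (\<integral>t. of_real (exp (- (z * t))) * h t \<partial>lborel) = r z)"
proof -
  have r: "(LINT t:{0<..}|lebesgue. of_real (exp (- (z * t))) * g t) = r z"
    and nz: "r z \<noteq> 0" if "b < z" for z
    using lap that by auto
  have int: "integrable lebesgue (\<lambda>t. indicator {0<..} t *\<^sub>R (of_real (exp (- (z * t))) * g t))" if "b < z" for z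
    using r[OF that] nz[OF that] not_integrable_integral_eq unfolding set_lebesgue_integral_def by fastforce
  define G where "G t = indicator {0<..} t *\<^sub>R g t" for t
  have eqG: "indicator {0<..} t *\<^sub>R (of_real (exp (- (z * t))) * g t) = of_real (exp (- (z * t))) * G t" for z t
    by (simp add: G_def)
  \<comment> \<open>Removing the weight at the single point z = b + 1 shows that G itself is
    Lebesgue measurable.\<close>
  have "(\<lambda>t. of_real (exp ((b + 1) * t)) * (of_real (exp (- ((b + 1) * t))) * G t)) \<in> borel_measurable lebesgue"
    using borel_measurable_integrable[OF int[of "b + 1"]] unfolding eqG
    by (auto intro!: borel_measurable_times measurable_completion[of "\<lambda>t. complex_of_real (exp ((b + 1) * t))" lborel])
  also have "(\<lambda>t. of_real (exp ((b + 1) * t)) * (of_real (exp (- ((b + 1) * t))) * G t)) = G"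
    by (simp flip: mult.assoc of_real_mult exp_add)
  finally have G: "G \<in> borel_measurable lebesgue" .
  obtain h1 where h1: "h1 \<in> borel_measurable lborel" "AE t in lborel. Re (G t) = h1 t"
    using completion_ex_borel_measurable_real[of "\<lambda>t. Re (G t)" lborel] G by auto
  obtain h2 where h2: "h2 \<in> borel_measurable lborel" "AE t in lborel. Im (G t) = h2 t"
    using completion_ex_borel_measurable_real[of "\<lambda>t. Im (G t)" lborel] G by auto
  define h where "h t = indicator {0<..} t *\<^sub>R Complex (h1 t) (h2 t)" for t
  have [measurable]: "h1 \<in> borel_measurable borel" "h2 \<in> borel_measurable borel" using h1 h2 by auto
  have hm[measurable]: "h \<in> borel_measurable borel"
    unfolding h_def Complex_eq by measurable
  have ae: "AE t in lebesgue. G t = h t"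
    using AE_completion[OF h1(2)] AE_completion[OF h2(2)]
    by eventually_elim (auto simp: G_def h_def indicator_def complex_eq_iff)
  have aez: "AE t in lebesgue. of_real (exp (- (z * t))) * G t = of_real (exp (- (z * t))) * h t" for z
    using ae by eventually_elim simp
  have mz: "(\<lambda>t. of_real (exp (- (z * t))) * h t) \<in> borel_measurable lebesgue" for z
    by (rule measurable_completion) simp
  have mGz: "(\<lambda>t. of_real (exp (- (z * t))) * G t) \<in> borel_measurable lebesgue" if "b < z" for z
    using int[OF that] unfolding eqG by auto
  show ?thesis
  proof (intro bexI[of _ h] conjI allI impI)
    show "h \<in> borel_measurable borel" by simp
    show "h t = 0" if "t \<le> 0" for t using that by (simp add: h_def)
    show "AE t in lebesgue. 0 < t \<longrightarrow> g t = h t"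
      using ae by eventually_elim (auto simp: G_def)
    fix z assume z: "b < z"
    have "integrable lebesgue (\<lambda>t. of_real (exp (- (z * t))) * h t)"
      using int[OF z] unfolding eqG by (subst integrable_cong_AE[OF mz mGz[OF z]]) (use aez[of z] in auto)
    then show "integrable lborel (\<lambda>t. of_real (exp (- (z * t))) * h t)"
      by (subst (asm) integrable_completion) auto
    have "r z = (\<integral>t. of_real (exp (- (z * t))) * h t \<partial>lebesgue)"
      unfolding r[OF z, symmetric] set_lebesgue_integral_def eqG
      by (rule integral_cong_AE[OF mGz[OF z] mz aez])
    then show "(\<integral>t. of_real (exp (- (z * t))) * h t \<partial>lborel) = r z"
      by (subst (asm) integral_completion) auto
  qed
qed

subsection \<open>The space-time measure of the kernel\<close>

text \<open>At frequency 0 the Fourier transform of \<open>Y t\<close> is its total mass, and the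
  prescribed Laplace transform is 1 / (1 / \<Psi>) = \<Psi>. So the mass is a nonnegative function
  with the transform of \<psi>, and uniqueness identifies the two.\<close>

lemma total_mass_kernel:
  fixes Y :: "real \<Rightarrow> (real ^ 'n) measure"
  assumes \<alpha>1: "0 < \<alpha>1" "\<alpha>1 < 1" and c: "0 < c"
    and \<psi>: "Psi_kernel \<alpha>1 \<alpha>2 c \<psi>" and Y: "Y_family \<alpha>1 \<alpha>2 c Y"
  obtains k where "volterra_kernel \<alpha>1 \<alpha>2 c k"
    "AE t in lebesgue. 0 < t \<longrightarrow>
      finite_measure (Y t) \<and> sets (Y t) = sets borel \<and> emeasure (Y t) UNIV = ennreal (k t)"
    "K_fun \<psi> = volterra_kernel.K k"
proof -
  have lapY: "(LINT t:{0<..}|lebesgue. of_real (exp (- (z * t))) * fourier_measure (Y t) 0)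
      = of_real (Psi \<alpha>1 \<alpha>2 c z)" if "0 < z" for z
    using Y that unfolding Y_family_def by (simp add: inverse_eq_divide)
  have nzY: "complex_of_real (Psi \<alpha>1 \<alpha>2 c z) \<noteq> 0" if "0 < z" for z
    using Psi_pos[OF that, of \<alpha>1 \<alpha>2 c] by simp
  have "\<forall>z>0. (LINT t:{0<..}|lebesgue. of_real (exp (- (z * t))) * fourier_measure (Y t) 0)
        = complex_of_real (Psi \<alpha>1 \<alpha>2 c z) \<and> complex_of_real (Psi \<alpha>1 \<alpha>2 c z) \<noteq> 0"
    using lapY nzY by blast
  from laplace_borel_version[OF this] obtain h where h0: "h \<in> borel_measurable borel"
    "(\<forall>t\<le>0. h t = 0) \<and> (AE t in lebesgue. 0 < t \<longrightarrow> fourier_measure (Y t) 0 = h t) \<and>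
      (\<forall>z>0. integrable lborel (\<lambda>t. of_real (exp (- (z * t))) * h t) \<and>
        (\<integral>t. of_real (exp (- (z * t))) * h t \<partial>lborel) = complex_of_real (Psi \<alpha>1 \<alpha>2 c z))"
    by (rule bexE)
  then have h: "h \<in> borel_measurable borel" "\<And>t. t \<le> 0 \<Longrightarrow> h t = 0"
    "AE t in lebesgue. 0 < t \<longrightarrow> fourier_measure (Y t) 0 = h t"
    "\<And>z. 0 < z \<Longrightarrow> integrable lborel (\<lambda>t. of_real (exp (- (z * t))) * h t)"
    "\<And>z. 0 < z \<Longrightarrow> (\<integral>t. of_real (exp (- (z * t))) * h t \<partial>lborel) = of_real (Psi \<alpha>1 \<alpha>2 c z)"
    by blast+
  have [measurable]: "h \<in> borel_measurable borel" by fact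
  \<comment> \<open>The cut at 0 changes \<open>Re (h t)\<close> only on a null set, where h t may
    fail to be a mass, and makes k nonnegative at every point.\<close>
  define k where "k t = max 0 (Re (h t))" for t
  have fin: "AE t in lebesgue. 0 < t \<longrightarrow> finite_measure (Y t) \<and> sets (Y t) = sets borel"
    using Y by (simp add: Y_family_def)
  have mass: "AE t in lebesgue. (0 < t \<longrightarrow>
      finite_measure (Y t) \<and> sets (Y t) = sets borel \<and> emeasure (Y t) UNIV = ennreal (k t)) \<and> Re (h t) = k t"
    using fin h(3)
  proof eventually_elim
    case (elim t)
    show ?case
    proof (cases "0 < t")
      case True
      then interpret finite_measure "Y t" using elim by simp
      have "space (Y t) = UNIV" using elim True by (metis sets_eq_imp_space_eq space_borel)
      then have "fourier_measure (Y t) 0 = of_real (measure (Y t) UNIV)"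
        by (simp add: fourier_measure_def scaleR_conv_of_real)
      then have "h t = of_real (measure (Y t) UNIV)" using elim True by simp
      then have "Re (h t) = measure (Y t) UNIV" by simp
      then show ?thesis using elim True by (simp add: k_def emeasure_eq_measure)
    qed (simp add: h k_def)
  qed
  have massl: "AE t in lborel. Re (h t) = k t"
  proof -
    have "AE t in lebesgue. Re (h t) = k t" using mass by eventually_elim simp
    then show ?thesis by (simp add: AE_completion_iff)
  qed
  have [measurable]: "k \<in> borel_measurable borel" unfolding k_def by measurable
  have ki: "integrable lborel (\<lambda>t. exp (- (z * t)) * k t)"
    and kp: "(\<integral>t. exp (- (z * t)) * k t \<partial>lborel) = Psi \<alpha>1 \<alpha>2 c z" if "0 < z" for z
  proof -
    have ae: "AE t in lborel. Re (of_real (exp (- (z * t))) * h t) = exp (- (z * t)) * k t"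
      using massl by eventually_elim simp
    show "integrable lborel (\<lambda>t. exp (- (z * t)) * k t)"
      using integrable_Re[OF h(4)[OF that]] by (subst integrable_cong_AE[OF _ _ ae, symmetric]) auto
    have "(\<integral>t. exp (- (z * t)) * k t \<partial>lborel) = (\<integral>t. Re (of_real (exp (- (z * t))) * h t) \<partial>lborel)"
      by (rule integral_cong_AE[symmetric, OF _ _ ae]) auto
    also have "\<dots> = Psi \<alpha>1 \<alpha>2 c z" using h(5)[OF that] by (subst integral_Re[OF h(4)[OF that]]) simp
    finally show "(\<integral>t. exp (- (z * t)) * k t \<partial>lborel) = Psi \<alpha>1 \<alpha>2 c z" .
  qed
  interpret volterra_kernel \<alpha>1 \<alpha>2 c k
    by standard (use \<alpha>1 c ki kp h(2) in \<open>auto simp: k_def\<close>)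
  obtain M \<sigma> t0 where \<sigma>: "\<And>z::complex. \<sigma> < Re z \<Longrightarrow>
      (LINT t:{0<..}|lebesgue. exp (- (z * of_real t)) * of_real (\<psi> t)) = Psi \<alpha>1 \<alpha>2 c z"
    using \<psi> unfolding Psi_kernel_def by blast
  \<comment> \<open>Above \<sigma> the transform of \<psi> is given; above 0 that of k is, and there
    the complex \<Psi> reduces to the positive real one.\<close>
  define b where "b = max \<sigma> 0"
  have lap\<psi>: "(LINT t:{0<..}|lebesgue. of_real (exp (- (z * t))) * of_real (\<psi> t)) = complex_of_real (Psi \<alpha>1 \<alpha>2 c z)"
    if "b < z" for z
    using \<sigma>[of "of_real z"] Psi_of_real[of z \<alpha>1 \<alpha>2 c] that by (simp add: b_def exp_of_real[symmetric])
  have nz\<psi>: "complex_of_real (Psi \<alpha>1 \<alpha>2 c z) \<noteq> 0" if "b < z" for z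
    using Psi_pos[of z \<alpha>1 \<alpha>2 c] that by (simp add: b_def)
  have "\<forall>z>b. (LINT t:{0<..}|lebesgue. of_real (exp (- (z * t))) * of_real (\<psi> t))
        = complex_of_real (Psi \<alpha>1 \<alpha>2 c z) \<and> complex_of_real (Psi \<alpha>1 \<alpha>2 c z) \<noteq> 0"
    using lap\<psi> nz\<psi> by blast
  from laplace_borel_version[OF this] obtain g where g0: "g \<in> borel_measurable borel"
    "(\<forall>t\<le>0. g t = 0) \<and> (AE t in lebesgue. 0 < t \<longrightarrow> of_real (\<psi> t) = g t) \<and>
      (\<forall>z>b. integrable lborel (\<lambda>t. of_real (exp (- (z * t))) * g t) \<and>
        (\<integral>t. of_real (exp (- (z * t))) * g t \<partial>lborel) = complex_of_real (Psi \<alpha>1 \<alpha>2 c z))"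
    by (rule bexE)
  then have g: "g \<in> borel_measurable borel" "\<And>t. t \<le> 0 \<Longrightarrow> g t = 0"
    "AE t in lebesgue. 0 < t \<longrightarrow> of_real (\<psi> t) = g t"
    "\<And>z. b < z \<Longrightarrow> integrable lborel (\<lambda>t. of_real (exp (- (z * t))) * g t)"
    "\<And>z. b < z \<Longrightarrow> (\<integral>t. of_real (exp (- (z * t))) * g t \<partial>lborel) = of_real (Psi \<alpha>1 \<alpha>2 c z)"
    by blast+
  have "AE t in lborel. g t - of_real (k t) = 0"
  proof (rule laplace_transform_unique_complex[of b])
    fix z assume z: "b < z"
    then have z0: "0 < z" by (simp add: b_def)
    have i: "integrable lborel (\<lambda>t. complex_of_real (exp (- (z * t)) * k t))"
      using k_laplace_integrable[OF z0] by (rule integrable_of_real)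
    show "integrable lborel (\<lambda>t. of_real (exp (- (z * t))) * (g t - of_real (k t)))"
      using Bochner_Integration.integrable_diff[OF g(4)[OF z] i] by (simp add: right_diff_distrib)
    show "(\<integral>t. of_real (exp (- (z * t))) * (g t - of_real (k t)) \<partial>lborel) = 0"
      using Bochner_Integration.integral_diff[OF g(4)[OF z] i] k_laplace[OF z0]
      by (simp add: right_diff_distrib g(5)[OF z] flip: of_real_mult)
  qed (simp add: g k_nonpos)
  then have "AE t in lebesgue. g t - of_real (k t) = 0" by (rule AE_completion)
  then have \<psi>k: "AE t in lebesgue. 0 < t \<longrightarrow> \<psi> t = k t"
    using g(3) by eventually_elim auto
  have "K_fun \<psi> t = K t" for t
  proof -
    have "K_fun \<psi> t = (\<integral>s. indicator {..t} s * k s \<partial>lebesgue)"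
      unfolding K_fun_def set_lebesgue_integral_def
    proof (rule integral_cong_AE)
      have m: "continuous_on ({0<..} \<inter> {0<..t}) \<psi>"
        using \<psi> unfolding Psi_kernel_def by (auto intro: continuous_on_subset)
      then have "(\<lambda>s. indicator ({0<..} \<inter> {0<..t}) s *\<^sub>R \<psi> s) \<in> borel_measurable borel"
        by (intro borel_measurable_continuous_on_indicator) auto
      also have "{0<..} \<inter> {0<..t} = {0<..t}" by auto
      finally show "(\<lambda>s. indicator {0<..t} s *\<^sub>R \<psi> s) \<in> borel_measurable lebesgue"
        by (intro measurable_completion) simp
      show "(\<lambda>s. indicator {..t} s * k s) \<in> borel_measurable lebesgue"
        by (intro measurable_completion) simp
      show "AE s in lebesgue. indicator {0<..t} s *\<^sub>R \<psi> s = indicator {..t} s * k s"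
        using \<psi>k by eventually_elim (auto simp: indicator_def k_nonpos)
    qed
    also have "\<dots> = K t" unfolding K_def by (rule integral_completion) simp
    finally show ?thesis .
  qed
  then have "K_fun \<psi> = K" by (simp add: fun_eq_iff)
  moreover have "AE t in lebesgue. 0 < t \<longrightarrow>
      finite_measure (Y t) \<and> sets (Y t) = sets borel \<and> emeasure (Y t) UNIV = ennreal (k t)"
    using mass by eventually_elim simp
  ultimately show thesis by (intro that[OF volterra_kernel_axioms])
qed

text \<open>\<open>Y t\<close> is written as its mass \<open>k t\<close> times a measure of mass at
  most 1, because measurability of a family of measures is expressed in the space of subprobability
  measures, and the masses \<open>k t\<close> need not be bounded. The source of
  \<open>\<kappa>\<close> is \<open>lebesgue\<close> because \<open>Y\<close> depends on t
  measurably in the completed sense only.\<close>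

locale spacetime_kernel = volterra_kernel \<alpha>1 \<alpha>2 c k
  for \<alpha>1 \<alpha>2 c :: real and k :: "real \<Rightarrow> real" +
  fixes Y :: "real \<Rightarrow> (real ^ 'n) measure" and \<kappa> :: "real \<Rightarrow> (real ^ 'n) measure"
  assumes \<kappa>_meas[measurable]: "\<kappa> \<in> lebesgue \<rightarrow>\<^sub>M subprob_algebra borel"
    and Y_eq: "AE t in lebesgue. 0 < t \<longrightarrow> Y t = density (\<kappa> t) (\<lambda>_. ennreal (k t))"

lemma spacetime_kernel_exists:
  fixes Y :: "real \<Rightarrow> (real ^ 'n) measure"
  assumes "volterra_kernel \<alpha>1 \<alpha>2 c k" and Y: "Y_family \<alpha>1 \<alpha>2 c Y"
    and ae: "AE t in lebesgue. 0 < t \<longrightarrow>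
      finite_measure (Y t) \<and> sets (Y t) = sets borel \<and> emeasure (Y t) UNIV = ennreal (k t)"
  obtains \<kappa> where "spacetime_kernel \<alpha>1 \<alpha>2 c k Y \<kappa>"
proof -
  interpret volterra_kernel \<alpha>1 \<alpha>2 c k by fact
  have ae': "AE t in lebesgue. \<not> (t \<le> 0 \<or> k t = 0) \<longrightarrow>
      finite_measure (Y t) \<and> sets (Y t) = sets borel \<and> emeasure (Y t) UNIV = ennreal (k t)"
    using ae by eventually_elim auto
  then obtain N where N: "N \<in> null_sets lebesgue"
    "{t \<in> space lebesgue. \<not> (\<not> (t \<le> 0 \<or> k t = 0) \<longrightarrow>
      finite_measure (Y t) \<and> sets (Y t) = sets borel \<and> emeasure (Y t) UNIV = ennreal (k t))} \<subseteq> N"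
    unfolding eventually_ae_filter by blast
  \<comment> \<open>At these times \<open>\<kappa> t\<close> is the zero measure. Where
    \<open>k t = 0\<close> nothing is lost, since outside N a measure of total mass 0 is itself 0; N
    is null, and only t > 0 enters the conclusion.\<close>
  define bad where "bad = N \<union> {t. t \<le> 0 \<or> k t = 0}"
  have bad_sets: "bad \<in> sets lebesgue"
  proof -
    have "{t. t \<le> 0 \<or> k t = 0} \<in> sets lborel" by simp
    then show ?thesis using N(1) unfolding bad_def by (auto intro: sets_completionI_sets)
  qed
  define \<kappa> where "\<kappa> t = (if t \<in> bad then null_measure borel else density (Y t) (\<lambda>_. ennreal (1 / k t)))" for t
  have good: "finite_measure (Y t)" "sets (Y t) = sets borel" "emeasure (Y t) UNIV = ennreal (k t)"
      "0 < t" "0 < k t" if "t \<notin> bad" for t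
    using that N(2) k_nonneg[of t] by (auto simp: bad_def less_le)
  have em: "emeasure (\<kappa> t) E = ennreal (1 / k t) * emeasure (Y t) E"
    if "E \<in> sets borel" "t \<notin> bad" for t E
    using that good[OF that(2)] by (simp add: \<kappa>_def emeasure_density_const)
  have "\<kappa> \<in> lebesgue \<rightarrow>\<^sub>M subprob_algebra borel"
  proof (rule measurable_subprob_algebra)
    fix t :: real
    show s: "sets (\<kappa> t) = sets borel" using good[of t] by (simp add: \<kappa>_def)
    then have sp: "space (\<kappa> t) = UNIV" by (metis sets_eq_imp_space_eq space_borel)
    show "subprob_space (\<kappa> t)"
    proof (rule subprob_spaceI)
      show "emeasure (\<kappa> t) (space (\<kappa> t)) \<le> 1"
        using em[of UNIV t] good[of t] unfolding sp
        by (cases "t \<in> bad") (auto simp: \<kappa>_def simp flip: ennreal_mult)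
    qed (simp add: sp)
  next
    fix E :: "(real ^ 'n) set" assume E: "E \<in> sets borel"
    have "(\<lambda>t. emeasure (\<kappa> t) E) = (\<lambda>t. if t \<in> bad then 0 else ennreal (1 / k t) * (indicator {0<..} t * emeasure (Y t) E))"
      using em[OF E] good(4) by (auto simp: fun_eq_iff \<kappa>_def)
    moreover have "(\<lambda>t. indicator {0<..} t * emeasure (Y t) E) \<in> borel_measurable lebesgue"
    proof -
      have "(\<lambda>t. emeasure (Y t) E) \<in> borel_measurable (lebesgue_on {0<..})"
        using Y E unfolding Y_family_def by blast
      then show ?thesis
        by (subst (asm) borel_measurable_restrict_space_iff_ennreal) (auto simp: mult.commute)
    qed
    moreover have "(\<lambda>t. ennreal (1 / k t)) \<in> borel_measurable lebesgue"
      by (rule measurable_completion) simp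
    ultimately show "(\<lambda>t. emeasure (\<kappa> t) E) \<in> borel_measurable lebesgue"
      using bad_sets by (auto intro!: measurable_If_set borel_measurable_times)
  qed
  moreover have "AE t in lebesgue. 0 < t \<longrightarrow> Y t = density (\<kappa> t) (\<lambda>_. ennreal (k t))"
    using ae AE_not_in[OF N(1)]
  proof eventually_elim
    case (elim t)
    show ?case
    proof
    assume "0 < t"
    then have Yt: "finite_measure (Y t)" "sets (Y t) = sets borel" "emeasure (Y t) UNIV = ennreal (k t)"
      using elim by auto
    show "Y t = density (\<kappa> t) (\<lambda>_. ennreal (k t))"
    proof (rule measure_eqI)
      show "sets (Y t) = sets (density (\<kappa> t) (\<lambda>_. ennreal (k t)))"
        using Yt by (simp add: \<kappa>_def)
      fix E assume "E \<in> sets (Y t)"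
      then have E: "E \<in> sets borel" using Yt by simp
      show "emeasure (Y t) E = emeasure (density (\<kappa> t) (\<lambda>_. ennreal (k t))) E"
      proof (cases "k t = 0")
        case True
        then have "emeasure (Y t) E \<le> 0" using Yt emeasure_mono[of E UNIV "Y t"] by (auto simp: sets_eq_imp_space_eq)
        then show ?thesis using True E by (simp add: emeasure_density_const \<kappa>_def Yt)
      next
        case False
        then have nb: "t \<notin> bad" using elim \<open>0 < t\<close> by (auto simp: bad_def)
        have kt: "0 < k t" using False k_nonneg[of t] by simp
        have "ennreal (k t) * (ennreal (1 / k t) * emeasure (Y t) E) = emeasure (Y t) E"
          using kt by (simp flip: mult.assoc ennreal_mult)
        then show ?thesis using em[OF E nb] E nb Yt
          by (simp add: emeasure_density_const \<kappa>_def)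
      qed
    qed
    qed
  qed
  ultimately show thesis
    by (intro that) (simp add: spacetime_kernel_def spacetime_kernel_axioms_def volterra_kernel_axioms)
qed

context spacetime_kernel begin

lemma sets_\<kappa>[measurable_cong]: "sets (\<kappa> t) = sets borel"
  using measurable_space[OF \<kappa>_meas, of t] by (simp add: space_subprob_algebra)

lemma space_\<kappa>[simp]: "space (\<kappa> t) = UNIV"
  using sets_eq_imp_space_eq[OF sets_\<kappa>] by simp

lemma subprob_\<kappa>: "subprob_space (\<kappa> t)"
  using measurable_space[OF \<kappa>_meas, of t] by (simp add: space_subprob_algebra)

text \<open>The identity comes from an equality of measures, so one exceptional set of times serves
  all integrands, in particular integrands that vary with t.\<close>

lemma Y_integral:
  "AE t in lebesgue. 0 < t \<longrightarrow> (\<forall>f :: real ^ 'n \<Rightarrow> 'b :: {banach, second_countable_topology}.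
     f \<in> borel_measurable borel \<longrightarrow> (LINT y|Y t. f y) = k t *\<^sub>R (LINT y|\<kappa> t. f y))"
  using Y_eq
proof eventually_elim
  case (elim t)
  show ?case
  proof (intro impI allI)
    fix f :: "real ^ 'n \<Rightarrow> 'b" assume "0 < t" and [measurable]: "f \<in> borel_measurable borel"
    then show "(LINT y|Y t. f y) = k t *\<^sub>R (LINT y|\<kappa> t. f y)"
      using elim integral_density[of f "\<kappa> t" "\<lambda>_. k t"] by (simp add: k_nonneg)
  qed
qed

text \<open>Density in time of the space-time measure \<open>\<mu>\<close> below, which is
  \<open>k t dt\<close> combined with the fibres \<open>\<kappa> t\<close>. The restriction to (0,
  1] makes both finite, with mass at most \<open>K 1\<close>. \<open>\<mu>0\<close> is a measure on
  Lebesgue sets because of \<open>\<kappa>\<close>, while \<open>\<mu>\<close> is one on Borel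
  sets.\<close>

definition \<mu>0 :: "real measure" where
  "\<mu>0 = density lebesgue (\<lambda>t. ennreal (indicator {0<..1} t * k t))"

definition \<mu> :: "(real \<times> (real ^ 'n)) measure" where
  "\<mu> = \<mu>0 \<bind> (\<lambda>t. distr (\<kappa> t) (borel \<Otimes>\<^sub>M borel) (Pair t))"

lemma k_lebesgue[measurable]: "k \<in> borel_measurable lebesgue"
  by (rule measurable_completion) simp

lemma ind_lebesgue[measurable]: "(\<lambda>t::real. indicator {0<..1} t :: real) \<in> borel_measurable lebesgue"
  by (rule borel_measurable_indicator) (intro sets_completionI_sets, simp add: greaterThanAtMost_borel)

lemma sets_\<mu>0[measurable_cong]: "sets \<mu>0 = sets lebesgue"
  by (simp add: \<mu>0_def)

lemma \<mu>_kernel[measurable]: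
  "(\<lambda>t. distr (\<kappa> t) (borel \<Otimes>\<^sub>M borel) (Pair t)) \<in> \<mu>0 \<rightarrow>\<^sub>M subprob_algebra (borel \<Otimes>\<^sub>M borel)"
proof -
  have "(\<lambda>x. x) \<in> lebesgue \<rightarrow>\<^sub>M (borel :: real measure)"
    by (rule measurable_completion) simp
  then have "(\<lambda>x. (fst x, snd x)) \<in> lebesgue \<Otimes>\<^sub>M borel \<rightarrow>\<^sub>M (borel :: real measure) \<Otimes>\<^sub>M (borel :: (real ^ 'n) measure)"
    by (intro measurable_Pair measurable_snd measurable_compose[OF measurable_fst])
  then have "(\<lambda>t. distr (\<kappa> t) (borel \<Otimes>\<^sub>M borel) (Pair t)) \<in> lebesgue \<rightarrow>\<^sub>M subprob_algebra (borel \<Otimes>\<^sub>M borel)"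
    by (intro measurable_distr2[where M=borel] \<kappa>_meas) (simp add: case_prod_unfold)
  then show ?thesis by simp
qed

lemma sets_\<mu>[measurable_cong]: "sets \<mu> = sets (borel \<Otimes>\<^sub>M borel)"
  unfolding \<mu>_def by (rule sets_bind[OF _]) (auto simp: \<mu>0_def)

lemma nn_integral_\<mu>:
  assumes [measurable]: "f \<in> borel_measurable (borel \<Otimes>\<^sub>M borel)"
  shows "(\<integral>\<^sup>+z. f z \<partial>\<mu>)
    = (\<integral>\<^sup>+t. ennreal (indicator {0<..1} t * k t) * (\<integral>\<^sup>+y. f (t, y) \<partial>\<kappa> t) \<partial>lebesgue)"
proof -
  have m: "(\<lambda>t. \<integral>\<^sup>+z. f z \<partial>distr (\<kappa> t) (borel \<Otimes>\<^sub>M borel) (Pair t)) \<in> borel_measurable \<mu>0"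
    by (rule measurable_compose[OF \<mu>_kernel nn_integral_measurable_subprob_algebra]) simp
  have "(\<integral>\<^sup>+z. f z \<partial>\<mu>) = (\<integral>\<^sup>+t. \<integral>\<^sup>+z. f z \<partial>distr (\<kappa> t) (borel \<Otimes>\<^sub>M borel) (Pair t) \<partial>\<mu>0)"
    unfolding \<mu>_def by (rule nn_integral_bind[OF _ \<mu>_kernel]) simp
  also have "\<dots> = (\<integral>\<^sup>+t. ennreal (indicator {0<..1} t * k t) * (\<integral>\<^sup>+z. f z \<partial>distr (\<kappa> t) (borel \<Otimes>\<^sub>M borel) (Pair t)) \<partial>lebesgue)"
    unfolding \<mu>0_def by (rule nn_integral_density) (use m in \<open>simp_all add: \<mu>0_def\<close>)
  also have "\<dots> = (\<integral>\<^sup>+t. ennreal (indicator {0<..1} t * k t) * (\<integral>\<^sup>+y. f (t, y) \<partial>\<kappa> t) \<partial>lebesgue)"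
    by (simp add: nn_integral_distr)
  finally show ?thesis .
qed

lemma ind_k_eq: "indicator {0<..t} s * k s = indicator {..t} s * k s"
  using k_nonpos[of s] by (auto simp: indicator_def)

lemma emeasure_\<mu>0: "emeasure \<mu>0 UNIV = ennreal (K 1)"
proof -
  have "emeasure \<mu>0 UNIV = (\<integral>\<^sup>+t. ennreal (indicator {0<..1} t * k t) \<partial>lebesgue)"
    unfolding \<mu>0_def by (subst emeasure_density) auto
  also have "\<dots> = (\<integral>\<^sup>+t. ennreal (indicator {..1} t * k t) \<partial>lborel)"
    unfolding ind_k_eq by (rule nn_integral_completion) 
  also have "\<dots> = ennreal (K 1)"
    unfolding K_def by (rule nn_integral_eq_integral[OF integrable_indicator_k]) (simp add: k_nonneg)
  finally show ?thesis .
qed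

lemma finite_\<mu>0: "finite_measure \<mu>0"
  by (rule finite_measureI) (simp add: emeasure_\<mu>0 \<mu>0_def[THEN arg_cong[of _ _ space]])

lemma
  fixes f :: "real \<times> (real ^ 'n) \<Rightarrow> real"
  assumes [measurable]: "f \<in> borel_measurable (borel \<Otimes>\<^sub>M borel)" and B: "\<And>z. \<bar>f z\<bar> \<le> B"
  shows integrable_\<mu>: "integrable \<mu> f"
    and integral_\<mu>: "(\<integral>z. f z \<partial>\<mu>) = (\<integral>t. (indicator {0<..1} t * k t) * (\<integral>y. f (t, y) \<partial>\<kappa> t) \<partial>lebesgue)"
proof -
  have ae: "AE t in \<mu>0. emeasure (distr (\<kappa> t) (borel \<Otimes>\<^sub>M borel) (Pair t))
      (space (distr (\<kappa> t) (borel \<Otimes>\<^sub>M borel) (Pair t))) \<le> ennreal 1"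
  proof (rule AE_I2)
    fix t assume "t \<in> space \<mu>0"
    from measurable_space[OF \<mu>_kernel this] show "emeasure (distr (\<kappa> t) (borel \<Otimes>\<^sub>M borel) (Pair t))
        (space (distr (\<kappa> t) (borel \<Otimes>\<^sub>M borel) (Pair t))) \<le> ennreal 1"
      by (auto simp: space_subprob_algebra dest: subprob_space.emeasure_space_le_1)
  qed
  show "integrable \<mu> f"
    unfolding \<mu>_def by (rule integrable_bind[OF _ _ \<mu>_kernel finite_\<mu>0 ae]) (use B in auto)
  have m: "(\<lambda>t. \<integral>z. f z \<partial>distr (\<kappa> t) (borel \<Otimes>\<^sub>M borel) (Pair t)) \<in> borel_measurable \<mu>0"
    by (rule measurable_compose[OF \<mu>_kernel integral_measurable_subprob_algebra]) simp
  have "(\<integral>z. f z \<partial>\<mu>) = (\<integral>t. (\<integral>z. f z \<partial>distr (\<kappa> t) (borel \<Otimes>\<^sub>M borel) (Pair t)) \<partial>\<mu>0)"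
    unfolding \<mu>_def by (rule integral_bind[OF _ _ \<mu>_kernel finite_\<mu>0 ae]) (use B in auto)
  also have "\<dots> = (\<integral>t. (indicator {0<..1} t * k t) * (\<integral>z. f z \<partial>distr (\<kappa> t) (borel \<Otimes>\<^sub>M borel) (Pair t)) \<partial>lebesgue)"
    unfolding \<mu>0_def by (subst integral_density) (use m k_nonneg in \<open>auto simp: \<mu>0_def\<close>)
  also have "\<dots> = (\<integral>t. (indicator {0<..1} t * k t) * (\<integral>y. f (t, y) \<partial>\<kappa> t) \<partial>lebesgue)"
    by (simp add: integral_distr)
  finally show "(\<integral>z. f z \<partial>\<mu>) = (\<integral>t. (indicator {0<..1} t * k t) * (\<integral>y. f (t, y) \<partial>\<kappa> t) \<partial>lebesgue)" .
qed

lemma finite_\<mu>: "finite_measure \<mu>"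
proof (rule finite_measureI)
  have "emeasure \<mu> (space \<mu>) = (\<integral>\<^sup>+z. 1 \<partial>\<mu>)" by simp
  also have "\<dots> \<le> (\<integral>\<^sup>+t. ennreal (indicator {0<..1} t * k t) * 1 \<partial>lebesgue)"
    using subprob_space.emeasure_space_le_1[OF subprob_\<kappa>, unfolded space_\<kappa>]
    by (subst nn_integral_\<mu>) (auto intro!: nn_integral_mono mult_left_le)
  also have "\<dots> = emeasure \<mu>0 UNIV"
    unfolding \<mu>0_def by (subst emeasure_density) auto
  finally show "emeasure \<mu> (space \<mu>) \<noteq> \<infinity>" by (auto simp: emeasure_\<mu>0 top_unique)
qed

sublocale \<mu>: finite_measure \<mu> by (rule finite_\<mu>)

text \<open>An inequality, because the fibres \<open>\<kappa> t\<close> may have mass below 1. It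
  reduces space-time estimates to integrals against k over \<open>lborel\<close>.\<close>

lemma nn_integral_\<mu>_time:
  assumes [measurable]: "h \<in> borel_measurable borel"
  shows "(\<integral>\<^sup>+z. h (fst z) \<partial>\<mu>) \<le> (\<integral>\<^sup>+t. ennreal (indicator {..1} t * k t) * h t \<partial>lborel)"
proof -
  have "(\<integral>\<^sup>+z. h (fst z) \<partial>\<mu>)
    = (\<integral>\<^sup>+t. ennreal (indicator {0<..1} t * k t) * (h t * emeasure (\<kappa> t) UNIV) \<partial>lebesgue)"
    by (subst nn_integral_\<mu>) auto
  also have "\<dots> \<le> (\<integral>\<^sup>+t. ennreal (indicator {..1} t * k t) * (h t * 1) \<partial>lebesgue)"
    unfolding ind_k_eq using subprob_space.emeasure_space_le_1[OF subprob_\<kappa>]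
    by (intro nn_integral_mono mult_left_mono) auto
  also have "\<dots> = (\<integral>\<^sup>+t. ennreal (indicator {..1} t * k t) * h t \<partial>lborel)"
    by (simp add: nn_integral_completion)
  finally show ?thesis .
qed

text \<open>Where \<open>k t = 0\<close> the measure \<open>\<mu>\<close> does not see the fibre
  over t, so nothing can be said at these times.\<close>

lemma AE_\<mu>:
  assumes [measurable]: "Measurable.pred (borel \<Otimes>\<^sub>M borel) P" and "AE z in \<mu>. P z"
  shows "AE t in lebesgue. 0 < t \<and> t \<le> 1 \<and> k t \<noteq> 0 \<longrightarrow> (AE y in \<kappa> t. P (t, y))"
proof -
  have "AE t in \<mu>0. AE z in distr (\<kappa> t) (borel \<Otimes>\<^sub>M borel) (Pair t). P z"
    using assms(2) unfolding \<mu>_def by (subst (asm) AE_bind[OF \<mu>_kernel]) auto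
  then have "AE t in lebesgue. 0 < ennreal (indicator {0<..1} t * k t) \<longrightarrow>
      (AE z in distr (\<kappa> t) (borel \<Otimes>\<^sub>M borel) (Pair t). P z)"
    unfolding \<mu>0_def by (subst (asm) AE_density) auto
  then show ?thesis
  proof eventually_elim
    case (elim t)
    show ?case
    proof
      assume t: "0 < t \<and> t \<le> 1 \<and> k t \<noteq> 0"
      then have "AE z in distr (\<kappa> t) (borel \<Otimes>\<^sub>M borel) (Pair t). P z"
        using elim k_nonneg[of t] by (simp add: less_le)
      then show "AE y in \<kappa> t. P (t, y)" by (subst (asm) AE_distr_iff) auto
    qed
  qed
qed

end

subsection \<open>The Duhamel operator\<close>

lemma nn_integral_lborel_translate:
  fixes g :: "real ^ 'n \<Rightarrow> ennreal"
  assumes [measurable]: "g \<in> borel_measurable borel"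
  shows "(\<integral>\<^sup>+x. g (x - a) \<partial>lborel) = (\<integral>\<^sup>+x. g x \<partial>lborel)"
proof -
  have "(\<integral>\<^sup>+x. g x \<partial>lborel) = (\<integral>\<^sup>+x. g x \<partial>distr lborel borel ((+) (-a)))"
    by (simp add: lborel_distr_plus)
  also have "\<dots> = (\<integral>\<^sup>+x. g (x - a) \<partial>lborel)"
    by (subst nn_integral_distr) auto
  finally show ?thesis ..
qed

lemma integral_lborel_translate:
  fixes g :: "real ^ 'n \<Rightarrow> 'b :: {banach, second_countable_topology}"
  assumes [measurable]: "g \<in> borel_measurable borel"
  shows "(\<integral>x. g (x - a) \<partial>lborel) = (\<integral>x. g x \<partial>lborel)"
proof -
  have "(\<integral>x. g x \<partial>lborel) = (\<integral>x. g x \<partial>distr lborel borel ((+) (-a)))"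
    by (simp add: lborel_distr_plus)
  also have "\<dots> = (\<integral>x. g (x - a) \<partial>lborel)"
    by (subst integral_distr) auto
  finally show ?thesis ..
qed

lemma integrable_lborel_translate:
  fixes g :: "real ^ 'n \<Rightarrow> 'b :: {banach, second_countable_topology}"
  assumes "integrable lborel g"
  shows "integrable lborel (\<lambda>x. g (x - a))"
proof -
  have [measurable]: "g \<in> borel_measurable borel" using assms by auto
  have "integrable (distr lborel borel ((+) (-a))) g"
    using assms by (simp add: lborel_distr_plus)
  then show ?thesis by (subst (asm) integrable_distr_eq) auto
qed

text \<open>This is completeness of Lebesgue measure. It gives measurability of time integrands that
  are determined only up to null sets.\<close>

lemma borel_measurable_lebesgue_AE_cong:
  assumes f: "f \<in> borel_measurable lebesgue" and ae: "AE x in lebesgue. f x = g x"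
  shows "g \<in> borel_measurable lebesgue"
proof (rule measurableI)
  fix A :: "'b set" assume "A \<in> sets borel"
  then have "f -` A \<inter> space lebesgue \<in> sets lebesgue" using f by (rule measurable_sets[rotated])
  then show "g -` A \<inter> space lebesgue \<in> sets lebesgue"
    by (rule completion.in_sets_AE[rotated]) (use ae in \<open>auto elim: eventually_mono\<close>)
qed simp

section \<open>Fourier transforms of integrable functions\<close>

definition fourier :: "(real ^ 'n \<Rightarrow> real) \<Rightarrow> real ^ 'n \<Rightarrow> complex" where
  "fourier g \<xi> = (\<integral>x. exp (- (\<i> * of_real (x \<bullet> \<xi>))) * of_real (g x) \<partial>lborel)"

lemma norm_exp_i[simp]: "norm (exp (- (\<i> * complex_of_real r))) = 1"
  using norm_exp_i_times[of "- r"] by simp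

lemma integrable_fourier:
  assumes "integrable lborel g"
  shows "integrable lborel (\<lambda>x. exp (- (\<i> * of_real (x \<bullet> \<xi>))) * complex_of_real (g x))"
  by (rule Bochner_Integration.integrable_bound[OF assms])
    (use borel_measurable_integrable[OF assms] in \<open>auto simp: norm_mult\<close>)

lemma norm_fourier_le: "integrable lborel g \<Longrightarrow> norm (fourier g \<xi>) \<le> (\<integral>x. \<bar>g x\<bar> \<partial>lborel)"
  unfolding fourier_def by (rule order_trans[OF integral_norm_bound]) (simp add: norm_mult)

lemma fourier_measurable:
  fixes f :: "real \<Rightarrow> real ^ 'n \<Rightarrow> real"
  assumes f: "(\<lambda>(s, x). f s x) \<in> borel_measurable (borel \<Otimes>\<^sub>M borel)"
  shows "(\<lambda>(s, \<xi>). fourier (f s) \<xi>) \<in> borel_measurable (borel \<Otimes>\<^sub>M borel)"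
proof -
  have [measurable]: "(\<lambda>p :: (real \<times> (real ^ 'n)) \<times> (real ^ 'n). f (fst (fst p)) (snd p))
      \<in> borel_measurable ((borel \<Otimes>\<^sub>M borel) \<Otimes>\<^sub>M borel)"
  proof -
    have "(\<lambda>p. (fst (fst p), snd p)) \<in> (((borel :: real measure) \<Otimes>\<^sub>M (borel :: (real ^ 'n) measure)) \<Otimes>\<^sub>M (borel :: (real ^ 'n) measure))
        \<rightarrow>\<^sub>M (borel \<Otimes>\<^sub>M borel)" by measurable
    from measurable_compose[OF this f] show ?thesis by simp
  qed
  have "(\<lambda>(p, x). exp (- (\<i> * of_real (x \<bullet> snd p))) * complex_of_real (f (fst p) x))
      \<in> borel_measurable ((borel \<Otimes>\<^sub>M borel) \<Otimes>\<^sub>M lborel)"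
    by (simp add: case_prod_unfold cong: measurable_cong_sets)
  then show ?thesis unfolding fourier_def case_prod_unfold
    by (intro lborel.borel_measurable_lebesgue_integral) (simp add: case_prod_unfold)
qed

lemma fourier_measurable_time:
  fixes f :: "real \<Rightarrow> real ^ 'n \<Rightarrow> real"
  assumes f: "(\<lambda>(s, x). f s x) \<in> borel_measurable (borel \<Otimes>\<^sub>M borel)"
  shows "(\<lambda>s. fourier (f s) \<xi>) \<in> borel_measurable borel"
  using measurable_compose[OF _ fourier_measurable[OF f], of "\<lambda>s. (s, \<xi>)"] by simp

lemma fourier_translate:
  assumes [measurable]: "(g :: real ^ 'n \<Rightarrow> real) \<in> borel_measurable borel"
  shows "(\<integral>x. exp (- (\<i> * of_real (x \<bullet> \<xi>))) * complex_of_real (g (x - y)) \<partial>lborel)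
    = exp (- (\<i> * of_real (y \<bullet> \<xi>))) * fourier g \<xi>"
proof -
  have "(\<integral>x. exp (- (\<i> * of_real (x \<bullet> \<xi>))) * complex_of_real (g (x - y)) \<partial>lborel)
      = (\<integral>x. (\<lambda>x. exp (- (\<i> * of_real ((x + y) \<bullet> \<xi>))) * complex_of_real (g x)) (x - y) \<partial>lborel)"
    by simp
  also have "\<dots> = (\<integral>x. exp (- (\<i> * of_real ((x + y) \<bullet> \<xi>))) * complex_of_real (g x) \<partial>lborel)"
    by (rule integral_lborel_translate) simp
  also have "\<dots> = (\<integral>x. exp (- (\<i> * of_real (y \<bullet> \<xi>))) * (exp (- (\<i> * of_real (x \<bullet> \<xi>))) * complex_of_real (g x)) \<partial>lborel)"
    by (intro Bochner_Integration.integral_cong)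
      (simp_all add: inner_add_left exp_add[symmetric] distrib_left mult.assoc[symmetric] add.commute)
  finally show ?thesis by (simp add: fourier_def)
qed

text \<open>The class of sources for the Duhamel operator, as functions on the whole time line.
  Continuity in L1 is required within (0, T] only, because a source extended by 0 jumps at time 0
  and after T.\<close>

definition admissible :: "real \<Rightarrow> (real \<Rightarrow> real ^ 'n \<Rightarrow> real) \<Rightarrow> bool" where
  "admissible T f \<longleftrightarrow>
     (\<lambda>(s, x). f s x) \<in> borel_measurable (borel \<Otimes>\<^sub>M borel) \<and>
     (\<exists>B. \<forall>s x. \<bar>f s x\<bar> \<le> B) \<and>
     (\<forall>s\<le>0. \<forall>x. f s x = 0) \<and>
     (\<forall>s. integrable lborel (f s)) \<and>
     (\<exists>C. \<forall>s. (\<integral>x. \<bar>f s x\<bar> \<partial>lborel) \<le> C) \<and>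
     (\<forall>s\<in>{0<..T}. ((\<lambda>r. \<integral>x. \<bar>f r x - f s x\<bar> \<partial>lborel) \<longlongrightarrow> 0) (at s within {0<..T}))"

context spacetime_kernel begin

text \<open>Convolution with \<open>\<mu>\<close> in time and space. For 0 \<le> t \<le> 1 and a
  bounded Borel f that vanishes for s \<le> 0 it equals the Duhamel integral of the mild equation,
  in a form to which Fubini applies directly.\<close>

definition duhamel :: "(real \<Rightarrow> real ^ 'n \<Rightarrow> real) \<Rightarrow> real \<Rightarrow> real ^ 'n \<Rightarrow> real" where
  "duhamel f t x = (\<integral>z. f (t - fst z) (x - snd z) \<partial>\<mu>)"

lemma measurable_\<mu>[simp]: "measurable \<mu> N = measurable (borel \<Otimes>\<^sub>M borel) N"
  by (rule measurable_cong_sets) (simp_all add: sets_\<mu>)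

lemma shift_measurable:
  fixes f :: "real \<Rightarrow> real ^ 'n \<Rightarrow> 'b :: topological_space"
  assumes "(\<lambda>(s, x). f s x) \<in> borel_measurable (borel \<Otimes>\<^sub>M borel)"
  shows "(\<lambda>z. f (t - fst z) (x - snd z)) \<in> borel_measurable (borel \<Otimes>\<^sub>M borel)"
proof -
  have "(\<lambda>z :: real \<times> (real ^ 'n). (t - fst z, x - snd z)) \<in> (borel \<Otimes>\<^sub>M borel) \<rightarrow>\<^sub>M (borel \<Otimes>\<^sub>M borel)"
    by measurable
  from measurable_compose[OF this assms] show ?thesis by simp
qed

lemma duhamel_measurable:
  assumes f: "(\<lambda>(s, x). f s x) \<in> borel_measurable (borel \<Otimes>\<^sub>M borel)"
  shows "(\<lambda>(t, x). duhamel f t x) \<in> borel_measurable (borel \<Otimes>\<^sub>M borel)"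
proof -
  have "(\<lambda>p. (fst (fst p) - fst (snd p), snd (fst p) - snd (snd p)))
      \<in> ((borel \<Otimes>\<^sub>M borel) \<Otimes>\<^sub>M \<mu>) \<rightarrow>\<^sub>M ((borel :: real measure) \<Otimes>\<^sub>M (borel :: (real ^ 'n) measure))"
    by measurable
  from measurable_compose[OF this f] show ?thesis
    unfolding duhamel_def case_prod_unfold
    by (intro \<mu>.borel_measurable_lebesgue_integral) (simp add: case_prod_unfold)
qed

lemma duhamel_measurable_at:
  assumes f: "(\<lambda>(s, x). f s x) \<in> borel_measurable (borel \<Otimes>\<^sub>M borel)"
  shows "duhamel f t \<in> borel_measurable borel"
  using measurable_compose[OF _ duhamel_measurable[OF f], of "\<lambda>x. (t, x)"] by simp

context
  fixes f :: "real \<Rightarrow> real ^ 'n \<Rightarrow> real" and B :: real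
  assumes f[measurable]: "(\<lambda>(s, x). f s x) \<in> borel_measurable (borel \<Otimes>\<^sub>M borel)"
    and B: "\<And>s x. \<bar>f s x\<bar> \<le> B"
begin

lemma duhamel_integrable: "integrable \<mu> (\<lambda>z. f (t - fst z) (x - snd z))"
  by (rule integrable_\<mu>[OF shift_measurable[OF f], of _ _ B]) (rule B)

text \<open>Since f vanishes for s \<le> 0, only kernel times up to t contribute. The bound
  therefore contains \<open>K t\<close>, which is small for small t, in place of the full mass of
  \<open>\<mu>\<close>.\<close>

lemma duhamel_bound:
  assumes fz: "\<And>s x. s \<le> 0 \<Longrightarrow> f s x = 0" and t: "t \<le> 1"
  shows "\<bar>duhamel f t x\<bar> \<le> B * K t"
proof -
  have B0: "0 \<le> B" using B[of 0 0] by linarith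
  have "ennreal \<bar>duhamel f t x\<bar> \<le> (\<integral>\<^sup>+z. ennreal \<bar>f (t - fst z) (x - snd z)\<bar> \<partial>\<mu>)"
    unfolding duhamel_def using integral_norm_bound_ennreal[OF duhamel_integrable] by simp
  also have "\<dots> \<le> (\<integral>\<^sup>+z. ennreal (B * indicator {..t} (fst z)) \<partial>\<mu>)"
    using B fz by (intro nn_integral_mono ennreal_leI) (auto simp: indicator_def)
  also have "\<dots> \<le> (\<integral>\<^sup>+s. ennreal (indicator {..1} s * k s) * ennreal (B * indicator {..t} s) \<partial>lborel)"
    by (rule nn_integral_\<mu>_time) simp
  also have "\<dots> = (\<integral>\<^sup>+s. ennreal (B * (indicator {..t} s * k s)) \<partial>lborel)"
    using t B0 k_nonneg by (intro nn_integral_cong) (auto simp: indicator_def ennreal_mult[symmetric] mult.commute)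
  also have "\<dots> = ennreal (B * K t)"
    unfolding K_def using B0 k_nonneg integrable_indicator_k
    by (subst nn_integral_eq_integral) auto
  finally show ?thesis using B0 K_nonneg[of t] by (subst (asm) ennreal_le_iff) auto
qed

text \<open>Tonelli and translation invariance: a shift in space does not change the L1 norm, so
  only the convolution in time remains.\<close>

lemma duhamel_L1:
  "(\<integral>\<^sup>+x. ennreal \<bar>duhamel f t x\<bar> \<partial>lborel)
    \<le> (\<integral>\<^sup>+s. ennreal (indicator {..1} s * k s) * (\<integral>\<^sup>+x. ennreal \<bar>f (t - s) x\<bar> \<partial>lborel) \<partial>lborel)"
proof -
  interpret P: pair_sigma_finite "lborel :: (real ^ 'n) measure" \<mu> ..
  have [measurable]: "(\<lambda>p. f (t - fst (snd p)) (fst p - snd (snd p)))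
      \<in> borel_measurable (borel \<Otimes>\<^sub>M (borel \<Otimes>\<^sub>M borel))"
  proof -
    have "(\<lambda>p :: (real ^ 'n) \<times> real \<times> (real ^ 'n). (t - fst (snd p), fst p - snd (snd p)))
        \<in> (borel \<Otimes>\<^sub>M (borel \<Otimes>\<^sub>M borel)) \<rightarrow>\<^sub>M (borel \<Otimes>\<^sub>M borel)"
      by measurable
    from measurable_compose[OF this f] show ?thesis by simp
  qed
  have [measurable]: "f s \<in> borel_measurable borel" for s
    using measurable_compose[OF _ f, of "\<lambda>x. (s, x)"] by simp
  have [measurable]: "(\<lambda>s. \<integral>\<^sup>+x. ennreal \<bar>f (t - s) x\<bar> \<partial>lborel) \<in> borel_measurable borel"
  proof (rule lborel.borel_measurable_nn_integral)
    have "(\<lambda>p :: real \<times> (real ^ 'n). (t - fst p, snd p)) \<in> (borel \<Otimes>\<^sub>M lborel) \<rightarrow>\<^sub>M (borel \<Otimes>\<^sub>M borel)"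
      by measurable
    from measurable_compose[OF this f]
    show "(\<lambda>(s, x). ennreal \<bar>f (t - s) x\<bar>) \<in> borel_measurable (borel \<Otimes>\<^sub>M lborel)"
      by (simp add: case_prod_unfold)
  qed
  have "(\<integral>\<^sup>+x. ennreal \<bar>duhamel f t x\<bar> \<partial>lborel)
      \<le> (\<integral>\<^sup>+x. (\<integral>\<^sup>+z. ennreal \<bar>f (t - fst z) (x - snd z)\<bar> \<partial>\<mu>) \<partial>lborel)"
    unfolding duhamel_def
    using integral_norm_bound_ennreal[OF duhamel_integrable] by (intro nn_integral_mono) simp
  also have "\<dots> = (\<integral>\<^sup>+z. (\<integral>\<^sup>+x. ennreal \<bar>f (t - fst z) (x - snd z)\<bar> \<partial>lborel) \<partial>\<mu>)"
    by (rule P.Fubini'[symmetric]) (simp add: case_prod_unfold cong: measurable_cong_sets)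
  also have "\<dots> = (\<integral>\<^sup>+z. (\<integral>\<^sup>+x. ennreal \<bar>f (t - fst z) x\<bar> \<partial>lborel) \<partial>\<mu>)"
  proof (rule nn_integral_cong)
    fix z
    show "(\<integral>\<^sup>+x. ennreal \<bar>f (t - fst z) (x - snd z)\<bar> \<partial>lborel) = (\<integral>\<^sup>+x. ennreal \<bar>f (t - fst z) x\<bar> \<partial>lborel)"
      by (rule nn_integral_lborel_translate[of "\<lambda>x. ennreal \<bar>f (t - fst z) x\<bar>"]) simp
  qed
  also have "\<dots> \<le> (\<integral>\<^sup>+s. ennreal (indicator {..1} s * k s) * (\<integral>\<^sup>+x. ennreal \<bar>f (t - s) x\<bar> \<partial>lborel) \<partial>lborel)"
    by (rule nn_integral_\<mu>_time) simp
  finally show ?thesis .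
qed

text \<open>In applications \<open>F\<close> is the nonlinearity of a mild solution, which is bounded almost everywhere
  only, and \<open>f\<close> its truncation.\<close>

lemma duhamel_eq_P_op:
  assumes F: "(\<lambda>(s, x). F s x) \<in> borel_measurable (borel \<Otimes>\<^sub>M borel)"
    and fz: "\<And>s x. s \<le> 0 \<Longrightarrow> f s x = 0" and t: "0 \<le> t" "t \<le> 1"
    and ae: "AE z in \<mu>. fst z < t \<longrightarrow> F (t - fst z) (x - snd z) = f (t - fst z) (x - snd z)"
  shows "(LINT s:{0<..<t}|lebesgue. P_op Y (t - s) (F s) x) = duhamel f t x"
proof -
  define h where "h r = (indicator {0<..1} r * k r) * (\<integral>y. f (t - r) (x - y) \<partial>\<kappa> r)" for r
  note [measurable] = shift_measurable[OF f, of t x] shift_measurable[OF F, of t x]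
  have hm: "h \<in> borel_measurable lebesgue"
  proof -
    have "(\<lambda>r. \<integral>z. f (t - fst z) (x - snd z) \<partial>distr (\<kappa> r) (borel \<Otimes>\<^sub>M borel) (Pair r)) \<in> borel_measurable \<mu>0"
      by (rule measurable_compose[OF \<mu>_kernel integral_measurable_subprob_algebra]) simp
    then have "(\<lambda>r. \<integral>y. f (t - r) (x - y) \<partial>\<kappa> r) \<in> borel_measurable lebesgue"
      by (simp add: integral_distr cong: measurable_cong_sets)
    then show ?thesis unfolding h_def by measurable
  qed
  define g where "g s = indicator {0<..<t} s *\<^sub>R P_op Y (t - s) (F s) x" for s
  have Fx: "(\<lambda>y. F s (x - y)) \<in> borel_measurable borel" for s
    using measurable_compose[OF _ F, of "\<lambda>y. (s, x - y)"] by simp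
  have fx: "(\<lambda>y. f s (x - y)) \<in> borel_measurable borel" for s
    using measurable_compose[OF _ f, of "\<lambda>y. (s, x - y)"] by simp
  have "AE r in lebesgue. 0 < r \<and> r \<le> 1 \<and> k r \<noteq> 0 \<longrightarrow>
      (AE y in \<kappa> r. r < t \<longrightarrow> F (t - r) (x - y) = f (t - r) (x - y))"
    using AE_\<mu>[OF _ ae] by simp
  \<comment> \<open>The variable r = t - s is the kernel time. For 0 < r < t both sides vanish where
    \<open>k r = 0\<close>, and elsewhere F and f agree \<open>\<kappa> r\<close>-almost everywhere
    along the fibre.\<close>
  then have eq: "AE r in lebesgue. h r = g (t + (-1) * r)"
    using Y_integral[where 'b=real]
  proof eventually_elim
    case (elim r)
    have Yr: "0 < r \<Longrightarrow> (LINT y|Y r. F (t - r) (x - y)) = k r * (LINT y|\<kappa> r. F (t - r) (x - y))"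
      using elim Fx by simp
    consider "r \<le> 0" | "t \<le> r" | "0 < r" "r < t" "k r = 0" | "0 < r" "r < t" "k r \<noteq> 0" by linarith
    then show ?case
    proof cases
      case 4
      then have "AE y in \<kappa> r. F (t - r) (x - y) = f (t - r) (x - y)" using elim t by simp
      then have "(\<integral>y. F (t - r) (x - y) \<partial>\<kappa> r) = (\<integral>y. f (t - r) (x - y) \<partial>\<kappa> r)"
        using Fx fx by (intro integral_cong_AE) (simp_all cong: measurable_cong_sets)
      then show ?thesis using 4 t Yr by (simp add: h_def g_def P_op_def conv_measure_def)
    qed (use fz t Yr in \<open>auto simp: h_def g_def P_op_def conv_measure_def\<close>)
  qed
  have "duhamel f t x = (\<integral>r. h r \<partial>lebesgue)"
    unfolding duhamel_def h_def by (subst integral_\<mu>[where B=B]) (auto simp: B)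
  \<comment> \<open>No direct argument makes g measurable, as it involves \<open>Y\<close> at all
    times; measurability is inherited from h, with which it agrees almost everywhere.\<close>
  also have "\<dots> = (\<integral>r. g (t + (-1) * r) \<partial>lebesgue)"
    by (rule integral_cong_AE[OF hm borel_measurable_lebesgue_AE_cong[OF hm eq] eq])
  also have "\<dots> = (\<integral>s. g s \<partial>lebesgue)"
    by (subst lebesgue_integral_real_affine[of "-1" g t]) auto
  finally show ?thesis by (simp add: g_def set_lebesgue_integral_def)
qed

end

lemma duhamel_diff:
  assumes "(\<lambda>(s, x). f s x) \<in> borel_measurable (borel \<Otimes>\<^sub>M borel)" "\<And>s x. \<bar>f s x\<bar> \<le> B"
    and "(\<lambda>(s, x). g s x) \<in> borel_measurable (borel \<Otimes>\<^sub>M borel)" "\<And>s x. \<bar>g s x\<bar> \<le> B'"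
  shows "duhamel f t x - duhamel g t x = duhamel (\<lambda>s x. f s x - g s x) t x"
  unfolding duhamel_def
  by (rule Bochner_Integration.integral_diff[symmetric])
    (rule duhamel_integrable[OF assms(1,2)] duhamel_integrable[OF assms(3,4)])+

lemma duhamel_mono:
  assumes "(\<lambda>(s, x). f s x) \<in> borel_measurable (borel \<Otimes>\<^sub>M borel)" "\<And>s x. \<bar>f s x\<bar> \<le> B"
    and "(\<lambda>(s, x). g s x) \<in> borel_measurable (borel \<Otimes>\<^sub>M borel)" "\<And>s x. \<bar>g s x\<bar> \<le> B'"
    and "\<And>s x. f s x \<le> g s x"
  shows "duhamel f t x \<le> duhamel g t x"
  unfolding duhamel_def by (intro integral_mono duhamel_integrable[OF assms(1,2)] duhamel_integrable[OF assms(3,4)] assms(5))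

lemma duhamel_nonneg: "(\<And>s x. 0 \<le> f s x) \<Longrightarrow> 0 \<le> duhamel f t x"
  unfolding duhamel_def by (rule Bochner_Integration.integral_nonneg) simp

lemma duhamel_tendsto:
  assumes "\<And>n. (\<lambda>(s, x). f n s x) \<in> borel_measurable (borel \<Otimes>\<^sub>M borel)" "\<And>n s x. \<bar>f n s x\<bar> \<le> B"
    and "(\<lambda>(s, x). g s x) \<in> borel_measurable (borel \<Otimes>\<^sub>M borel)"
    and "\<And>s x. (\<lambda>n. f n s x) \<longlonglongrightarrow> g s x"
  shows "(\<lambda>n. duhamel (f n) t x) \<longlonglongrightarrow> duhamel g t x"
  unfolding duhamel_def
  by (rule integral_dominated_convergence[where w="\<lambda>_. B"])
    (use assms in \<open>auto intro!: shift_measurable simp: \<mu>.integrable_const\<close>)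

text \<open>The L1 norm of the source enters through a majorant N, so that both constant bounds and
  the time-dependent bound of the uniqueness argument fit.\<close>

lemma duhamel_L1_real:
  assumes f: "(\<lambda>(s, x). f s x) \<in> borel_measurable (borel \<Otimes>\<^sub>M borel)"
    and B: "\<And>s x. \<bar>f s x\<bar> \<le> B" and t: "t \<le> 1"
    and fz: "\<And>s x. s \<le> 0 \<Longrightarrow> f s x = 0" and fi: "\<And>s. integrable lborel (f s)"
    and N: "N \<in> borel_measurable borel" "\<And>s. s \<le> t \<Longrightarrow> (\<integral>x. \<bar>f s x\<bar> \<partial>lborel) \<le> N s"
    and NC: "\<And>s. 0 \<le> N s" "\<And>s. N s \<le> C"
  shows "integrable lborel (duhamel f t)"
    and "(\<integral>x. \<bar>duhamel f t x\<bar> \<partial>lborel) \<le> (\<integral>s. indicator {..t} s * k s * N (t - s) \<partial>lborel)"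
    and "integrable lborel (\<lambda>s. indicator {..t} s * k s * N (t - s))"
proof -
  note [measurable] = N(1) duhamel_measurable_at[OF f]
  show int: "integrable lborel (\<lambda>s. indicator {..t} s * k s * N (t - s))"
  proof (rule Bochner_Integration.integrable_bound)
    show "integrable lborel (\<lambda>s. C * (indicator {..t} s * k s))"
      by (intro integrable_mult_right integrable_indicator_k)
    have "0 \<le> C" using NC[of 0] by linarith
    then show "AE s in lborel. norm (indicator {..t} s * k s * N (t - s)) \<le> norm (C * (indicator {..t} s * k s))"
      using NC k_nonneg by (auto simp: abs_mult indicator_def mult.commute[of C] intro!: mult_left_mono)
  qed simp
  have "(\<integral>\<^sup>+x. ennreal \<bar>duhamel f t x\<bar> \<partial>lborel)
      \<le> (\<integral>\<^sup>+s. ennreal (indicator {..1} s * k s) * (\<integral>\<^sup>+x. ennreal \<bar>f (t - s) x\<bar> \<partial>lborel) \<partial>lborel)"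
    by (rule duhamel_L1[OF f B])
  also have "\<dots> \<le> (\<integral>\<^sup>+s. ennreal (indicator {..t} s * k s * N (t - s)) \<partial>lborel)"
  proof (rule nn_integral_mono)
    fix s
    have e: "(\<integral>\<^sup>+x. ennreal \<bar>f (t - s) x\<bar> \<partial>lborel) = ennreal (\<integral>x. \<bar>f (t - s) x\<bar> \<partial>lborel)"
      by (rule nn_integral_eq_integral) (use fi in auto)
    show "ennreal (indicator {..1} s * k s) * (\<integral>\<^sup>+x. ennreal \<bar>f (t - s) x\<bar> \<partial>lborel)
        \<le> ennreal (indicator {..t} s * k s * N (t - s))"
    proof (cases "0 < s \<and> s \<le> t")
      case True
      then show ?thesis unfolding e using t k_nonneg[of s] N(2)[of "t - s"]
        by (simp add: ennreal_mult[symmetric] ennreal_leI mult_left_mono)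
    next
      case False
      then show ?thesis using fz[of "t - s"] k_nonpos[of s] by auto
    qed
  qed
  also have "\<dots> = ennreal (\<integral>s. indicator {..t} s * k s * N (t - s) \<partial>lborel)"
    by (rule nn_integral_eq_integral[OF int]) (use NC k_nonneg in auto)
  finally have le: "(\<integral>\<^sup>+x. ennreal \<bar>duhamel f t x\<bar> \<partial>lborel) \<le> ennreal (\<integral>s. indicator {..t} s * k s * N (t - s) \<partial>lborel)" .
  show D: "integrable lborel (duhamel f t)"
    by (rule integrableI_bounded) (use le in \<open>auto intro: le_less_trans\<close>)
  have "(\<integral>\<^sup>+x. ennreal \<bar>duhamel f t x\<bar> \<partial>lborel) = ennreal (\<integral>x. \<bar>duhamel f t x\<bar> \<partial>lborel)"
    by (rule nn_integral_eq_integral) (use D in auto)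
  then show "(\<integral>x. \<bar>duhamel f t x\<bar> \<partial>lborel) \<le> (\<integral>s. indicator {..t} s * k s * N (t - s) \<partial>lborel)"
    using le NC k_nonneg by (simp add: ennreal_le_iff integral_nonneg_AE)
qed

lemma admissible_duhamel_integrable:
  assumes adm: "admissible T f" and t: "t \<le> 1"
  shows "integrable lborel (duhamel f t)"
proof -
  obtain B C where f: "(\<lambda>(s, x). f s x) \<in> borel_measurable (borel \<Otimes>\<^sub>M borel)"
      "\<And>s x. \<bar>f s x\<bar> \<le> B" "\<And>s x. s \<le> 0 \<Longrightarrow> f s x = 0" "\<And>s. integrable lborel (f s)"
      "\<And>s. (\<integral>x. \<bar>f s x\<bar> \<partial>lborel) \<le> C"
    using adm unfolding admissible_def by blast
  have "0 \<le> C" using f(5)[of 0] f(3) by simp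
  show ?thesis
    by (rule duhamel_L1_real(1)[OF f(1,2) t f(3,4), where N="\<lambda>_. C" and C=C]) (use f \<open>0 \<le> C\<close> in auto)
qed

text \<open>Continuity is inherited from the source by shifting time: the difference of two values
  is the Duhamel term at time 0 of a difference of shifted sources. Its L1 norm is at most an
  integral of d n s against k, to which dominated convergence applies.\<close>

lemma duhamel_continuous_L1:
  assumes adm: "admissible T f" and T: "T \<le> 1" and t: "t \<in> {0..T}"
  shows "((\<lambda>r. \<integral>x. \<bar>duhamel f r x - duhamel f t x\<bar> \<partial>lborel) \<longlongrightarrow> 0) (at t within {0..T})"
  unfolding tendsto_at_iff_sequentially comp_def
proof (intro allI impI)
  obtain B C where f: "(\<lambda>(s, x). f s x) \<in> borel_measurable (borel \<Otimes>\<^sub>M borel)"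
      "\<And>s x. \<bar>f s x\<bar> \<le> B" "\<And>s x. s \<le> 0 \<Longrightarrow> f s x = 0" "\<And>s. integrable lborel (f s)"
      "\<And>s. (\<integral>x. \<bar>f s x\<bar> \<partial>lborel) \<le> C"
    and cont: "\<And>s. s \<in> {0<..T} \<Longrightarrow>
      ((\<lambda>r. \<integral>x. \<bar>f r x - f s x\<bar> \<partial>lborel) \<longlongrightarrow> 0) (at s within {0<..T})"
    using adm unfolding admissible_def by blast
  fix X :: "nat \<Rightarrow> real" assume X: "\<forall>n. X n \<in> {0..T} - {t}" "X \<longlonglongrightarrow> t"
  have [measurable]: "f s \<in> borel_measurable borel" for s
    using measurable_compose[OF _ f(1), of "\<lambda>x. (s, x)"] by simp
  define d where "d n s = (\<integral>x. \<bar>f (X n - s) x - f (t - s) x\<bar> \<partial>lborel)" for n s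
  define h where "h n s x = f (s + X n) x - f (s + t) x" for n s x
  have hm: "(\<lambda>(s, x). h n s x) \<in> borel_measurable (borel \<Otimes>\<^sub>M borel)" for n
  proof -
    have "(\<lambda>p :: real \<times> (real ^ 'n). (fst p + a, snd p)) \<in> (borel \<Otimes>\<^sub>M borel) \<rightarrow>\<^sub>M (borel \<Otimes>\<^sub>M borel)" for a
      by measurable
    from measurable_compose[OF this f(1)] show ?thesis
      unfolding h_def by (simp add: case_prod_unfold)
  qed
  have hB: "\<bar>h n s x\<bar> \<le> 2 * B" for n s x
    using f(2)[of "s + X n" x] f(2)[of "s + t" x] unfolding h_def by linarith
  have dm[measurable]: "d n \<in> borel_measurable borel" for n
    unfolding d_def
  proof (rule lborel.borel_measurable_lebesgue_integral)
    have "(\<lambda>p :: real \<times> (real ^ 'n). (a - fst p, snd p)) \<in> (borel \<Otimes>\<^sub>M lborel) \<rightarrow>\<^sub>M (borel \<Otimes>\<^sub>M borel)" for a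
      by measurable
    from measurable_compose[OF this f(1)]
    show "(\<lambda>(s, x). \<bar>f (X n - s) x - f (t - s) x\<bar>) \<in> borel_measurable (borel \<Otimes>\<^sub>M lborel)"
      by (simp add: case_prod_unfold)
  qed
  have d0: "0 \<le> d n s" for n s unfolding d_def by simp
  have dC: "d n s \<le> 2 * C" for n s
  proof -
    have "d n s \<le> (\<integral>x. \<bar>f (X n - s) x\<bar> + \<bar>f (t - s) x\<bar> \<partial>lborel)"
      unfolding d_def using f(4)
      by (intro integral_mono Bochner_Integration.integrable_add integrable_abs Bochner_Integration.integrable_diff) auto
    also have "\<dots> \<le> 2 * C"
      using f(5)[of "X n - s"] f(5)[of "t - s"] f(4) by (subst Bochner_Integration.integral_add) auto
    finally show ?thesis .
  qed
  have le: "(\<integral>x. \<bar>duhamel f (X n) x - duhamel f t x\<bar> \<partial>lborel) \<le> (\<integral>s. indicator {..1} s * k s * d n s \<partial>lborel)" for n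
  proof -
    have eq: "duhamel f (X n) x - duhamel f t x = duhamel (h n) 0 x" for x
      unfolding duhamel_def h_def
      by (subst Bochner_Integration.integral_diff[symmetric]) (auto intro: duhamel_integrable[OF f(1,2)])
    have int: "integrable lborel (\<lambda>s. indicator {..1} s * k s * d n s)"
    proof (rule Bochner_Integration.integrable_bound)
      show "integrable lborel (\<lambda>s. 2 * C * (indicator {..1} s * k s))"
        by (intro integrable_mult_right integrable_indicator_k)
      show "AE s in lborel. norm (indicator {..1} s * k s * d n s) \<le> norm (2 * C * (indicator {..1} s * k s))"
        using d0 dC k_nonneg order_trans[OF d0 dC]
        by (auto simp: abs_mult indicator_def mult.commute[of "2 * C"] intro!: mult_left_mono)
    qed simp
    have "(\<integral>\<^sup>+x. ennreal \<bar>duhamel (h n) 0 x\<bar> \<partial>lborel)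
        \<le> (\<integral>\<^sup>+s. ennreal (indicator {..1} s * k s) * (\<integral>\<^sup>+x. ennreal \<bar>h n (0 - s) x\<bar> \<partial>lborel) \<partial>lborel)"
      by (rule duhamel_L1[OF hm hB])
    also have "\<dots> = (\<integral>\<^sup>+s. ennreal (indicator {..1} s * k s * d n s) \<partial>lborel)"
    proof (rule nn_integral_cong)
      fix s
      have "(\<integral>\<^sup>+x. ennreal \<bar>h n (0 - s) x\<bar> \<partial>lborel) = ennreal (d n s)"
        unfolding d_def h_def using f(4) by (subst nn_integral_eq_integral) auto
      then show "ennreal (indicator {..1} s * k s) * (\<integral>\<^sup>+x. ennreal \<bar>h n (0 - s) x\<bar> \<partial>lborel)
          = ennreal (indicator {..1} s * k s * d n s)"
        using k_nonneg[of s] d0 by (simp add: ennreal_mult)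
    qed
    also have "\<dots> = ennreal (\<integral>s. indicator {..1} s * k s * d n s \<partial>lborel)"
      by (rule nn_integral_eq_integral[OF int]) (use d0 k_nonneg in auto)
    finally have *: "(\<integral>\<^sup>+x. ennreal \<bar>duhamel (h n) 0 x\<bar> \<partial>lborel) \<le> ennreal (\<integral>s. indicator {..1} s * k s * d n s \<partial>lborel)" .
    have "integrable lborel (\<lambda>x. duhamel f (X n) x - duhamel f t x)"
      using X(1) t T by (intro Bochner_Integration.integrable_diff admissible_duhamel_integrable[OF adm]) (auto intro: order_trans)
    then have "(\<integral>\<^sup>+x. ennreal \<bar>duhamel (h n) 0 x\<bar> \<partial>lborel) = ennreal (\<integral>x. \<bar>duhamel (h n) 0 x\<bar> \<partial>lborel)"
      unfolding eq by (intro nn_integral_eq_integral) auto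
    then show ?thesis using * d0 k_nonneg unfolding eq by (simp add: ennreal_le_iff integral_nonneg_AE)
  qed
  have "(\<lambda>n. \<integral>s. indicator {..1} s * k s * d n s \<partial>lborel) \<longlonglongrightarrow> (\<integral>s. (0 :: real) \<partial>(lborel :: real measure))"
  proof (rule integral_dominated_convergence[where w="\<lambda>s. 2 * C * (indicator {..1} s * k s)"])
    show "integrable lborel (\<lambda>s. 2 * C * (indicator {..1} s * k s))"
      by (intro integrable_mult_right integrable_indicator_k)
    show "AE s in lborel. norm (indicator {..1} s * k s * d n s) \<le> 2 * C * (indicator {..1} s * k s)" for n
      using d0 dC k_nonneg
      by (auto simp: abs_mult indicator_def mult.commute[of "2 * C"] intro!: mult_left_mono)
    \<comment> \<open>The point s = t is excluded because there the source is evaluated at time 0,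
      where its extension by 0 may jump. For s > t both arguments are eventually negative and the
      difference is 0.\<close>
    show "AE s in lborel. (\<lambda>n. indicator {..1} s * k s * d n s) \<longlonglongrightarrow> 0"
      using AE_lborel_singleton[of t]
    proof eventually_elim
      case (elim s)
      have Xs: "(\<lambda>n. X n - s) \<longlonglongrightarrow> t - s" by (intro tendsto_intros X)
      consider "s \<le> 0" | "t < s" | "0 < s" "s < t" using elim by linarith
      then show ?case
      proof cases
        case 1 then show ?thesis by (simp add: k_nonpos)
      next
        case 2
        then have "\<forall>\<^sub>F n in sequentially. X n - s < 0" using Xs by (intro order_tendstoD) auto
        then have "\<forall>\<^sub>F n in sequentially. indicator {..1} s * k s * d n s = 0"
          by eventually_elim (use 2 f(3) in \<open>simp add: d_def\<close>)
        then show ?thesis by (rule tendsto_eventually)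
      next
        case 3
        have "\<forall>\<^sub>F n in sequentially. 0 < X n - s" using order_tendstoD(1)[OF Xs, of 0] 3 by simp
        then have "\<forall>\<^sub>F n in sequentially. X n - s \<in> {0<..T} \<and> X n - s \<noteq> t - s"
        proof eventually_elim
          case (elim n)
          then show ?case using X(1)[rule_format, of n] 3 by auto
        qed
        then have "filterlim (\<lambda>n. X n - s) (at (t - s) within {0<..T}) sequentially"
          unfolding filterlim_at using Xs by blast
        moreover have "t - s \<in> {0<..T}" using 3 t by simp
        ultimately have "(\<lambda>n. d n s) \<longlonglongrightarrow> 0"
          unfolding d_def by (rule filterlim_compose[OF cont, rotated])
        then show ?thesis by (rule tendsto_mult_right_zero)
      qed
    qed
  qed measurable
  then have lim: "(\<lambda>n. \<integral>s. indicator {..1} s * k s * d n s \<partial>lborel) \<longlonglongrightarrow> 0" by simp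
  show "(\<lambda>n. \<integral>x. \<bar>duhamel f (X n) x - duhamel f t x\<bar> \<partial>lborel) \<longlonglongrightarrow> 0"
    by (rule tendsto_sandwich[OF always_eventually always_eventually tendsto_const lim])
      (use le in simp_all)
qed

text \<open>The pointwise version needs F and f to agree along the shifted fibres of
  \<open>\<mu>\<close>, which may be singular in space. Integrating over x first makes the
  exceptional set negligible: by Tonelli and translation invariance its total mass is 0, so it is
  \<open>\<mu>\<close>-null for almost every x.\<close>

lemma duhamel_eq_P_op_AE:
  assumes f: "(\<lambda>(s, x). f s x) \<in> borel_measurable (borel \<Otimes>\<^sub>M borel)"
    and B: "\<And>s x. \<bar>f s x\<bar> \<le> B"
    and F: "(\<lambda>(s, x). F s x) \<in> borel_measurable (borel \<Otimes>\<^sub>M borel)"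
    and fz: "\<And>s x. s \<le> 0 \<Longrightarrow> f s x = 0" and t: "0 \<le> t" "t \<le> 1"
    and ae: "AE s in lborel. 0 < s \<and> s < t \<longrightarrow> (AE x in lborel. F s x = f s x)"
  shows "AE x in lborel. (LINT s:{0<..<t}|lebesgue. P_op Y (t - s) (F s) x) = duhamel f t x"
proof -
  interpret P: pair_sigma_finite "lborel :: (real ^ 'n) measure" \<mu> ..
  define e where "e s x = (if 0 < s \<and> s < t \<and> F s x \<noteq> f s x then 1 else 0 :: ennreal)" for s x
  have e[measurable]: "(\<lambda>(s, x). e s x) \<in> borel_measurable (borel \<Otimes>\<^sub>M borel)"
  proof -
    have [measurable]: "(\<lambda>p. f (fst p) (snd p)) \<in> borel_measurable (borel \<Otimes>\<^sub>M borel)"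
      "(\<lambda>p. F (fst p) (snd p)) \<in> borel_measurable (borel \<Otimes>\<^sub>M borel)"
      using f F by (simp_all add: case_prod_unfold)
    show ?thesis unfolding e_def case_prod_unfold by measurable
  qed
  have [measurable]: "(\<lambda>p. e (t - fst (snd p)) (fst p - snd (snd p)))
      \<in> borel_measurable (borel \<Otimes>\<^sub>M (borel \<Otimes>\<^sub>M borel))"
  proof -
    have "(\<lambda>p :: (real ^ 'n) \<times> real \<times> (real ^ 'n). (t - fst (snd p), fst p - snd (snd p)))
        \<in> (borel \<Otimes>\<^sub>M (borel \<Otimes>\<^sub>M borel)) \<rightarrow>\<^sub>M (borel \<Otimes>\<^sub>M borel)"
      by measurable
    from measurable_compose[OF this e] show ?thesis by simp
  qed
  have es[measurable]: "e s \<in> borel_measurable borel" for s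
    using measurable_compose[OF _ e, of "\<lambda>x. (s, x)"] by simp
  define E where "E s = (\<integral>\<^sup>+x. e s x \<partial>lborel)" for s
  have [measurable]: "E \<in> borel_measurable borel"
    unfolding E_def using e by (intro lborel.borel_measurable_nn_integral) (simp cong: measurable_cong_sets)
  have E0: "AE s in lborel. E s = 0"
    using ae
  proof eventually_elim
    case (elim s)
    have "AE x in lborel. e s x = 0"
    proof (cases "0 < s \<and> s < t")
      case True
      with elim have "AE x in lborel. F s x = f s x" by simp
      then show ?thesis by eventually_elim (simp add: e_def)
    next
      case False
      then have "e s x = 0" for x by (auto simp: e_def)
      then show ?thesis by simp
    qed
    then show ?case unfolding E_def by (subst nn_integral_0_iff_AE) auto
  qed
  then have E0': "AE s in lborel. E (t - s) = 0"
    using AE_borel_affine[of "-1" "\<lambda>s. E s = 0" t] by simp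
  have "(\<integral>\<^sup>+x. (\<integral>\<^sup>+z. e (t - fst z) (x - snd z) \<partial>\<mu>) \<partial>lborel)
      = (\<integral>\<^sup>+z. (\<integral>\<^sup>+x. e (t - fst z) (x - snd z) \<partial>lborel) \<partial>\<mu>)"
    by (rule P.Fubini'[symmetric]) (simp add: case_prod_unfold cong: measurable_cong_sets)
  also have "\<dots> = (\<integral>\<^sup>+z. E (t - fst z) \<partial>\<mu>)"
    unfolding E_def by (intro nn_integral_cong nn_integral_lborel_translate es)
  also have "\<dots> \<le> (\<integral>\<^sup>+s. ennreal (indicator {..1} s * k s) * E (t - s) \<partial>lborel)"
    by (rule nn_integral_\<mu>_time) simp
  also have "\<dots> = (\<integral>\<^sup>+s. 0 \<partial>(lborel :: real measure))"
    using E0' by (intro nn_integral_cong_AE) (auto elim: eventually_mono)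
  finally have z: "(\<integral>\<^sup>+x. (\<integral>\<^sup>+z. e (t - fst z) (x - snd z) \<partial>\<mu>) \<partial>lborel) = 0" by simp
  have "(\<lambda>x. \<integral>\<^sup>+z. e (t - fst z) (x - snd z) \<partial>\<mu>) \<in> borel_measurable lborel"
    by (rule \<mu>.borel_measurable_nn_integral) (simp add: case_prod_unfold cong: measurable_cong_sets)
  with z have "AE x in lborel. (\<integral>\<^sup>+z. e (t - fst z) (x - snd z) \<partial>\<mu>) = 0"
    by (subst (asm) nn_integral_0_iff_AE) auto
  then show ?thesis
  proof eventually_elim
    case (elim x)
    have "(\<lambda>z. e (t - fst z) (x - snd z)) \<in> borel_measurable \<mu>"
      using shift_measurable[OF e] by simp
    with elim have "AE z in \<mu>. e (t - fst z) (x - snd z) = 0"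
      by (subst (asm) nn_integral_0_iff_AE) auto
    then have "AE z in \<mu>. 0 < fst z \<longrightarrow> fst z < t \<longrightarrow> F (t - fst z) (x - snd z) = f (t - fst z) (x - snd z)"
      by eventually_elim (auto simp: e_def split: if_splits)
    moreover have "AE z in \<mu>. 0 < fst z"
      unfolding \<mu>_def \<mu>0_def
    proof (subst AE_bind[OF \<mu>_kernel[unfolded \<mu>0_def]])
      have m: "(\<lambda>t. ennreal (indicator {0<..1} t * k t)) \<in> borel_measurable lebesgue" by measurable
      show "AE t in density lebesgue (\<lambda>t. ennreal (indicator {0<..1} t * k t)).
          AE z in distr (\<kappa> t) (borel \<Otimes>\<^sub>M borel) (Pair t). 0 < fst z"
        unfolding AE_density[OF m]
      proof (rule AE_I2, rule impI)
        fix t assume "0 < ennreal (indicator {0<..1} t * k t)"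
        then have "0 < t" by (cases "0 < t") auto
        then show "AE z in distr (\<kappa> t) (borel \<Otimes>\<^sub>M borel) (Pair t). 0 < fst z"
          by (subst AE_distr_iff) auto
      qed
    qed simp
    ultimately have "AE z in \<mu>. fst z < t \<longrightarrow> F (t - fst z) (x - snd z) = f (t - fst z) (x - snd z)"
      by eventually_elim auto
    then show ?case by (intro duhamel_eq_P_op[OF f B F _ t] fz)
  qed
qed

section \<open>Fourier transform of the Duhamel term\<close>

lemma integral_\<mu>_complex:
  fixes f :: "real \<times> (real ^ 'n) \<Rightarrow> complex"
  assumes [measurable]: "f \<in> borel_measurable (borel \<Otimes>\<^sub>M borel)" and B: "\<And>z. norm (f z) \<le> B"
  shows "(\<integral>z. f z \<partial>\<mu>) = (\<integral>t. (indicator {0<..1} t * k t) *\<^sub>R (\<integral>y. f (t, y) \<partial>\<kappa> t) \<partial>lebesgue)"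
    and "integrable lebesgue (\<lambda>t. (indicator {0<..1} t * k t) *\<^sub>R (\<integral>y. f (t, y) \<partial>\<kappa> t))"
proof -
  let ?g = "\<lambda>t. (indicator {0<..1} t * k t) *\<^sub>R (\<integral>y. f (t, y) \<partial>\<kappa> t)"
  have Re: "\<bar>Re (f z)\<bar> \<le> B" and Im: "\<bar>Im (f z)\<bar> \<le> B" for z
    using B[of z] abs_Re_le_cmod[of "f z"] abs_Im_le_cmod[of "f z"] by linarith+
  have f\<kappa>: "integrable (\<kappa> t) (\<lambda>y. f (t, y))" for t
  proof -
    interpret subprob_space "\<kappa> t" by (rule subprob_\<kappa>)
    show ?thesis by (rule integrable_const_bound[where B=B]) (use B in \<open>auto cong: measurable_cong_sets\<close>)
  qed
  have f\<mu>: "integrable \<mu> f"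
    by (rule \<mu>.integrable_const_bound[where B=B]) (use B in auto)
  have gm: "?g \<in> borel_measurable lebesgue"
  proof -
    have "(\<lambda>t. \<integral>z. f z \<partial>distr (\<kappa> t) (borel \<Otimes>\<^sub>M borel) (Pair t)) \<in> borel_measurable \<mu>0"
      by (rule measurable_compose[OF \<mu>_kernel integral_measurable_subprob_algebra]) simp
    then have [measurable]: "(\<lambda>t. \<integral>y. f (t, y) \<partial>\<kappa> t) \<in> borel_measurable lebesgue"
      by (simp add: integral_distr cong: measurable_cong_sets)
    show ?thesis by measurable
  qed
  show gi: "integrable lebesgue ?g"
  proof (rule Bochner_Integration.integrable_bound[OF _ gm])
    show "integrable lebesgue (\<lambda>t. B * (indicator {..1} t * k t))"
      using integrable_indicator_k[of 1] by (intro integrable_mult_right) (simp add: integrable_completion)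
    have "0 \<le> B" using norm_ge_zero[of "f undefined"] B[of undefined] by linarith
    have "norm (\<integral>y. f (t, y) \<partial>\<kappa> t) \<le> B" for t
    proof -
      interpret subprob_space "\<kappa> t" by (rule subprob_\<kappa>)
      have "norm (\<integral>y. f (t, y) \<partial>\<kappa> t) \<le> (\<integral>y. norm (f (t, y)) \<partial>\<kappa> t)" by (rule integral_norm_bound)
      also have "\<dots> \<le> (\<integral>y. B \<partial>\<kappa> t)"
        using f\<kappa> B by (intro integral_mono integrable_norm) auto
      also have "\<dots> \<le> B" using subprob_measure_le_1[of UNIV] \<open>0 \<le> B\<close> by (simp add: mult_left_le_one_le)
      finally show ?thesis .
    qed
    then show "AE t in lebesgue. norm (?g t) \<le> norm (B * (indicator {..1} t * k t))"
      using k_nonneg \<open>0 \<le> B\<close>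
      by (intro AE_I2) (auto simp: abs_mult indicator_def mult.commute[of B] intro!: mult_left_mono)
  qed
  show "(\<integral>z. f z \<partial>\<mu>) = (\<integral>t. ?g t \<partial>lebesgue)"
  proof (rule complex_eqI)
    have "Re (\<integral>z. f z \<partial>\<mu>) = (\<integral>z. Re (f z) \<partial>\<mu>)" by (rule integral_Re[OF f\<mu>, symmetric])
    also have "\<dots> = (\<integral>t. (indicator {0<..1} t * k t) * (\<integral>y. Re (f (t, y)) \<partial>\<kappa> t) \<partial>lebesgue)"
      by (rule integral_\<mu>[OF _ Re]) measurable
    also have "\<dots> = (\<integral>t. Re (?g t) \<partial>lebesgue)"
      using integral_Re[OF f\<kappa>] by simp
    also have "\<dots> = Re (\<integral>t. ?g t \<partial>lebesgue)" by (rule integral_Re[OF gi])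
    finally show "Re (\<integral>z. f z \<partial>\<mu>) = Re (\<integral>t. ?g t \<partial>lebesgue)" .
    have "Im (\<integral>z. f z \<partial>\<mu>) = (\<integral>z. Im (f z) \<partial>\<mu>)" by (rule integral_Im[OF f\<mu>, symmetric])
    also have "\<dots> = (\<integral>t. (indicator {0<..1} t * k t) * (\<integral>y. Im (f (t, y)) \<partial>\<kappa> t) \<partial>lebesgue)"
      by (rule integral_\<mu>[OF _ Im]) measurable
    also have "\<dots> = (\<integral>t. Im (?g t) \<partial>lebesgue)"
      using integral_Im[OF f\<kappa>] by simp
    also have "\<dots> = Im (\<integral>t. ?g t \<partial>lebesgue)" by (rule integral_Im[OF gi])
    finally show "Im (\<integral>z. f z \<partial>\<mu>) = Im (\<integral>t. ?g t \<partial>lebesgue)" .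
  qed
qed

text \<open>Fubini turns the shift by y into a phase, and integrating the phase against
  \<open>k s\<close> times \<open>\<kappa> s\<close> gives the transform of \<open>Y s\<close>,
  represented by the Borel function b. The cutoff of \<open>\<mu>\<close> at time 1 is invisible:
  for s > 1 the argument t - s is negative and f vanishes.\<close>

lemma fourier_duhamel:
  fixes f :: "real \<Rightarrow> real ^ 'n \<Rightarrow> real" and b :: "real \<Rightarrow> complex"
  assumes f: "(\<lambda>(s, x). f s x) \<in> borel_measurable (borel \<Otimes>\<^sub>M borel)"
    and B: "\<And>s x. \<bar>f s x\<bar> \<le> B" and t: "t \<le> 1"
    and fz: "\<And>s x. s \<le> 0 \<Longrightarrow> f s x = 0" and fi: "\<And>s. integrable lborel (f s)"
    and C: "\<And>s. (\<integral>x. \<bar>f s x\<bar> \<partial>lborel) \<le> C"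
    and b[measurable]: "b \<in> borel_measurable borel" and bz: "\<And>s. s \<le> 0 \<Longrightarrow> b s = 0"
    and bY: "AE s in lebesgue. 0 < s \<longrightarrow> fourier_measure (Y s) \<xi> = b s"
  shows "fourier (duhamel f t) \<xi> = (\<integral>s. fourier (f (t - s)) \<xi> * b s \<partial>lborel)"
proof -
  interpret P: pair_sigma_finite \<mu> "lborel :: (real ^ 'n) measure" ..
  let ?e = "\<lambda>x. exp (- (\<i> * complex_of_real (x \<bullet> \<xi>)))"
  have fm[measurable]: "f s \<in> borel_measurable borel" for s
    using measurable_compose[OF _ f, of "\<lambda>x. (s, x)"] by simp
  note [measurable] = fourier_measurable_time[OF f]
  have [measurable]: "(\<lambda>p. f (t - fst (fst p)) (snd p - snd (fst p)))
      \<in> borel_measurable ((borel \<Otimes>\<^sub>M borel) \<Otimes>\<^sub>M borel)"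
  proof -
    have "(\<lambda>p :: (real \<times> (real ^ 'n)) \<times> (real ^ 'n). (t - fst (fst p), snd p - snd (fst p)))
        \<in> ((borel \<Otimes>\<^sub>M borel) \<Otimes>\<^sub>M borel) \<rightarrow>\<^sub>M (borel \<Otimes>\<^sub>M borel)"
      by measurable
    from measurable_compose[OF this f] show ?thesis by simp
  qed
  have m2: "(\<lambda>(z, x). ?e x * complex_of_real (f (t - fst z) (x - snd z))) \<in> borel_measurable (\<mu> \<Otimes>\<^sub>M lborel)"
    by (simp add: case_prod_unfold cong: measurable_cong_sets)
  have int: "integrable (\<mu> \<Otimes>\<^sub>M lborel) (\<lambda>(z, x). ?e x * complex_of_real (f (t - fst z) (x - snd z)))"
  proof (rule P.Fubini_integrable[OF m2])
    have eq: "(\<integral>x. norm (case (z, x) of (z, x) \<Rightarrow> ?e x * complex_of_real (f (t - fst z) (x - snd z))) \<partial>lborel)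
        = (\<integral>x. \<bar>f (t - fst z) x\<bar> \<partial>lborel)" for z
      using integral_lborel_translate[of "\<lambda>x. \<bar>f (t - fst z) x\<bar>" "snd z"] by (simp add: norm_mult)
    have [measurable]: "(\<lambda>s. \<integral>x. \<bar>f (t - s) x\<bar> \<partial>lborel) \<in> borel_measurable borel"
    proof (rule lborel.borel_measurable_lebesgue_integral)
      have "(\<lambda>p :: real \<times> (real ^ 'n). (t - fst p, snd p)) \<in> (borel \<Otimes>\<^sub>M lborel) \<rightarrow>\<^sub>M (borel \<Otimes>\<^sub>M borel)"
        by measurable
      from measurable_compose[OF this f]
      show "(\<lambda>(s, x). \<bar>f (t - s) x\<bar>) \<in> borel_measurable (borel \<Otimes>\<^sub>M lborel)"
        by (simp add: case_prod_unfold)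
    qed
    show "integrable \<mu> (\<lambda>z. \<integral>x. norm (case (z, x) of (z, x) \<Rightarrow> ?e x * complex_of_real (f (t - fst z) (x - snd z))) \<partial>lborel)"
      unfolding eq by (rule \<mu>.integrable_const_bound[where B=C]) (use C in auto)
    show "AE z in \<mu>. integrable lborel (\<lambda>x. case (z, x) of (z, x) \<Rightarrow> ?e x * complex_of_real (f (t - fst z) (x - snd z)))"
      by (auto intro!: integrable_fourier integrable_lborel_translate fi)
  qed
  have "fourier (duhamel f t) \<xi> = (\<integral>x. (\<integral>z. ?e x * complex_of_real (f (t - fst z) (x - snd z)) \<partial>\<mu>) \<partial>lborel)"
    unfolding fourier_def duhamel_def by simp
  also have "\<dots> = (\<integral>z. (\<integral>x. ?e x * complex_of_real (f (t - fst z) (x - snd z)) \<partial>lborel) \<partial>\<mu>)"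
    by (rule P.Fubini_integral[OF int])
  also have "\<dots> = (\<integral>z. ?e (snd z) * fourier (f (t - fst z)) \<xi> \<partial>\<mu>)"
    by (simp add: fourier_translate)
  also have "\<dots> = (\<integral>s. (indicator {0<..1} s * k s) *\<^sub>R (\<integral>y. ?e y * fourier (f (t - s)) \<xi> \<partial>\<kappa> s) \<partial>lebesgue)"
    using norm_fourier_le[OF fi] C
    by (subst integral_\<mu>_complex[where B=C]) (auto simp: norm_mult intro: order_trans)
  also have "\<dots> = (\<integral>s. fourier (f (t - s)) \<xi> * b s \<partial>lebesgue)"
  proof -
    have im: "integrable lebesgue (\<lambda>s. (indicator {0<..1} s * k s) *\<^sub>R (\<integral>y. ?e y * fourier (f (t - s)) \<xi> \<partial>\<kappa> s))"
      using norm_fourier_le[OF fi] C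
        integral_\<mu>_complex(2)[where B=C and f="\<lambda>z. ?e (snd z) * fourier (f (t - fst z)) \<xi>"]
      by (auto simp: norm_mult intro: order_trans)
    have bm: "(\<lambda>s. fourier (f (t - s)) \<xi> * b s) \<in> borel_measurable lebesgue"
      by (rule measurable_completion) simp
    show ?thesis
    proof (rule integral_cong_AE[OF borel_measurable_integrable[OF im] bm])
      show "AE s in lebesgue. (indicator {0<..1} s * k s) *\<^sub>R (\<integral>y. ?e y * fourier (f (t - s)) \<xi> \<partial>\<kappa> s)
          = fourier (f (t - s)) \<xi> * b s"
        using bY Y_integral[where 'b=complex]
      proof eventually_elim
        case (elim s)
        consider "s \<le> 0" | "1 < s" | "0 < s" "s \<le> 1" by linarith
        then show ?case
        proof cases
          case 2
          then have "f (t - s) = (\<lambda>_. 0)" using fz t by auto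
          then show ?thesis using 2 by (simp add: fourier_def)
        next
          case 3
          have bs: "k s *\<^sub>R (\<integral>y. ?e y \<partial>\<kappa> s) = b s"
            using elim 3 unfolding fourier_measure_def by simp
          then show ?thesis using 3 by (simp add: bs[symmetric] mult.commute)
        qed (simp add: bz)
      qed
    qed
  qed
  also have "\<dots> = (\<integral>s. fourier (f (t - s)) \<xi> * b s \<partial>lborel)"
    by (rule integral_completion) simp
  finally show ?thesis .
qed

end

subsection \<open>Blow-up of a Volterra inequality\<close>

context volterra_kernel begin

lemma conv_integrable:
  assumes [measurable]: "h \<in> borel_measurable borel" and M: "\<And>t. \<bar>h t\<bar> \<le> M"
  shows "integrable lborel (\<lambda>s. indicator {..t} s * k s * h (t - s))"
proof (rule Bochner_Integration.integrable_bound)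
  show "integrable lborel (\<lambda>s. M * (indicator {..t} s * k s))"
    by (intro integrable_mult_right integrable_indicator_k)
  have "0 \<le> M" using M[of 0] by linarith
  then show "AE s in lborel. norm (indicator {..t} s * k s * h (t - s)) \<le> norm (M * (indicator {..t} s * k s))"
    using M k_nonneg by (auto simp: abs_mult indicator_def mult.commute[of M] intro!: mult_left_mono)
qed simp

text \<open>For t > \<tau> + \<delta> the convolution meets values G \<ge> m at all kernel times
  below t - \<tau> \<ge> \<delta>, and these carry mass at least \<open>K \<delta>\<close>. The
  values of G on (0, \<tau>) contribute with the right sign, since G \<ge> b there and h is
  nonnegative above b.\<close>

lemma doubling_step:
  fixes G :: "real \<Rightarrow> real"
  assumes G[measurable]: "G \<in> borel_measurable borel" and M: "\<And>t. \<bar>G t\<bar> \<le> M" "\<And>t. 0 \<le> G t"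
    and h[measurable]: "h \<in> borel_measurable borel" and hM: "\<And>t. \<bar>h (G t)\<bar> \<le> M'"
    and low: "\<And>x. b \<le> x \<Longrightarrow> \<kappa> * x powr p \<le> h x" and \<kappa>: "0 < \<kappa>" and p: "0 < p" and b: "0 < b"
    and base: "AE t in lborel. 0 < t \<and> t < T \<longrightarrow> b \<le> G t"
    and ineq: "AE t in lborel. 0 < t \<and> t < T \<longrightarrow>
      (\<integral>s. indicator {..t} s * k s * h (G (t - s)) \<partial>lborel) \<le> G t"
    and m: "b \<le> m" and \<tau>: "0 \<le> \<tau>" "0 \<le> \<delta>"
    and lm: "AE t in lborel. \<tau> < t \<and> t < T \<longrightarrow> m \<le> G t"
  shows "AE t in lborel. \<tau> + \<delta> < t \<and> t < T \<longrightarrow> K \<delta> * (\<kappa> * m powr p) \<le> G t"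
  using ineq
proof eventually_elim
  case (elim t)
  show ?case
  proof
    assume t: "\<tau> + \<delta> < t \<and> t < T"
    have "AE s in lborel. 0 < t + - 1 * s \<and> t + - 1 * s < T \<longrightarrow> b \<le> G (t + - 1 * s)"
      by (rule AE_borel_affine[where P="\<lambda>t. 0 < t \<and> t < T \<longrightarrow> b \<le> G t", OF _ _ base]) simp_all
    moreover have "AE s in lborel. \<tau> < t + - 1 * s \<and> t + - 1 * s < T \<longrightarrow> m \<le> G (t + - 1 * s)"
      by (rule AE_borel_affine[where P="\<lambda>t. \<tau> < t \<and> t < T \<longrightarrow> m \<le> G t", OF _ _ lm]) simp_all
    moreover have "AE s in lborel. s \<noteq> t" "AE s in lborel. s \<noteq> t - \<tau>"
      by (rule AE_lborel_singleton)+
    ultimately have ae: "AE s in lborel. (\<kappa> * m powr p) * (indicator {..t - \<tau>} s * k s)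
        \<le> indicator {..t} s * k s * h (G (t - s))"
    proof eventually_elim
      case (elim s)
      consider "s \<le> 0" | "t < s" | "0 < s" "s < t - \<tau>" | "0 < s" "t - \<tau> < s" "s < t"
        using elim(3,4) by linarith
      then show ?case
      proof cases
        case 3
        then have "0 < t - s" "t - s < T" "\<tau> < t - s" using t \<tau> by auto
        then have "b \<le> G (t - s)" "m \<le> G (t - s)" using elim(1,2) by auto
        then have "\<kappa> * m powr p \<le> h (G (t - s))"
        proof -
          have "m powr p \<le> G (t - s) powr p" using \<open>m \<le> G (t - s)\<close> b m p by (intro powr_mono2) auto
          then have "\<kappa> * m powr p \<le> \<kappa> * G (t - s) powr p" using \<kappa> by simp
          also have "\<dots> \<le> h (G (t - s))" using low \<open>b \<le> G (t - s)\<close> by simp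
          finally show ?thesis .
        qed
        then show ?thesis using 3 \<tau> k_nonneg[of s] by (simp add: mult_left_mono mult.commute)
      next
        case 4
        then have "b \<le> G (t - s)" using elim(1) t by auto
        then have "\<kappa> * G (t - s) powr p \<le> h (G (t - s))" by (rule low)
        moreover have "0 \<le> \<kappa> * G (t - s) powr p" using \<kappa> by simp
        ultimately have "0 \<le> h (G (t - s))" by linarith
        then show ?thesis using 4 k_nonneg[of s] by simp
      qed (use \<tau> in \<open>auto simp: k_nonpos\<close>)
    qed
    have "K \<delta> * (\<kappa> * m powr p) \<le> K (t - \<tau>) * (\<kappa> * m powr p)"
      using t \<kappa> by (intro mult_right_mono K_mono) auto
    also have "\<dots> = (\<integral>s. (\<kappa> * m powr p) * (indicator {..t - \<tau>} s * k s) \<partial>lborel)"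
      by (simp add: K_def)
    also have "\<dots> \<le> (\<integral>s. indicator {..t} s * k s * h (G (t - s)) \<partial>lborel)"
      using conv_integrable[of "\<lambda>t. h (G t)" M'] hM
      by (intro integral_mono_AE ae integrable_mult_right integrable_indicator_k) auto
    also have "\<dots> \<le> G t" using elim t \<tau> by simp
    finally show "K \<delta> * (\<kappa> * m powr p) \<le> G t" .
  qed
qed

text \<open>A memory inequality offers no differential inequality to integrate, so lower bounds are
  iterated along doubling levels instead. The constants do not depend on the bound M, which only
  expresses that G has not yet blown up.\<close>

lemma blow_up_time_bound:
  fixes p \<kappa> L :: real
  assumes p: "1 < p" and \<kappa>: "0 < \<kappa>" and L: "0 \<le> L"
  obtains C G1 where "0 < C" "0 < G1"
    "\<And>G0 T G M. G1 \<le> G0 \<Longrightarrow> 0 < T \<Longrightarrow> T \<le> 1 \<Longrightarrow>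
      G \<in> borel_measurable borel \<Longrightarrow> (\<And>t. 0 \<le> G t) \<Longrightarrow> (\<And>t. G t \<le> M) \<Longrightarrow>
      (AE t in lborel. 0 < t \<and> t < T \<longrightarrow>
        G0 + \<kappa> * (\<integral>s. indicator {..t} s * k s * G (t - s) powr p \<partial>lborel)
          \<le> G t + L * (\<integral>s. indicator {..t} s * k s * G (t - s) \<partial>lborel)) \<Longrightarrow>
      T \<le> C * G0 powr (- (p - 1) / \<alpha>1)"
proof -
  obtain c1 c2 t1 where c1: "0 < c1" "0 < t1" "\<And>t. 0 < t \<Longrightarrow> t \<le> t1 \<Longrightarrow> c1 * t powr \<alpha>1 \<le> K t"
    using K_asymptotics by metis
  \<comment> \<open>Power and linear term combined. From x1 on the power dominates, h x \<ge>
    \<kappa>/2 x^p, and h x \<ge> - L x1 for every x \<ge> 0.\<close>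
  define h where "h x = \<kappa> * x powr p - L * x" for x
  have [measurable]: "h \<in> borel_measurable borel" unfolding h_def by measurable
  define x1 where "x1 = max 1 ((2 * L / \<kappa>) powr (1 / (p - 1)))"
  have x1: "0 < x1" by (simp add: x1_def)
  have low: "\<kappa> / 2 * x powr p \<le> h x" if "x1 \<le> x" for x
  proof -
    have x: "0 < x" using that x1 by simp
    have "2 * L / \<kappa> = ((2 * L / \<kappa>) powr (1 / (p - 1))) powr (p - 1)"
      using L \<kappa> p by (simp add: powr_powr)
    also have "\<dots> \<le> x powr (p - 1)"
      using that p by (intro powr_mono2) (auto simp: x1_def)
    finally have "2 * L \<le> \<kappa> * x powr (p - 1)" using \<kappa> by (simp add: field_simps)
    then have "2 * L * x \<le> \<kappa> * (x powr (p - 1) * x)" using x by (simp add: mult.assoc[symmetric] mult_right_mono)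
    also have "x powr (p - 1) * x = x powr p" using x by (simp add: powr_mult_base mult.commute)
    finally show ?thesis by (simp add: h_def)
  qed
  have hlow: "- (L * x1) \<le> h x" if "0 \<le> x" for x
  proof (cases "x1 \<le> x")
    case True
    have "0 \<le> \<kappa> / 2 * x powr p" using \<kappa> by simp
    moreover have "0 \<le> L * x1" using L x1 by simp
    ultimately show ?thesis using low[OF True] by linarith
  next
    case False
    then have "L * x \<le> L * x1" using L by (intro mult_left_mono) auto
    moreover have "0 \<le> \<kappa> * x powr p" using \<kappa> by simp
    ultimately show ?thesis by (simp add: h_def)
  qed
  \<comment> \<open>The ratio of consecutive time steps: doubling the level m divides m^(1-p) by
    2^(p-1), and \<open>K \<delta>\<close> is bounded below by a multiple of
    \<delta>^\<alpha>1.\<close>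
  define q where "q = 2 powr (- (p - 1) / \<alpha>1)"
  have q: "0 < q" "q < 1" using p \<alpha>1 by (auto simp: q_def divide_neg_pos intro!: powr_less_one)
  \<comment> \<open>Chosen so that step j satisfies c1 \<delta>^\<alpha>1 = (4 / \<kappa>) (2^j
    b)^(1-p), exactly what raises the level 2^j b to 2^(j+1) b with the halved constant \<kappa> /
    2. The factor 2^(p-1) converts b = G0 / 2 into G0.\<close>
  define D where "D = (4 / (\<kappa> * c1) * 2 powr (p - 1)) powr (1 / \<alpha>1)"
  have D: "0 < D" using \<kappa> c1 by (simp add: D_def)
  define C where "C = D / (1 - q)"
  have C: "0 < C" using D q by (simp add: C_def)
  have "((\<lambda>G0. D * G0 powr (- (p - 1) / \<alpha>1)) \<longlongrightarrow> D * 0) at_top"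
    using p \<alpha>1 by (intro tendsto_mult tendsto_const tendsto_neg_powr filterlim_ident) (auto simp: divide_neg_pos)
  then have "\<forall>\<^sub>F G0 in at_top. D * G0 powr (- (p - 1) / \<alpha>1) < t1"
    using c1 by (intro order_tendstoD) auto
  then obtain G2 where G2: "\<And>G0. G2 \<le> G0 \<Longrightarrow> D * G0 powr (- (p - 1) / \<alpha>1) < t1"
    by (auto simp: eventually_at_top_linorder)
  \<comment> \<open>\<open>G2\<close> keeps all steps below t1, where the lower bound for K holds;
    \<open>2 * x1\<close> gives b \<ge> x1; the last entry makes the possible loss L x1 K 1 at most
    G0 / 2, so that G starts above b; and 1 makes G0 positive.\<close>
  define G1 where "G1 = Max {1, G2, 2 * x1, 2 * (L * x1 * K 1)}"
  have "0 < G1" by (auto simp: G1_def less_max_iff_disj)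
  show thesis
  proof (rule that[OF C \<open>0 < G1\<close>])
    fix G0 T M :: real and G :: "real \<Rightarrow> real"
    assume G0: "G1 \<le> G0" and T: "0 < T" "T \<le> 1" and [measurable]: "G \<in> borel_measurable borel"
      and G: "\<And>t. 0 \<le> G t" "\<And>t. G t \<le> M"
      and ineq: "AE t in lborel. 0 < t \<and> t < T \<longrightarrow>
        G0 + \<kappa> * (\<integral>s. indicator {..t} s * k s * G (t - s) powr p \<partial>lborel)
          \<le> G t + L * (\<integral>s. indicator {..t} s * k s * G (t - s) \<partial>lborel)"
    have G0': "1 \<le> G0" "G2 \<le> G0" "2 * x1 \<le> G0" "2 * (L * x1 * K 1) \<le> G0"
      using G0 by (auto simp: G1_def)
    define b where "b = G0 / 2"
    have b: "0 < b" "x1 \<le> b" using G0' by (auto simp: b_def)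
    have M0: "0 \<le> M" using G[of 0] by linarith
    have Gp: "G t powr p \<le> M powr p" for t using G p by (intro powr_mono2) auto
    have hM: "\<bar>h (G t)\<bar> \<le> \<kappa> * M powr p + L * M" for t
    proof -
      have "0 \<le> \<kappa> * G t powr p" "\<kappa> * G t powr p \<le> \<kappa> * M powr p" "0 \<le> L * G t" "L * G t \<le> L * M"
        using Gp[of t] G[of t] \<kappa> L by (auto intro!: mult_left_mono)
      then show ?thesis unfolding h_def by linarith
    qed
    have hineq: "AE t in lborel. 0 < t \<and> t < T \<longrightarrow>
        G0 + (\<integral>s. indicator {..t} s * k s * h (G (t - s)) \<partial>lborel) \<le> G t"
      using ineq
    proof eventually_elim
      case (elim t)
      have "(\<integral>s. indicator {..t} s * k s * h (G (t - s)) \<partial>lborel)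
          = (\<integral>s. \<kappa> * (indicator {..t} s * k s * G (t - s) powr p) - L * (indicator {..t} s * k s * G (t - s)) \<partial>lborel)"
        by (intro Bochner_Integration.integral_cong) (auto simp: h_def algebra_simps)
      also have "\<dots> = \<kappa> * (\<integral>s. indicator {..t} s * k s * G (t - s) powr p \<partial>lborel)
          - L * (\<integral>s. indicator {..t} s * k s * G (t - s) \<partial>lborel)"
        using conv_integrable[of "\<lambda>t. G t powr p" "M powr p"] conv_integrable[of G M] G Gp
        by (subst Bochner_Integration.integral_diff) auto
      finally show ?case using elim by auto
    qed
    have base: "AE t in lborel. 0 < t \<and> t < T \<longrightarrow> b \<le> G t"
      using hineq
    proof eventually_elim
      case (elim t)
      show ?case
      proof
        assume t: "0 < t \<and> t < T"
        have "- (L * x1) * K t = (\<integral>s. - (L * x1) * (indicator {..t} s * k s) \<partial>lborel)"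
          by (simp add: K_def)
        also have "\<dots> \<le> (\<integral>s. indicator {..t} s * k s * h (G (t - s)) \<partial>lborel)"
        proof (intro integral_mono integrable_mult_right integrable_indicator_k)
          show "integrable lborel (\<lambda>s. indicator {..t} s * k s * h (G (t - s)))"
            using conv_integrable[of "\<lambda>t. h (G t)"] hM by auto
          fix s
          have "0 \<le> indicator {..t} s * k s" using k_nonneg[of s] by simp
          from mult_left_mono[OF hlow[OF G(1)[of "t - s"]] this]
          show "- (L * x1) * (indicator {..t} s * k s) \<le> indicator {..t} s * k s * h (G (t - s))"
            by (simp only: mult.commute)
        qed
        finally have "- (L * x1 * K t) \<le> G t - G0" using elim t by auto
        moreover have "L * x1 * K t \<le> L * x1 * K 1"
          using L x1 T t by (intro mult_left_mono K_mono) auto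
        ultimately show "b \<le> G t" using G0' unfolding b_def by linarith
      qed
    qed
    have hineq': "AE t in lborel. 0 < t \<and> t < T \<longrightarrow>
        (\<integral>s. indicator {..t} s * k s * h (G (t - s)) \<partial>lborel) \<le> G t"
      using hineq by eventually_elim (use G0' in auto)
    define \<delta> where "\<delta> j = D * G0 powr (- (p - 1) / \<alpha>1) * q ^ j" for j :: nat
    have \<delta>0: "0 < \<delta> j" for j using D q G0' by (simp add: \<delta>_def)
    have \<delta>t1: "\<delta> j \<le> t1" for j
    proof -
      have "\<delta> j \<le> D * G0 powr (- (p - 1) / \<alpha>1) * 1"
        unfolding \<delta>_def using D q by (intro mult_left_mono power_le_one) auto
      then show ?thesis using G2[OF G0'(2)] by simp
    qed
    have K\<delta>: "2 ^ Suc j * b \<le> K (\<delta> j) * (\<kappa> / 2 * (2 ^ j * b) powr p)" for j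
    proof -
      have "\<delta> j powr \<alpha>1 = 4 / (\<kappa> * c1) * 2 powr (p - 1) * G0 powr (- (p - 1)) * (2 ^ j) powr (- (p - 1))"
      proof -
        have "(q ^ j) powr \<alpha>1 = (2 ^ j) powr (- (p - 1))"
          using \<alpha>1 by (simp add: q_def powr_realpow[symmetric] powr_powr mult.commute)
        then show ?thesis
          using \<kappa> c1 q G0' \<alpha>1 by (simp add: \<delta>_def D_def powr_mult powr_powr)
      qed
      also have "\<dots> = 4 / (\<kappa> * c1) * (2 ^ j * b) powr (- (p - 1))"
        using G0' by (simp add: b_def powr_mult powr_divide powr_minus divide_simps) (simp flip: powr_add)
      finally have e: "c1 * \<delta> j powr \<alpha>1 = 4 / \<kappa> * (2 ^ j * b) powr (- (p - 1))"
        using c1 by simp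
      have "(2 ^ j * b) powr (- (p - 1)) * (2 ^ j * b) powr p = 2 ^ j * b"
        using b by (simp flip: powr_add)
      then have "2 ^ Suc j * b = (c1 * \<delta> j powr \<alpha>1) * (\<kappa> / 2 * (2 ^ j * b) powr p)"
        unfolding e using \<kappa> by (simp add: mult.assoc mult.left_commute)
      also have "\<dots> \<le> K (\<delta> j) * (\<kappa> / 2 * (2 ^ j * b) powr p)"
        using c1(3)[OF \<delta>0 \<delta>t1] \<kappa> by (intro mult_right_mono) auto
      finally show ?thesis .
    qed
    have claim: "AE t in lborel. (\<Sum>i<j. \<delta> i) < t \<and> t < T \<longrightarrow> 2 ^ j * b \<le> G t" for j
    proof (induction j)
      case 0
      then show ?case using base by simp
    next
      case (Suc j)
      have "AE t in lborel. (\<Sum>i<j. \<delta> i) + \<delta> j < t \<and> t < T \<longrightarrow> K (\<delta> j) * (\<kappa> / 2 * (2 ^ j * b) powr p) \<le> G t"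
      proof (rule doubling_step[where h=h and b=b and M=M and M'="\<kappa> * M powr p + L * M"])
        show "b \<le> 2 ^ j * b" using b by simp
        show "0 \<le> (\<Sum>i<j. \<delta> i)" using \<delta>0 by (intro sum_nonneg) (simp add: less_imp_le)
        show "\<kappa> / 2 * x powr p \<le> h x" if "b \<le> x" for x using low b(2) that by simp
        show "\<bar>G t\<bar> \<le> M" for t using G[of t] by simp
      qed (use G hM \<kappa> p b \<delta>0[of j] in \<open>simp_all add: less_imp_le Suc base hineq'\<close>)
      then show ?case by eventually_elim (use K\<delta>[of j] in auto)
    qed
    have sum_le: "(\<Sum>i<j. \<delta> i) \<le> C * G0 powr (- (p - 1) / \<alpha>1)" for j
    proof -
      have "(\<Sum>i<j. q ^ i) \<le> 1 / (1 - q)"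
        using q by (simp add: sum_gp_strict divide_right_mono)
      then have "D * G0 powr (- (p - 1) / \<alpha>1) * (\<Sum>i<j. q ^ i) \<le> D * G0 powr (- (p - 1) / \<alpha>1) * (1 / (1 - q))"
        using D by (intro mult_left_mono) auto
      then show ?thesis by (simp add: \<delta>_def C_def sum_distrib_left)
    qed
    show "T \<le> C * G0 powr (- (p - 1) / \<alpha>1)"
    \<comment> \<open>Otherwise an interval of positive length lies beyond all partial sums of the
      steps. Almost everywhere on it G is at least 2^j b for every j, against the bound M.\<close>
    proof (rule ccontr)
      assume neg: "\<not> T \<le> C * G0 powr (- (p - 1) / \<alpha>1)"
      define \<tau> where "\<tau> = C * G0 powr (- (p - 1) / \<alpha>1)"
      have \<tau>: "\<tau> < T" using neg by (simp add: \<tau>_def)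
      have "AE t in lborel. \<forall>j. (\<Sum>i<j. \<delta> i) < t \<and> t < T \<longrightarrow> 2 ^ j * b \<le> G t"
        using claim by (simp add: AE_all_countable)
      then have "AE t in lborel. \<not> (\<tau> < t \<and> t < T)"
      proof eventually_elim
        case (elim t)
        show ?case
        proof
          assume t: "\<tau> < t \<and> t < T"
          obtain j where "M / b < 2 ^ j" using real_arch_pow[of 2 "M / b"] by auto
          then have "M < 2 ^ j * b" using b by (simp add: field_simps)
          moreover have "2 ^ j * b \<le> G t" using elim t sum_le[of j] unfolding \<tau>_def by auto
          ultimately show False using G(2)[of t] by simp
        qed
      qed
      then have "emeasure lborel {\<tau><..<T} = 0"
        by (subst (asm) AE_iff_measurable[of "{\<tau><..<T}"]) auto
      then show False using \<tau> by simp
    qed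
  qed
qed

end

subsection \<open>Gaussian test functions\<close>

text \<open>Boundary terms of the integration by parts in the next lemma.\<close>

lemma std_normal_tendsto:
  "((\<lambda>x. std_normal_density x * (\<bar>x\<bar> + C)) \<longlongrightarrow> 0) at_top"
  "((\<lambda>x. std_normal_density x * (\<bar>x\<bar> + C)) \<longlongrightarrow> 0) at_bot"
  unfolding std_normal_density_def by real_asymp+

lemma std_normal_second_moment_fourier:
  "integrable std_normal_distribution (\<lambda>u. of_real (u\<^sup>2) * exp (- (\<i> * of_real (r * u))))"
  "(\<integral>u. of_real (u\<^sup>2) * exp (- (\<i> * of_real (r * u))) \<partial>std_normal_distribution)
    = of_real ((1 - r\<^sup>2) * exp (- r\<^sup>2 / 2))"
  "integrable std_normal_distribution (\<lambda>u. exp (- (\<i> * of_real (r * u))))"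
  "(\<integral>u. exp (- (\<i> * of_real (r * u))) \<partial>std_normal_distribution) = of_real (exp (- r\<^sup>2 / 2))"
proof -
  let ?N = std_normal_distribution
  interpret N: real_distribution ?N by (rule real_dist_normal_dist)
  let ?e = "\<lambda>u. exp (- (\<i> * of_real (r * u)))"
  show i0: "integrable ?N ?e"
    by (rule N.integrable_const_bound[where B=1]) auto
  have "?e = (\<lambda>u. iexp (- r * u))" by (auto simp: fun_eq_iff)
  then show e0: "(\<integral>u. ?e u \<partial>?N) = of_real (exp (- r\<^sup>2 / 2))"
    using char_std_normal_distribution[THEN fun_cong, of "- r"] unfolding char_def by simp
  have "integrable ?N (\<lambda>u. u ^ 2)" by (rule integrable_std_normal_distribution_moment)
  then show i2: "integrable ?N (\<lambda>u. of_real (u\<^sup>2) * ?e u)"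
    by (rule Bochner_Integration.integrable_bound) (auto simp: norm_mult norm_power)
  \<comment> \<open>F is an antiderivative of f, which is the density times (1 - r^2 - u^2) exp (-i
    r u), because the density has derivative -u times itself. F vanishes at both ends, so the second
    moment reduces to the characteristic function.\<close>
  define F where "F u = of_real (std_normal_density u) * ((of_real u - \<i> * of_real r) * ?e u)" for u
  define f where "f u = of_real (std_normal_density u) * ((1 - of_real r ^ 2 - of_real (u\<^sup>2)) * ?e u)" for u
  have der: "(F has_vector_derivative f u) (at u)" for u
  proof -
    have d1: "((\<lambda>u. of_real (std_normal_density u) :: complex) has_vector_derivative of_real (- u * std_normal_density u)) (at u)"
    proof (rule has_vector_derivative_of_real)
      have "((\<lambda>u. A * exp (- u\<^sup>2 / 2)) has_real_derivative - u * (A * exp (- u\<^sup>2 / 2))) (at u)" for A :: real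
        by (auto intro!: derivative_eq_intros)
      then show "(std_normal_density has_real_derivative - u * std_normal_density u) (at u)"
        unfolding std_normal_density_def .
    qed
    have d2: "(?e has_vector_derivative (- \<i> * of_real r) * ?e u) (at u)"
    proof -
      have "((\<lambda>w. exp (- (\<i> * (of_real r * w)))) has_field_derivative (- \<i> * of_real r) * ?e u) (at (of_real u))"
        by (auto intro!: derivative_eq_intros)
      from has_vector_derivative_real_field[OF this] show ?thesis by simp
    qed
    have d3: "((\<lambda>u. of_real u - \<i> * of_real r) has_vector_derivative (1 :: complex)) (at u)"
      by (auto intro!: derivative_eq_intros)
    show ?thesis
      unfolding F_def f_def
      by (rule has_vector_derivative_eq_rhs[OF has_vector_derivative_mult[OF d1 has_vector_derivative_mult[OF d3 d2]]])
        (simp add: algebra_simps power2_eq_square)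
  qed
  have fi: "integrable lborel f"
  proof -
    have "integrable ?N (\<lambda>u. (1 - of_real r ^ 2) * ?e u - of_real (u\<^sup>2) * ?e u)"
      by (intro Bochner_Integration.integrable_diff integrable_mult_right i0 i2)
    then show ?thesis
      by (subst (asm) integrable_density) (auto simp: f_def[abs_def] normal_density_nonneg scaleR_conv_of_real algebra_simps)
  qed
  have nF: "norm (F u) \<le> std_normal_density u * (\<bar>u\<bar> + \<bar>r\<bar>)" for u
    using norm_triangle_ineq4[of "of_real u" "\<i> * of_real r :: complex"]
    by (simp add: F_def norm_mult normal_density_nonneg mult_left_mono)
  have "(LBINT x=-\<infinity>..\<infinity>. f x) = 0 - 0"
  proof (rule interval_integral_FTC_integrable)
    show "isCont f u" for u
      unfolding f_def std_normal_density_def by (intro continuous_intros) auto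
    show "set_integrable lborel (einterval (-\<infinity>) \<infinity>) f"
      using fi by (simp add: set_integrable_def)
    show "((F \<circ> real_of_ereal) \<longlongrightarrow> 0) (at_right (- \<infinity>))"
      unfolding ereal_tendsto_simps
      by (rule Lim_null_comparison[OF always_eventually std_normal_tendsto(2)]) (use nF in auto)
    show "((F \<circ> real_of_ereal) \<longlongrightarrow> 0) (at_left \<infinity>)"
      unfolding ereal_tendsto_simps
      by (rule Lim_null_comparison[OF always_eventually std_normal_tendsto(1)]) (use nF in auto)
  qed (use der in auto)
  then have "(\<integral>u. f u \<partial>lborel) = 0"
    by (simp add: interval_lebesgue_integral_def set_lebesgue_integral_def)
  moreover have "(\<integral>u. f u \<partial>lborel) = (\<integral>u. (1 - of_real r ^ 2) * ?e u - of_real (u\<^sup>2) * ?e u \<partial>?N)"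
    by (subst integral_density) (auto simp: f_def normal_density_nonneg scaleR_conv_of_real algebra_simps intro!: Bochner_Integration.integral_cong)
  moreover have "\<dots> = (1 - of_real r ^ 2) * (\<integral>u. ?e u \<partial>?N) - (\<integral>u. of_real (u\<^sup>2) * ?e u \<partial>?N)"
    using i0 i2 by (subst Bochner_Integration.integral_diff) auto
  ultimately show "(\<integral>u. of_real (u\<^sup>2) * ?e u \<partial>?N) = of_real ((1 - r\<^sup>2) * exp (- r\<^sup>2 / 2))"
    unfolding e0 by simp
qed

text \<open>\<gamma> is the standard Gaussian measure, the image of a product of one-dimensional
  ones. Its Fourier transform is the test function \<chi>, and the weight |\<xi>|^2 produces
  -\<Delta>\<chi> = (n - |x|^2) \<chi>.\<close>

lemma gaussian_fourier_representation:
  obtains \<gamma> :: "'a :: euclidean_space measure" where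
    "prob_space \<gamma>" "sets \<gamma> = sets borel" "integrable \<gamma> (\<lambda>\<xi>. (norm \<xi>)\<^sup>2)"
    "\<And>x. (\<integral>\<xi>. exp (- (\<i> * of_real (x \<bullet> \<xi>))) \<partial>\<gamma>) = of_real (exp (- (norm x)\<^sup>2 / 2))"
    "\<And>x. (\<integral>\<xi>. of_real ((norm \<xi>)\<^sup>2) * exp (- (\<i> * of_real (x \<bullet> \<xi>))) \<partial>\<gamma>)
      = of_real ((DIM('a) - (norm x)\<^sup>2) * exp (- (norm x)\<^sup>2 / 2))"
proof -
  let ?N = std_normal_distribution
  interpret N: real_distribution ?N by (rule real_dist_normal_dist)
  interpret P: product_sigma_finite "\<lambda>_ :: 'a. ?N" ..
  let ?P = "\<Pi>\<^sub>M b\<in>(Basis :: 'a set). ?N"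
  let ?v = "\<lambda>f. \<Sum>b\<in>Basis. f b *\<^sub>R (b :: 'a)"
  have [measurable]: "?v \<in> ?P \<rightarrow>\<^sub>M borel" by measurable
  define \<gamma> where "\<gamma> = distr ?P borel ?v"
  have v: "?v f \<bullet> b = f b" if "b \<in> Basis" for f b
    using that by (simp add: inner_sum_left inner_Basis if_distrib cong: if_cong)
  have e: "exp (- (\<i> * of_real (x \<bullet> ?v f))) = (\<Prod>b\<in>Basis. exp (- (\<i> * complex_of_real ((x \<bullet> b) * f b))))" for x f
    by (simp add: inner_sum_right exp_sum sum_distrib_left sum_negf[symmetric] mult.commute[of "f _"])
  have n2: "(norm (?v f))\<^sup>2 = (\<Sum>b\<in>Basis. (f b)\<^sup>2)" for f
    unfolding power2_norm_eq_inner by (subst euclidean_inner) (simp add: v power2_eq_square)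
  have nx: "(norm x)\<^sup>2 = (\<Sum>b\<in>Basis. (x \<bullet> b)\<^sup>2)" for x :: 'a
    unfolding power2_norm_eq_inner by (subst euclidean_inner) (simp add: power2_eq_square)
  have Pp: "prob_space ?P" by (rule prob_space_PiM) (rule N.prob_space_axioms)
  show thesis
  proof (rule that)
    show "prob_space \<gamma>" unfolding \<gamma>_def by (rule prob_space.prob_space_distr[OF Pp]) simp
    show "sets \<gamma> = sets borel" by (simp add: \<gamma>_def)
    have sq: "integrable ?N (\<lambda>u. u ^ 2)" by (rule integrable_std_normal_distribution_moment)
    have pe: "(\<Prod>i\<in>Basis. if i = b then (f i)\<^sup>2 else 1) = (f b :: real)\<^sup>2" if "b \<in> (Basis :: 'a set)" for f b
      using that by (simp add: prod.delta)
    have "integrable ?P (\<lambda>f. (f b)\<^sup>2)" if b: "b \<in> Basis" for b :: 'a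
    proof -
      have "integrable ?P (\<lambda>f. \<Prod>i\<in>Basis. (\<lambda>u. if i = b then u\<^sup>2 else 1) (f i))"
      proof (rule P.product_integrable_prod)
        show "integrable ?N (\<lambda>u. if i = b then u\<^sup>2 else 1)" for i
          using sq by (cases "i = b") auto
      qed simp
      then show ?thesis using pe[OF b] by simp
    qed
    then show "integrable \<gamma> (\<lambda>\<xi>. (norm \<xi>)\<^sup>2)"
      unfolding \<gamma>_def by (subst integrable_distr_eq) (auto simp: n2)
    fix x :: 'a
    have prodexp: "(\<Prod>b\<in>Basis. complex_of_real (exp (- (x \<bullet> b)\<^sup>2 / 2))) = of_real (exp (- (norm x)\<^sup>2 / 2))"
      by (simp add: nx exp_sum sum_divide_distrib sum_negf[symmetric] flip: of_real_prod)
    have "(\<integral>\<xi>. exp (- (\<i> * of_real (x \<bullet> \<xi>))) \<partial>\<gamma>)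
        = (\<integral>f. (\<Prod>b\<in>Basis. exp (- (\<i> * complex_of_real ((x \<bullet> b) * f b)))) \<partial>?P)"
      unfolding \<gamma>_def by (subst integral_distr) (auto simp: e)
    also have "\<dots> = (\<Prod>b\<in>Basis. \<integral>u. exp (- (\<i> * complex_of_real ((x \<bullet> b) * u))) \<partial>?N)"
      by (rule P.product_integral_prod) (simp, rule std_normal_second_moment_fourier(3))
    also have "\<dots> = of_real (exp (- (norm x)\<^sup>2 / 2))"
      unfolding std_normal_second_moment_fourier(4) by (rule prodexp)
    finally show "(\<integral>\<xi>. exp (- (\<i> * of_real (x \<bullet> \<xi>))) \<partial>\<gamma>) = of_real (exp (- (norm x)\<^sup>2 / 2))" .
    \<comment> \<open>When |\<xi>|^2 is expanded in coordinates, the summand for b0 is again a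
      product over the basis, in which only the factor b0 carries a square.\<close>
    let ?g = "\<lambda>b0 b u. if b = b0 then of_real (u\<^sup>2) * exp (- (\<i> * complex_of_real ((x \<bullet> b) * u)))
        else exp (- (\<i> * complex_of_real ((x \<bullet> b) * u)))"
    have gi: "integrable ?N (?g b0 b)" for b0 b
      using std_normal_second_moment_fourier(1,3)[of "x \<bullet> b"] by (cases "b = b0") auto
    have split: "(\<Prod>b\<in>Basis. if b = b0 then p b * w b else w b) = p b0 * (\<Prod>b\<in>Basis. w b)"
      if "b0 \<in> Basis" for b0 :: 'a and p w :: "'a \<Rightarrow> complex"
      using that by (simp add: prod.remove[of Basis b0] mult.assoc)
    have "(\<integral>\<xi>. of_real ((norm \<xi>)\<^sup>2) * exp (- (\<i> * of_real (x \<bullet> \<xi>))) \<partial>\<gamma>)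
        = (\<integral>f. (\<Sum>b0\<in>Basis. of_real ((f b0)\<^sup>2)) * (\<Prod>b\<in>Basis. exp (- (\<i> * complex_of_real ((x \<bullet> b) * f b)))) \<partial>?P)"
      unfolding \<gamma>_def by (subst integral_distr) (auto simp: e n2)
    also have "\<dots> = (\<integral>f. (\<Sum>b0\<in>Basis. \<Prod>b\<in>Basis. ?g b0 b (f b)) \<partial>?P)"
      by (intro Bochner_Integration.integral_cong refl) (simp add: sum_distrib_right split)
    also have "\<dots> = (\<Sum>b0\<in>Basis. \<integral>f. (\<Prod>b\<in>Basis. ?g b0 b (f b)) \<partial>?P)"
      by (intro Bochner_Integration.integral_sum P.product_integrable_prod gi) simp
    also have "\<dots> = (\<Sum>b0\<in>Basis. \<Prod>b\<in>Basis. \<integral>u. ?g b0 b u \<partial>?N)"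
      by (intro sum.cong refl P.product_integral_prod gi) simp
    also have "\<dots> = (\<Sum>b0\<in>Basis. \<Prod>b\<in>Basis. if b = b0
        then of_real (1 - (x \<bullet> b)\<^sup>2) * of_real (exp (- (x \<bullet> b)\<^sup>2 / 2)) else of_real (exp (- (x \<bullet> b)\<^sup>2 / 2)))"
    proof (intro sum.cong prod.cong refl)
      fix b0 b
      show "(\<integral>u. ?g b0 b u \<partial>?N) = (if b = b0
          then of_real (1 - (x \<bullet> b)\<^sup>2) * of_real (exp (- (x \<bullet> b)\<^sup>2 / 2)) else of_real (exp (- (x \<bullet> b)\<^sup>2 / 2)))"
        using std_normal_second_moment_fourier(2,4)[of "x \<bullet> b"] by (cases "b = b0") simp_all
    qed
    also have "\<dots> = (\<Sum>b0\<in>Basis. of_real (1 - (x \<bullet> b0)\<^sup>2) * of_real (exp (- (norm x)\<^sup>2 / 2)))"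
      by (intro sum.cong refl) (simp only: split prodexp)
    also have "\<dots> = of_real ((DIM('a) - (norm x)\<^sup>2) * exp (- (norm x)\<^sup>2 / 2))"
      by (simp add: nx sum_distrib_right[symmetric] sum_subtractf)
    finally show "(\<integral>\<xi>. of_real ((norm \<xi>)\<^sup>2) * exp (- (\<i> * of_real (x \<bullet> \<xi>))) \<partial>\<gamma>)
      = of_real ((DIM('a) - (norm x)\<^sup>2) * exp (- (norm x)\<^sup>2 / 2))" .
  qed
qed

lemma gaussian_integrable: "integrable lborel (\<lambda>x :: 'a :: euclidean_space. exp (- (norm x)\<^sup>2 / 2))"
proof (rule integrableI_nonneg)
  have nx: "(norm x)\<^sup>2 = (\<Sum>b\<in>Basis. (x \<bullet> b)\<^sup>2)" for x :: 'a
    unfolding power2_norm_eq_inner by (subst euclidean_inner) (simp add: power2_eq_square)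
  have "exp (- (norm x)\<^sup>2 / 2) = (\<Prod>b\<in>Basis. exp (- (x \<bullet> b)\<^sup>2 / 2))" for x :: 'a
    by (simp add: nx exp_sum sum_divide_distrib sum_negf[symmetric])
  then have "(\<integral>\<^sup>+x. ennreal (exp (- (norm x)\<^sup>2 / 2)) \<partial>(lborel :: 'a measure))
      = (\<integral>\<^sup>+x. (\<Prod>b\<in>Basis. ennreal (exp (- (x \<bullet> b)\<^sup>2 / 2))) \<partial>(lborel :: 'a measure))"
    by (simp add: prod_ennreal)
  also have "\<dots> = (\<Prod>b\<in>(Basis :: 'a set). \<integral>\<^sup>+u. ennreal (exp (- u\<^sup>2 / 2)) \<partial>lborel)"
    by (rule nn_integral_lborel_prod) auto
  also have "\<dots> < \<infinity>"
  proof -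
    have "integrable lborel (\<lambda>u. sqrt (2 * pi) * (std_normal_density u * u ^ 0))"
      by (intro integrable_mult_right integrable_std_normal_moment)
    then have "integrable lborel (\<lambda>u :: real. exp (- u\<^sup>2 / 2 :: real))" by (simp add: std_normal_density_def)
    then have "(\<integral>\<^sup>+u. ennreal (exp (- u\<^sup>2 / 2)) \<partial>lborel) = ennreal (\<integral>u. exp (- u\<^sup>2 / 2) \<partial>lborel)"
      by (intro nn_integral_eq_integral) auto
    then show ?thesis by (simp add: ennreal_power)
  qed
  finally show "(\<integral>\<^sup>+x. ennreal (exp (- (norm x)\<^sup>2 / 2)) \<partial>(lborel :: 'a measure)) < \<infinity>" .
qed auto

subsection \<open>Mild solutions and truncated sources\<close>

text \<open>A convex function lies above its tangent at m. Young's inequality for x / m and 1 yields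
  this including the endpoint x = 0. It is the common source of the Lipschitz bound and of Jensen's
  inequality.\<close>

lemma powr_tangent_le:
  fixes x m p :: real
  assumes "1 < p" "0 \<le> x" "0 < m"
  shows "m powr p + p * m powr (p - 1) * (x - m) \<le> x powr p"
proof -
  define q where "q = p / (p - 1)"
  have q: "1 < q" "1 / p + 1 / q = 1" using assms by (auto simp: q_def field_simps)
  have "(x / m) * 1 \<le> (x / m) powr p / p + 1 powr q / q"
    by (rule Youngs_inequality) (use assms q in auto)
  then have "p * (x / m) \<le> p * ((x / m) powr p / p + 1 / q)"
    using assms by (intro mult_left_mono) simp_all
  also have "\<dots> = (x / m) powr p + (p - 1)"
  proof -
    have "p * (1 / q) = p - 1" using assms by (simp add: q_def)
    moreover have "p * ((x / m) powr p / p) = (x / m) powr p" using assms by simp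
    ultimately show ?thesis by (simp only: distrib_left)
  qed
  finally have "p * (x / m) \<le> x powr p / m powr p + (p - 1)" using assms by (simp add: powr_divide)
  then have "(p * (x / m)) * m powr p \<le> (x powr p / m powr p + (p - 1)) * m powr p"
    by (intro mult_right_mono) auto
  also have "\<dots> = x powr p + (p - 1) * m powr p" using assms by (simp add: distrib_right)
  finally have *: "p * x * (m powr p / m) \<le> x powr p + (p - 1) * m powr p" by simp
  have m: "m powr p / m = m powr (p - 1)" "m powr (p - 1) * m = m powr p"
    using assms by (simp_all add: powr_diff)
  have "m powr p + p * m powr (p - 1) * (x - m) = m powr p + p * x * m powr (p - 1) - p * (m powr (p - 1) * m)"
    by (simp only: right_diff_distrib) (simp only: mult_ac)
  also have "\<dots> \<le> x powr p" using * unfolding m by (simp add: left_diff_distrib)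
  finally show ?thesis .
qed

lemma eventually_at_withinI: "(\<And>s. s \<in> S \<Longrightarrow> P s) \<Longrightarrow> eventually P (at t within S)"
  by (simp add: eventually_at_filter)

text \<open>Cutting at M makes the nonlinearity bounded and globally Lipschitz. For arguments of
  absolute value at most M it is the power of the positive part, as in the mild equation.\<close>

definition truncated_power :: "real \<Rightarrow> real \<Rightarrow> real \<Rightarrow> real" where
  "truncated_power p M x = max 0 (min M x) powr p"

lemma truncated_power_measurable[measurable]: "truncated_power p M \<in> borel_measurable borel"
  unfolding truncated_power_def by measurable

lemma truncated_power_eq: "0 \<le> x \<Longrightarrow> x \<le> M \<Longrightarrow> truncated_power p M x = x powr p"
  by (simp add: truncated_power_def)

lemma truncated_power_0[simp]: "0 \<le> M \<Longrightarrow> truncated_power p M 0 = 0"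
  by (simp add: truncated_power_def)

lemma truncated_power_nonneg: "0 \<le> truncated_power p M x"
  by (simp add: truncated_power_def)

lemma truncated_power_le: "0 \<le> M \<Longrightarrow> 0 \<le> p \<Longrightarrow> truncated_power p M x \<le> M powr p"
  unfolding truncated_power_def by (intro powr_mono2) auto

lemma truncated_power_mono: "0 \<le> p \<Longrightarrow> x \<le> y \<Longrightarrow> truncated_power p M x \<le> truncated_power p M y"
  unfolding truncated_power_def by (intro powr_mono2) auto

text \<open>Clipping to [0, M] is a contraction, and the tangent at the larger of the two clipped
  points has slope at most p M^(p-1).\<close>

lemma truncated_power_lipschitz:
  assumes p: "1 < p" and M: "0 < M"
  shows "\<bar>truncated_power p M x - truncated_power p M y\<bar> \<le> p * M powr (p - 1) * \<bar>x - y\<bar>"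
proof -
  have le: "truncated_power p M y - truncated_power p M x \<le> p * M powr (p - 1) * (y - x)" if "x \<le> y" for x y
  proof -
    let ?a = "max 0 (min M x)" and ?b = "max 0 (min M y)"
    have ab: "0 \<le> ?a" "?a \<le> ?b" "?b \<le> M" "?b - ?a \<le> y - x" using that M by auto
    show ?thesis
    proof (cases "?b = 0")
      case True
      then have "?a = 0" using ab by simp
      then show ?thesis using True that p unfolding truncated_power_def by simp
    next
      case False
      then have b: "0 < ?b" using ab by linarith
      have "?b powr p - ?a powr p \<le> p * ?b powr (p - 1) * (?b - ?a)"
        using powr_tangent_le[OF p ab(1) b] by (simp add: algebra_simps)
      also have "\<dots> \<le> p * M powr (p - 1) * (y - x)"
        using ab p by (intro mult_mono powr_mono2) auto
      finally show ?thesis by (simp add: truncated_power_def)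
    qed
  qed
  show ?thesis
    using le[of x y] le[of y x] truncated_power_mono[of p x y M] truncated_power_mono[of p y x M] p
    by (cases "x \<le> y") auto
qed

text \<open>The window (0, T] yields a function on the whole line that vanishes for s \<le> 0,
  whatever the values of u outside its interval.\<close>

definition source :: "real \<Rightarrow> real \<Rightarrow> real \<Rightarrow> (real \<Rightarrow> real ^ 'n \<Rightarrow> real) \<Rightarrow> real \<Rightarrow> real ^ 'n \<Rightarrow> real" where
  "source p M T u s x = (if 0 < s \<and> s \<le> T then truncated_power p M (u s x) else 0)"

text \<open>The clauses of \<open>mild_solution\<close> that express u \<in> C([0,T]; L1). They are
  split off because Picard iterates satisfy them without being solutions.\<close>

definition L1_curve :: "real \<Rightarrow> (real \<Rightarrow> real ^ 'n \<Rightarrow> real) \<Rightarrow> bool" where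
  "L1_curve T u \<longleftrightarrow>
     (\<lambda>(t, x). u t x) \<in> borel_measurable (restrict_space borel ({0..T} \<times> UNIV)) \<and>
     (\<forall>t\<in>{0..T}. integrable lborel (u t)) \<and>
     (\<forall>t\<in>{0..T}. ((\<lambda>s. LINT x|lborel. \<bar>u s x - u t x\<bar>) \<longlongrightarrow> 0) (at t within {0..T}))"

lemma L1_curve_extension_measurable:
  fixes u :: "real \<Rightarrow> real ^ 'n \<Rightarrow> real"
  assumes "L1_curve T u" "S \<in> sets borel" "S \<subseteq> {0..T}"
  shows "(\<lambda>(s, x). indicator S s * u s x) \<in> borel_measurable (borel \<Otimes>\<^sub>M borel)"
proof -
  have "{0..T} \<times> (UNIV :: (real ^ 'n) set) \<in> sets borel"
    unfolding borel_prod[symmetric] by auto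
  then have [measurable]: "(\<lambda>p. indicator ({0..T} \<times> UNIV) p *\<^sub>R (case p of (t, x) \<Rightarrow> u t x)) \<in> borel_measurable (borel \<Otimes>\<^sub>M borel)"
    using assms(1) unfolding L1_curve_def
    by (subst (asm) borel_measurable_restrict_space_iff) (auto simp: borel_prod)
  have [measurable]: "S \<in> sets borel" by fact
  have "(\<lambda>p. indicator S (fst p) * (indicator ({0..T} \<times> UNIV) p *\<^sub>R (case p of (t, x) \<Rightarrow> u t x)))
      \<in> borel_measurable ((borel :: real measure) \<Otimes>\<^sub>M (borel :: (real ^ 'n) measure))"
    by measurable
  also have "(\<lambda>p. indicator S (fst p) * (indicator ({0..T} \<times> UNIV) p *\<^sub>R (case p of (t, x) \<Rightarrow> u t x)))
      = (\<lambda>(s, x). indicator S s * u s x)"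
    using assms(3) by (auto simp: fun_eq_iff indicator_def)
  finally show ?thesis .
qed

text \<open>The norm is a continuous function of t on a compact interval.\<close>

lemma L1_curve_norm_bound:
  assumes "L1_curve T u"
  obtains C where "0 \<le> C" "\<And>t. t \<in> {0..T} \<Longrightarrow> (\<integral>x. \<bar>u t x\<bar> \<partial>lborel) \<le> C"
proof -
  let ?w = "\<lambda>t. \<integral>x. \<bar>u t x\<bar> \<partial>lborel"
  have int: "integrable lborel (u t)" if "t \<in> {0..T}" for t using assms that unfolding L1_curve_def by blast
  have "continuous_on {0..T} ?w"
    unfolding continuous_on_def
  proof
    fix t assume t: "t \<in> {0..T}"
    have "((\<lambda>s. LINT x|lborel. \<bar>u s x - u t x\<bar>) \<longlongrightarrow> 0) (at t within {0..T})"
      using assms t unfolding L1_curve_def by blast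
    moreover have "\<forall>\<^sub>F s in at t within {0..T}. norm (?w s - ?w t) \<le> (LINT x|lborel. \<bar>u s x - u t x\<bar>)"
    proof (rule eventually_at_withinI)
      fix s assume s: "s \<in> {0..T}"
      have "?w s - ?w t = (\<integral>x. \<bar>u s x\<bar> - \<bar>u t x\<bar> \<partial>lborel)"
        using int s t by (subst Bochner_Integration.integral_diff) auto
      also have "norm \<dots> \<le> (\<integral>x. norm (\<bar>u s x\<bar> - \<bar>u t x\<bar>) \<partial>lborel)" by (rule integral_norm_bound)
      also have "\<dots> \<le> (LINT x|lborel. \<bar>u s x - u t x\<bar>)"
        using int s t by (intro integral_mono integrable_norm integrable_abs Bochner_Integration.integrable_diff) auto
      finally show "norm (?w s - ?w t) \<le> (LINT x|lborel. \<bar>u s x - u t x\<bar>)" .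
    qed
    ultimately have "((\<lambda>s. ?w s - ?w t) \<longlongrightarrow> 0) (at t within {0..T})"
      by (rule Lim_null_comparison[rotated])
    then show "(?w \<longlongrightarrow> ?w t) (at t within {0..T})" by (simp add: LIM_zero_iff)
  qed
  then have "bounded (?w ` {0..T})" by (intro compact_imp_bounded compact_continuous_image) auto
  then obtain C where "\<And>t. t \<in> {0..T} \<Longrightarrow> norm (?w t) \<le> C" unfolding bounded_iff by blast
  then show thesis by (intro that[of "max C 0"]) (auto simp: max_def intro: order_trans)
qed

lemma source_nonneg: "0 \<le> source p M T u s x"
  by (simp add: source_def truncated_power_nonneg)

lemma source_le: "0 < M \<Longrightarrow> 1 < p \<Longrightarrow> \<bar>source p M T u s x\<bar> \<le> M powr p"
  using truncated_power_le[of M p] truncated_power_nonneg[of p M] by (simp add: source_def)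

lemma source_nonpos: "s \<le> 0 \<Longrightarrow> source p M T u s x = 0"
  by (simp add: source_def)

lemma source_diff_le:
  assumes "1 < p" "0 < M" "s \<in> {0..T}"
  shows "\<bar>source p M T u s x - source p M T v s x\<bar> \<le> p * M powr (p - 1) * \<bar>u s x - v s x\<bar>"
  using truncated_power_lipschitz[OF assms(1,2), of "u s x" "v s x"] assms by (simp add: source_def)

lemma source_abs_le:
  assumes "1 < p" "0 < M" "s \<in> {0..T}"
  shows "\<bar>source p M T u s x\<bar> \<le> p * M powr (p - 1) * \<bar>u s x\<bar>"
  using truncated_power_lipschitz[OF assms(1,2), of "u s x" 0] assms by (simp add: source_def)

lemma source_measurable:
  fixes u :: "real \<Rightarrow> real ^ 'n \<Rightarrow> real"
  assumes "L1_curve T u"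
  shows "(\<lambda>(s, x). source p M T u s x) \<in> borel_measurable (borel \<Otimes>\<^sub>M borel)"
proof -
  note [measurable] = L1_curve_extension_measurable[OF assms, of "{0<..T}", simplified case_prod_unfold]
  have "(\<lambda>p'. indicator {0<..T} (fst p') * truncated_power p M (indicator {0<..T} (fst p') * u (fst p') (snd p')))
      \<in> borel_measurable ((borel :: real measure) \<Otimes>\<^sub>M (borel :: (real ^ 'n) measure))"
    by measurable (auto simp: greaterThanAtMost_borel)
  also have "(\<lambda>p'. indicator {0<..T} (fst p') * truncated_power p M (indicator {0<..T} (fst p') * u (fst p') (snd p')))
      = (\<lambda>(s, x). source p M T u s x)"
    by (auto simp: fun_eq_iff source_def indicator_def)
  finally show ?thesis .
qed

lemma source_integrable:
  assumes u: "L1_curve T u" and p: "1 < p" and M: "0 < M"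
  shows "integrable lborel (source p M T u s)"
proof (cases "0 < s \<and> s \<le> T")
  case True
  have [measurable]: "source p M T u s \<in> borel_measurable borel"
    using measurable_compose[OF _ source_measurable[OF u, of p M], of "\<lambda>x. (s, x)"] by simp
  have "integrable lborel (u s)" using u True unfolding L1_curve_def by auto
  then have "integrable lborel (\<lambda>x. p * M powr (p - 1) * u s x)" by simp
  then show ?thesis
    by (rule Bochner_Integration.integrable_bound)
      (use source_abs_le[OF p M, of s T u] True p in \<open>auto simp: abs_mult\<close>)
next
  case False
  then have "source p M T u s = (\<lambda>_. 0)" by (auto simp: source_def)
  then show ?thesis by simp
qed

lemma source_L1_bound:
  assumes u: "L1_curve T u" and p: "1 < p" and M: "0 < M"
    and C: "0 \<le> C" "\<And>t. t \<in> {0..T} \<Longrightarrow> (\<integral>x. \<bar>u t x\<bar> \<partial>lborel) \<le> C"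
  shows "(\<integral>x. \<bar>source p M T u s x\<bar> \<partial>lborel) \<le> p * M powr (p - 1) * C"
proof (cases "0 < s \<and> s \<le> T")
  case True
  then have s: "s \<in> {0..T}" by simp
  have int: "integrable lborel (u s)" using u s unfolding L1_curve_def by auto
  have "(\<integral>x. \<bar>source p M T u s x\<bar> \<partial>lborel) \<le> (\<integral>x. p * M powr (p - 1) * \<bar>u s x\<bar> \<partial>lborel)"
    using source_abs_le[OF p M s] source_integrable[OF u p M] int
    by (intro integral_mono integrable_abs integrable_mult_right) auto
  also have "\<dots> \<le> p * M powr (p - 1) * C" using C(2)[OF s] p by (simp add: mult_left_mono)
  finally show ?thesis .
next
  case False
  then have "source p M T u s = (\<lambda>_. 0)" by (auto simp: source_def)
  then show ?thesis using C p by simp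
qed

lemma source_admissible:
  assumes u: "L1_curve T u" and p: "1 < p" and M: "0 < M"
  shows "admissible T (source p M T u)"
  unfolding admissible_def
proof (intro conjI allI ballI impI)
  show "(\<lambda>(s, x). source p M T u s x) \<in> borel_measurable (borel \<Otimes>\<^sub>M borel)"
    by (rule source_measurable[OF u])
  show "\<exists>B. \<forall>s x. \<bar>source p M T u s x\<bar> \<le> B" using source_le[OF M p] by blast
  show "source p M T u s x = 0" if "s \<le> 0" for s x using that by (rule source_nonpos)
  show int: "integrable lborel (source p M T u s)" for s by (rule source_integrable[OF u p M])
  obtain C where "0 \<le> C" "\<And>t. t \<in> {0..T} \<Longrightarrow> (\<integral>x. \<bar>u t x\<bar> \<partial>lborel) \<le> C"
    using L1_curve_norm_bound[OF u] by blast
  from source_L1_bound[OF u p M this]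
  show "\<exists>C. \<forall>s. (\<integral>x. \<bar>source p M T u s x\<bar> \<partial>lborel) \<le> C" by blast
  fix s assume s: "s \<in> {0<..T}"
  then have s': "s \<in> {0..T}" by simp
  then have "((\<lambda>r. LINT x|lborel. \<bar>u r x - u s x\<bar>) \<longlongrightarrow> 0) (at s within {0..T})"
    using u unfolding L1_curve_def by blast
  then have "((\<lambda>r. LINT x|lborel. \<bar>u r x - u s x\<bar>) \<longlongrightarrow> 0) (at s within {0<..T})"
    by (rule tendsto_within_subset) auto
  from tendsto_mult_right_zero[OF this, of "p * M powr (p - 1)"]
  have lim: "((\<lambda>r. p * M powr (p - 1) * (LINT x|lborel. \<bar>u r x - u s x\<bar>)) \<longlongrightarrow> 0) (at s within {0<..T})" .
  show "((\<lambda>r. \<integral>x. \<bar>source p M T u r x - source p M T u s x\<bar> \<partial>lborel) \<longlongrightarrow> 0) (at s within {0<..T})"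
  proof (rule Lim_null_comparison[OF _ lim])
    show "\<forall>\<^sub>F r in at s within {0<..T}. norm (\<integral>x. \<bar>source p M T u r x - source p M T u s x\<bar> \<partial>lborel)
        \<le> p * M powr (p - 1) * (LINT x|lborel. \<bar>u r x - u s x\<bar>)"
    proof (rule eventually_at_withinI)
      fix r assume r: "r \<in> {0<..T}"
      have iu: "integrable lborel (u t)" if "t \<in> {0..T}" for t using u that unfolding L1_curve_def by blast
      have "(\<integral>x. \<bar>source p M T u r x - source p M T u s x\<bar> \<partial>lborel)
          \<le> (\<integral>x. p * M powr (p - 1) * \<bar>u r x - u s x\<bar> \<partial>lborel)"
        using r s p truncated_power_lipschitz[OF p M]
        by (intro integral_mono integrable_abs integrable_mult_right Bochner_Integration.integrable_diff int iu)
          (auto simp: source_def)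
      then show "norm (\<integral>x. \<bar>source p M T u r x - source p M T u s x\<bar> \<partial>lborel)
        \<le> p * M powr (p - 1) * (LINT x|lborel. \<bar>u r x - u s x\<bar>)" by simp
    qed
  qed
qed

lemma mild_solution_L1_curve: "mild_solution Z Y p u0 T u \<Longrightarrow> L1_curve T u"
  unfolding mild_solution_def L1_curve_def in_L1_def by blast

context spacetime_kernel begin

lemma mild_solution_duhamel:
  assumes u: "mild_solution Z Y p u0 T u" and T: "0 < T" "T \<le> 1" and p: "1 < p"
  obtains M0 where "\<And>M. M0 \<le> M \<Longrightarrow> 0 < M \<Longrightarrow>
    (AE s in lborel. 0 < s \<and> s < T \<longrightarrow> (AE x in lborel. \<bar>u s x\<bar> \<le> M)) \<and>
    (\<forall>t\<in>{0..T}. AE x in lborel. u t x = S_op Z t u0 x + duhamel (source p M T u) t x)"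
proof -
  obtain M0 where M0: "AE t in lebesgue. t \<in> {0<..<T} \<longrightarrow> (AE x in lborel. \<bar>u t x\<bar> \<le> M0)"
    using u unfolding mild_solution_def by blast
  note L = mild_solution_L1_curve[OF u]
  show thesis
  proof (rule that[of M0], rule conjI, goal_cases)
    case (1 M)
    have "AE t in lborel. t \<in> {0<..<T} \<longrightarrow> (AE x in lborel. \<bar>u t x\<bar> \<le> M0)"
      using M0 by (simp only: AE_completion_iff)
    then show ?case
    proof eventually_elim
      case (elim t)
      show ?case
      proof
        assume "0 < t \<and> t < T"
        with elim have "AE x in lborel. \<bar>u t x\<bar> \<le> M0" by simp
        then show "AE x in lborel. \<bar>u t x\<bar> \<le> M" by (rule eventually_mono) (use 1 in simp)
      qed
    qed
  next
    case (2 M)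
    have bd: "AE s in lborel. s \<in> {0<..<T} \<longrightarrow> (AE x in lborel. \<bar>u s x\<bar> \<le> M0)"
      using M0 by (simp only: AE_completion_iff)
    \<comment> \<open>u is measurable on [0, T] only; the indicator extends the nonlinearity to a
      Borel function on the whole line and changes nothing on (0, t).\<close>
    define F where "F s x = max (indicator {0<..T} s * u s x) 0 powr p" for s x
    have Fm: "(\<lambda>(s, x). F s x) \<in> borel_measurable (borel \<Otimes>\<^sub>M borel)"
      using L1_curve_extension_measurable[OF L, of "{0<..T}"]
      unfolding F_def case_prod_unfold by (simp add: greaterThanAtMost_borel subset_eq)
    show ?case
    proof
      fix t assume t: "t \<in> {0..T}"
      have "AE x in lborel. (LINT s:{0<..<t}|lebesgue. P_op Y (t - s) (F s) x) = duhamel (source p M T u) t x"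
      proof (rule duhamel_eq_P_op_AE[OF source_measurable[OF L] source_le Fm])
        show "AE s in lborel. 0 < s \<and> s < t \<longrightarrow> (AE x in lborel. F s x = source p M T u s x)"
          using bd
        proof eventually_elim
          case (elim s)
          show ?case
          proof
            assume s: "0 < s \<and> s < t"
            with elim t have "AE x in lborel. \<bar>u s x\<bar> \<le> M0" by simp
            then show "AE x in lborel. F s x = source p M T u s x"
            proof eventually_elim
              case (elim x)
              then have "u s x \<le> M" using 2 by simp
              then show ?case using s t 2
                by (simp add: F_def source_def truncated_power_def max.commute min_absorb2)
            qed
          qed
        qed
      qed (use t T p 2 in \<open>auto simp: source_nonpos\<close>)
      moreover have "AE x in lborel. u t x = mild_rhs Z Y p u0 u t x"
        using u t unfolding mild_solution_def by blast
      ultimately show "AE x in lborel. u t x = S_op Z t u0 x + duhamel (source p M T u) t x"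
      proof eventually_elim
        case (elim x)
        have "(LINT s:{0<..<t}|lebesgue. P_op Y (t - s) (\<lambda>y. max (u s y) 0 powr p) x)
            = (LINT s:{0<..<t}|lebesgue. P_op Y (t - s) (F s) x)"
          using t by (intro set_lebesgue_integral_cong) (auto simp: F_def[abs_def])
        then show ?case using elim by (simp add: mild_rhs_def)
      qed
    qed
  qed
qed

end

subsection \<open>The Volterra equation in Fourier variables\<close>

context
  fixes \<nu> :: "(real ^ 'n) measure" and g :: "real ^ 'n \<Rightarrow> real"
  assumes \<nu>: "finite_measure \<nu>" "sets \<nu> = sets borel" and g: "integrable lborel g"
begin

interpretation \<nu>: finite_measure \<nu> by (rule \<nu>)
interpretation \<nu>P: pair_sigma_finite \<nu> "lborel :: (real ^ 'n) measure" ..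

lemma conv_measure_product_integrable:
  "integrable (\<nu> \<Otimes>\<^sub>M lborel) (\<lambda>(y, x). g (x - y))"
proof (rule \<nu>P.Fubini_integrable)
  note [measurable_cong] = \<nu>(2)
  have [measurable]: "g \<in> borel_measurable borel" using g by auto
  show "(\<lambda>(y, x). g (x - y)) \<in> borel_measurable (\<nu> \<Otimes>\<^sub>M lborel)"
    by (simp add: case_prod_unfold)
  have "(\<integral>x. norm (case (y, x) of (y, x) \<Rightarrow> g (x - y)) \<partial>lborel) = (\<integral>x. \<bar>g x\<bar> \<partial>lborel)" for y
    using integral_lborel_translate[of "\<lambda>x. \<bar>g x\<bar>" y] by simp
  then show "integrable \<nu> (\<lambda>y. \<integral>x. norm (case (y, x) of (y, x) \<Rightarrow> g (x - y)) \<partial>lborel)" by simp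
  show "AE y in \<nu>. integrable lborel (\<lambda>x. case (y, x) of (y, x) \<Rightarrow> g (x - y))"
    using integrable_lborel_translate[OF g] by simp
qed

lemma conv_measure_integrable: "integrable lborel (conv_measure \<nu> g)"
  using \<nu>P.integrable_snd[OF conv_measure_product_integrable] by (simp add: conv_measure_def[abs_def])

lemma fourier_conv_measure: "fourier (conv_measure \<nu> g) \<xi> = fourier g \<xi> * fourier_measure \<nu> \<xi>"
proof -
  note [measurable_cong] = \<nu>(2)
  have [measurable]: "g \<in> borel_measurable borel" using g by auto
  have int: "integrable (\<nu> \<Otimes>\<^sub>M lborel) (\<lambda>(y, x). exp (- (\<i> * of_real (x \<bullet> \<xi>))) * complex_of_real (g (x - y)))"
    by (rule Bochner_Integration.integrable_bound[OF conv_measure_product_integrable])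
      (auto simp: case_prod_unfold norm_mult)
  have "fourier (conv_measure \<nu> g) \<xi>
      = (\<integral>x. (\<integral>y. exp (- (\<i> * of_real (x \<bullet> \<xi>))) * complex_of_real (g (x - y)) \<partial>\<nu>) \<partial>lborel)"
    by (simp add: fourier_def conv_measure_def)
  also have "\<dots> = (\<integral>y. (\<integral>x. exp (- (\<i> * of_real (x \<bullet> \<xi>))) * complex_of_real (g (x - y)) \<partial>lborel) \<partial>\<nu>)"
    by (rule \<nu>P.Fubini_integral[OF int])
  also have "\<dots> = (\<integral>y. exp (- (\<i> * of_real (y \<bullet> \<xi>))) * fourier g \<xi> \<partial>\<nu>)"
    by (simp add: fourier_translate)
  finally show ?thesis by (simp add: fourier_measure_def mult.commute)
qed

text \<open>\<nu> may be singular, so at a fixed x a bound on g that holds almost everywhere cannot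
  be integrated. For each shift y it holds for almost every x; exchanging the two quantifiers gives,
  for almost every x, a bound valid \<nu>-almost everywhere.\<close>

lemma conv_measure_AE_bounds:
  assumes ae: "AE x in lborel. 0 \<le> g x \<and> g x \<le> m" and m: "0 \<le> m" and le1: "measure \<nu> UNIV \<le> 1"
  shows "AE x in lborel. 0 \<le> conv_measure \<nu> g x \<and> conv_measure \<nu> g x \<le> m"
proof -
  note [measurable_cong] = \<nu>(2)
  interpret Q: pair_sigma_finite "lborel :: (real ^ 'n) measure" \<nu> ..
  have [measurable]: "g \<in> borel_measurable borel" using g by auto
  have "AE x in lborel. AE y in \<nu>. 0 \<le> g (x - y) \<and> g (x - y) \<le> m"
  proof (subst Q.AE_commute)
    show "AE y in \<nu>. AE x in lborel. 0 \<le> g (x - y) \<and> g (x - y) \<le> m"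
    proof (rule AE_I2)
      fix y
      have d: "distr lborel borel ((+) (- y)) = (lborel :: (real ^ 'n) measure)" by (rule lborel_distr_plus)
      have "AE x in distr lborel borel ((+) (- y)). 0 \<le> g x \<and> g x \<le> m" unfolding d by (rule ae)
      then show "AE x in lborel. 0 \<le> g (x - y) \<and> g (x - y) \<le> m"
        by (subst (asm) AE_distr_iff) auto
    qed
  qed measurable
  then show ?thesis
  proof eventually_elim
    case (elim x)
    have [measurable]: "(\<lambda>y. g (x - y)) \<in> borel_measurable \<nu>" by measurable
    have int: "integrable \<nu> (\<lambda>y. g (x - y))"
      by (rule \<nu>.integrable_const_bound[where B=m]) (use elim in auto)
    have sp: "space \<nu> = UNIV" using sets_eq_imp_space_eq[OF \<nu>(2)] by simp
    have "conv_measure \<nu> g x \<le> (\<integral>y. m \<partial>\<nu>)"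
      unfolding conv_measure_def by (rule integral_mono_AE) (use int elim in auto)
    also have "\<dots> \<le> m" using le1 m sp by (simp add: mult_left_le_one_le)
    finally show ?case
      unfolding conv_measure_def using elim by (auto intro: integral_nonneg_AE)
  qed
qed

end

section \<open>Laplace transforms of bounded functions\<close>

lemma laplace_integrable_bounded:
  fixes h :: "real \<Rightarrow> complex"
  assumes "h \<in> borel_measurable borel" "\<And>t. norm (h t) \<le> C" "\<And>t. t \<le> 0 \<Longrightarrow> h t = 0" and z: "0 < z"
  shows "integrable lborel (\<lambda>t. of_real (exp (- (z * t))) * h t)"
proof -
  have [measurable]: "h \<in> borel_measurable borel" by fact
  have C: "0 \<le> C" using norm_ge_zero[of "h 0"] assms(2)[of 0] by linarith
  have "integrable lborel (\<lambda>t. indicator {0..} t * exp (- (z * t)))"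
  proof -
    have "((\<lambda>t. exp (- z * t)) has_integral exp (- z * 0) / z) {0..}"
      using z by (rule has_integral_exp_minus_to_infinity)
    then have "(\<lambda>t. exp (- z * t)) absolutely_integrable_on {0..}"
      by (intro nonnegative_absolutely_integrable_1) (auto simp: integrable_on_def)
    then have "integrable lebesgue (\<lambda>t. indicator {0..} t * exp (- (z * t)))"
      by (simp add: set_integrable_def)
    then show ?thesis by (subst (asm) integrable_completion) auto
  qed
  then have "integrable lborel (\<lambda>t. C * (indicator {0..} t * exp (- (z * t))))"
    by (rule integrable_mult_right)
  then show ?thesis
  proof (rule Bochner_Integration.integrable_bound)
    show "AE t in lborel. norm (of_real (exp (- (z * t))) * h t) \<le> norm (C * (indicator {0..} t * exp (- (z * t))))"
    proof (rule AE_I2)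
      fix t
      show "norm (of_real (exp (- (z * t))) * h t) \<le> norm (C * (indicator {0..} t * exp (- (z * t))))"
        using assms(2)[of t] assms(3)[of t] C by (cases "t \<le> 0") (auto simp: norm_mult abs_mult mult.commute)
    qed
  qed simp
qed

lemma laplace_heaviside:
  assumes z: "0 < z"
  shows "(\<integral>t. of_real (exp (- (z * t))) * indicator {0<..} t \<partial>lborel) = complex_of_real (1 / z)"
proof -
  have "((\<lambda>t. exp (- z * t)) has_integral exp (- z * 0) / z) {0..}"
    using z by (rule has_integral_exp_minus_to_infinity)
  then have "((\<lambda>t. if t \<in> {0..} then exp (- z * t) else 0) has_integral exp (- z * 0) / z) UNIV"
    by (simp only: has_integral_restrict_UNIV)
  moreover have "(\<lambda>t. if t \<in> {0..} then exp (- z * t) else 0) = (\<lambda>t. indicator {0..} t * exp (- (z * t)))"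
    by (auto simp: fun_eq_iff)
  ultimately have *: "((\<lambda>t. indicator {0..} t * exp (- (z * t))) has_integral 1 / z) UNIV" by simp
  have "has_bochner_integral lborel (\<lambda>t. indicator {0..} t * exp (- (z * t))) (1 / z)"
  proof (rule has_bochner_integral_nn_integral)
    show "(\<integral>\<^sup>+t. ennreal (indicator {0..} t * exp (- (z * t))) \<partial>lborel) = ennreal (1 / z)"
      using nn_integral_has_integral_lborel[OF _ _ *] by simp
  qed (use z in auto)
  then have "(\<integral>t. indicator {0..} t * exp (- (z * t)) \<partial>lborel) = 1 / z"
    by (rule has_bochner_integral_integral_eq)
  then have "complex_of_real (1 / z) = of_real (\<integral>t. indicator {0..} t * exp (- (z * t)) \<partial>lborel)"
    by simp
  also have "\<dots> = (\<integral>t. of_real (indicator {0..} t * exp (- (z * t))) \<partial>lborel)"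
    by (rule integral_complex_of_real[symmetric])
  also have "\<dots> = (\<integral>t. of_real (exp (- (z * t))) * indicator {0<..} t \<partial>lborel)"
  proof (rule integral_cong_AE)
    show "AE t in lborel. of_real (indicator {0..} t * exp (- (z * t))) = complex_of_real (exp (- (z * t))) * indicator {0<..} t"
      using AE_lborel_singleton[of 0] by eventually_elim (auto simp: indicator_def)
  qed auto
  finally show ?thesis ..
qed

context spacetime_kernel begin

lemma k_laplace_complex:
  assumes "0 < z"
  shows "integrable lborel (\<lambda>t. of_real (exp (- (z * t))) * complex_of_real (k t))"
    and "(\<integral>t. of_real (exp (- (z * t))) * complex_of_real (k t) \<partial>lborel) = of_real (Psi \<alpha>1 \<alpha>2 c z)"
proof -
  have eq: "(\<lambda>t. of_real (exp (- (z * t))) * complex_of_real (k t)) = (\<lambda>t. of_real (exp (- (z * t)) * k t))"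
    by (simp add: fun_eq_iff)
  show "integrable lborel (\<lambda>t. of_real (exp (- (z * t))) * complex_of_real (k t))"
    unfolding eq using k_laplace_integrable[OF assms] by (rule integrable_of_real)
  show "(\<integral>t. of_real (exp (- (z * t))) * complex_of_real (k t) \<partial>lborel) = of_real (Psi \<alpha>1 \<alpha>2 c z)"
    unfolding eq using k_laplace[OF assms] by (simp del: of_real_mult)
qed

text \<open>With \<open>F = 1 / \<Psi>\<close> and \<open>\<rho> = (norm \<xi>)\<^sup>2\<close>, multiplying the resolvents \<open>F / (z (F + \<rho>))\<close> and
  \<open>1 / (F + \<rho>)\<close> by \<open>1 + \<rho> \<Psi> = \<Psi> (F + \<rho>)\<close> leaves \<open>1 / z\<close> and \<open>\<Psi>\<close>.\<close>

lemma volterra_fourier_identity: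
  assumes Zf: "Z_family \<alpha>1 \<alpha>2 c Z" and Yf: "Y_family \<alpha>1 \<alpha>2 c Y" and u0: "integrable lborel u0"
    and f: "(\<lambda>(s, x). f s x) \<in> borel_measurable (borel \<Otimes>\<^sub>M borel)" "\<And>s x. \<bar>f s x\<bar> \<le> B"
      "\<And>s x. s \<le> 0 \<Longrightarrow> f s x = 0" "\<And>s. integrable lborel (f s)" "\<And>s. (\<integral>x. \<bar>f s x\<bar> \<partial>lborel) \<le> C"
    and T: "T \<le> 1" and U0: "\<And>s. s \<le> 0 \<Longrightarrow> U s = (\<lambda>_. 0)"
    and U: "\<And>t. 0 < t \<Longrightarrow> t < T \<Longrightarrow> U t \<in> borel_measurable borel \<and>
      (AE x in lborel. U t x = S_op Z t u0 x + duhamel f t x)"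
    and Um: "(\<lambda>t. fourier (U t) \<xi>) \<in> borel_measurable borel"
  shows "AE t in lborel. 0 < t \<and> t < T \<longrightarrow>
    fourier (U t) \<xi> + of_real ((norm \<xi>)\<^sup>2) * (\<integral>s. fourier (U (t - s)) \<xi> * of_real (k s) \<partial>lborel)
      = fourier u0 \<xi> + (\<integral>s. fourier (f (t - s)) \<xi> * of_real (k s) \<partial>lborel)"
proof -
  define \<rho> where "\<rho> = (norm \<xi>)\<^sup>2"
  have \<rho>: "0 \<le> \<rho>" by (simp add: \<rho>_def)
  define \<Phi> where "\<Phi> z = inverse (Psi \<alpha>1 \<alpha>2 c z)" for z :: real
  have \<Phi>: "0 < \<Phi> z" if "0 < z" for z using Psi_pos[OF that] by (simp add: \<Phi>_def)
  have "\<forall>z>0. (LINT t:{0<..}|lebesgue. of_real (exp (- (z * t))) * fourier_measure (Z t) \<xi>)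
      = complex_of_real (\<Phi> z / (z * (\<Phi> z + \<rho>))) \<and> complex_of_real (\<Phi> z / (z * (\<Phi> z + \<rho>))) \<noteq> 0"
  proof (intro allI impI conjI)
    fix z :: real assume z: "0 < z"
    show "complex_of_real (\<Phi> z / (z * (\<Phi> z + \<rho>))) \<noteq> 0"
      using \<Phi>[OF z] \<rho> z by (simp only: of_real_eq_0_iff) (simp add: add_nonneg_eq_0_iff)
  qed (use Zf in \<open>auto simp: Z_family_def \<Phi>_def \<rho>_def\<close>)
  \<comment> \<open>The Fourier transforms of \<open>Z t\<close> and, below, of \<open>Y t\<close>
    are replaced by Borel functions a and b, whose Laplace transforms are the two
    resolvents.\<close>
  from laplace_borel_version[OF this] obtain a where a0: "a \<in> borel_measurable borel"
    "(\<forall>t\<le>0. a t = 0) \<and> (AE t in lebesgue. 0 < t \<longrightarrow> fourier_measure (Z t) \<xi> = a t) \<and>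
      (\<forall>z>0. integrable lborel (\<lambda>t. of_real (exp (- (z * t))) * a t) \<and>
        (\<integral>t. of_real (exp (- (z * t))) * a t \<partial>lborel) = complex_of_real (\<Phi> z / (z * (\<Phi> z + \<rho>))))"
    by (rule bexE)
  have a: "\<And>t. t \<le> 0 \<Longrightarrow> a t = 0" "AE t in lebesgue. 0 < t \<longrightarrow> fourier_measure (Z t) \<xi> = a t"
    "\<And>z. 0 < z \<Longrightarrow> integrable lborel (\<lambda>t. of_real (exp (- (z * t))) * a t)"
    "\<And>z. 0 < z \<Longrightarrow> (\<integral>t. of_real (exp (- (z * t))) * a t \<partial>lborel) = complex_of_real (\<Phi> z / (z * (\<Phi> z + \<rho>)))"
    using a0(2) by blast+
  have "\<forall>z>0. (LINT t:{0<..}|lebesgue. of_real (exp (- (z * t))) * fourier_measure (Y t) \<xi>)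
      = complex_of_real (1 / (\<Phi> z + \<rho>)) \<and> complex_of_real (1 / (\<Phi> z + \<rho>)) \<noteq> 0"
  proof (intro allI impI conjI)
    fix z :: real assume z: "0 < z"
    show "complex_of_real (1 / (\<Phi> z + \<rho>)) \<noteq> 0"
      using \<Phi>[OF z] \<rho> z by (simp only: of_real_eq_0_iff) (simp add: add_nonneg_eq_0_iff)
  qed (use Yf in \<open>auto simp: Y_family_def \<Phi>_def \<rho>_def\<close>)
  from laplace_borel_version[OF this] obtain b where b0: "b \<in> borel_measurable borel"
    "(\<forall>t\<le>0. b t = 0) \<and> (AE t in lebesgue. 0 < t \<longrightarrow> fourier_measure (Y t) \<xi> = b t) \<and>
      (\<forall>z>0. integrable lborel (\<lambda>t. of_real (exp (- (z * t))) * b t) \<and>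
        (\<integral>t. of_real (exp (- (z * t))) * b t \<partial>lborel) = complex_of_real (1 / (\<Phi> z + \<rho>)))"
    by (rule bexE)
  have b: "\<And>t. t \<le> 0 \<Longrightarrow> b t = 0" "AE t in lebesgue. 0 < t \<longrightarrow> fourier_measure (Y t) \<xi> = b t"
    "\<And>z. 0 < z \<Longrightarrow> integrable lborel (\<lambda>t. of_real (exp (- (z * t))) * b t)"
    "\<And>z. 0 < z \<Longrightarrow> (\<integral>t. of_real (exp (- (z * t))) * b t \<partial>lborel) = complex_of_real (1 / (\<Phi> z + \<rho>))"
    using b0(2) by blast+
  note [measurable] = a0(1) b0(1) fourier_measurable_time[OF f(1)] Um
  define fh where "fh s = fourier (f s) \<xi>" for s
  have [measurable]: "fh \<in> borel_measurable borel" unfolding fh_def by measurable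
  have fh0: "fh s = 0" if "s \<le> 0" for s using f(3)[OF that] by (simp add: fh_def fourier_def)
  have fhC: "norm (fh s) \<le> C" for s
    unfolding fh_def using norm_fourier_le[OF f(4)] f(5) by (rule order_trans)
  define w0 where "w0 = fourier u0 \<xi>"
  \<comment> \<open>Laplace uniqueness needs a function on the whole half-line, but U satisfies the
    equation only on (0, T). As a, b and f are given for all times, \<omega> continues the Fourier
    transform of U beyond T; the two agree almost everywhere on (0, T) because T \<le> 1.\<close>
  define \<omega> where "\<omega> t = w0 * a t + (\<integral>s. fh (t - s) * b s \<partial>lborel)" for t
  have conv0: "(\<integral>s. g (t - s) * h s \<partial>lborel) = 0"
    if "\<And>s. s \<le> 0 \<Longrightarrow> g s = 0" "\<And>s. s \<le> 0 \<Longrightarrow> h s = 0" "t \<le> 0" for g h :: "real \<Rightarrow> complex" and t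
  proof -
    have "(\<lambda>s. g (t - s) * h s) = (\<lambda>s. 0)"
    proof
      fix s show "g (t - s) * h s = 0" using that by (cases "s \<le> 0") auto
    qed
    then show ?thesis by simp
  qed
  have \<omega>0: "\<omega> t = 0" if "t \<le> 0" for t
    unfolding \<omega>_def using conv0[of fh b t] fh0 a(1) b(1) that by simp
  have fhi: "integrable lborel (\<lambda>t. of_real (exp (- (z * t))) * fh t)" if "0 < z" for z
    by (rule laplace_integrable_bounded[OF _ fhC fh0 that]) measurable
  have \<omega>i: "integrable lborel (\<lambda>t. of_real (exp (- (z * t))) * \<omega> t)"
    and \<omega>l: "(\<integral>t. of_real (exp (- (z * t))) * \<omega> t \<partial>lborel)
      = w0 * of_real (\<Phi> z / (z * (\<Phi> z + \<rho>))) + (\<integral>t. of_real (exp (- (z * t))) * fh t \<partial>lborel) * of_real (1 / (\<Phi> z + \<rho>))"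
    if z: "0 < z" for z
  proof -
    have eq: "of_real (exp (- (z * t))) * \<omega> t = w0 * (of_real (exp (- (z * t))) * a t)
        + of_real (exp (- (z * t))) * (\<integral>s. fh (t - s) * b s \<partial>lborel)" for t
      by (simp add: \<omega>_def algebra_simps)
    note i1 = integrable_mult_right[OF a(3)[OF z], of w0]
      and i2 = integrable_laplace_convolution[OF fhi[OF z] b(3)[OF z]]
    show "integrable lborel (\<lambda>t. of_real (exp (- (z * t))) * \<omega> t)"
      unfolding eq by (rule Bochner_Integration.integrable_add[OF i1 i2])
    show "(\<integral>t. of_real (exp (- (z * t))) * \<omega> t \<partial>lborel)
      = w0 * of_real (\<Phi> z / (z * (\<Phi> z + \<rho>))) + (\<integral>t. of_real (exp (- (z * t))) * fh t \<partial>lborel) * of_real (1 / (\<Phi> z + \<rho>))"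
      unfolding eq Bochner_Integration.integral_add[OF i1 i2]
        laplace_convolution[OF fhi[OF z] b(3)[OF z]] b(4)[OF z]
      by (simp only: integral_mult_right_zero a(4)[OF z])
  qed
  \<comment> \<open>The defect of the Volterra equation for \<omega>. Its Laplace transform is
    computed term by term and vanishes by \<open>alg\<close>.\<close>
  define E where "E t = (\<omega> t + of_real \<rho> * (\<integral>s. \<omega> (t - s) * of_real (k s) \<partial>lborel))
      - (w0 * indicator {0<..} t + (\<integral>s. fh (t - s) * of_real (k s) \<partial>lborel))" for t
  have "AE t in lborel. E t = 0"
  proof (rule laplace_transform_unique_complex[of 0])
    fix z :: real assume z: "0 < z"
    define Lf where "Lf = (\<integral>t. of_real (exp (- (z * t))) * fh t \<partial>lborel)"
    have eq: "of_real (exp (- (z * t))) * E t = (of_real (exp (- (z * t))) * \<omega> t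
        + of_real \<rho> * (of_real (exp (- (z * t))) * (\<integral>s. \<omega> (t - s) * of_real (k s) \<partial>lborel)))
        - (w0 * (of_real (exp (- (z * t))) * indicator {0<..} t)
          + of_real (exp (- (z * t))) * (\<integral>s. fh (t - s) * of_real (k s) \<partial>lborel))" for t
      by (simp add: E_def algebra_simps)
    have hi: "integrable lborel (\<lambda>t. of_real (exp (- (z * t))) * (indicator {0<..} t :: complex))"
      by (rule laplace_integrable_bounded[where C=1]) (auto simp: indicator_def z)
    note i1 = \<omega>i[OF z]
      and i2 = integrable_mult_right[OF integrable_laplace_convolution[OF \<omega>i[OF z] k_laplace_complex(1)[OF z]], of "of_real \<rho>"]
      and i3 = integrable_mult_right[OF hi, of w0]
      and i4 = integrable_laplace_convolution[OF fhi[OF z] k_laplace_complex(1)[OF z]]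
    show "integrable lborel (\<lambda>t. of_real (exp (- (z * t))) * E t)"
      unfolding eq by (intro Bochner_Integration.integrable_diff Bochner_Integration.integrable_add i1 i2 i3 i4)
    have \<Phi>z: "0 < \<Phi> z" "of_real (Psi \<alpha>1 \<alpha>2 c z) = complex_of_real (1 / \<Phi> z)"
      using \<Phi>[OF z] by (simp_all add: \<Phi>_def divide_inverse)
    have nz: "\<Phi> z + \<rho> \<noteq> 0" "\<Phi> z \<noteq> 0" "z \<noteq> 0" using \<Phi>z \<rho> z by auto
    have alg: "(w * (P / (y * (P + r))) + l * (1 / (P + r))) + r * ((w * (P / (y * (P + r))) + l * (1 / (P + r))) * (1 / P))
        - (w * (1 / y) + l * (1 / P)) = 0"
      if "P + r \<noteq> 0" "P \<noteq> 0" "y \<noteq> 0" for w P y r l :: complex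
    proof -
      have "X + r * (X * (1 / P)) = X * ((P + r) / P)" for X using that by (simp add: field_simps)
      then have "(w * (P / (y * (P + r))) + l * (1 / (P + r))) + r * ((w * (P / (y * (P + r))) + l * (1 / (P + r))) * (1 / P))
          = (w * (P / (y * (P + r))) + l * (1 / (P + r))) * ((P + r) / P)" .
      also have "\<dots> = w * (1 / y) + l * (1 / P)"
      proof -
        have "w * (P / (y * (P + r))) * ((P + r) / P) = w * (1 / y)" "l * (1 / (P + r)) * ((P + r) / P) = l * (1 / P)"
          using that by simp_all
        then show ?thesis by (simp only: distrib_right)
      qed
      finally show ?thesis by simp
    qed
    have "(\<integral>t. of_real (exp (- (z * t))) * E t \<partial>lborel)
        = ((w0 * of_real (\<Phi> z / (z * (\<Phi> z + \<rho>))) + Lf * of_real (1 / (\<Phi> z + \<rho>)))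
          + of_real \<rho> * ((w0 * of_real (\<Phi> z / (z * (\<Phi> z + \<rho>))) + Lf * of_real (1 / (\<Phi> z + \<rho>))) * of_real (1 / \<Phi> z)))
          - (w0 * of_real (1 / z) + Lf * of_real (1 / \<Phi> z))"
      unfolding eq
      by (subst Bochner_Integration.integral_diff[OF Bochner_Integration.integrable_add[OF i1 i2] Bochner_Integration.integrable_add[OF i3 i4]])
        (simp only: Bochner_Integration.integral_add[OF i1 i2] Bochner_Integration.integral_add[OF i3 i4]
          integral_mult_right_zero laplace_convolution[OF \<omega>i[OF z] k_laplace_complex(1)[OF z]]
          laplace_convolution[OF fhi[OF z] k_laplace_complex(1)[OF z]]
          k_laplace_complex(2)[OF z] \<omega>l[OF z] laplace_heaviside[OF z] \<Phi>z(2) Lf_def)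
    also have "\<dots> = 0"
      using alg[of "of_real (\<Phi> z)" "of_real \<rho>" "of_real z" w0 Lf] nz
      by (simp add: of_real_eq_0_iff flip: of_real_add)
    finally show "(\<integral>t. of_real (exp (- (z * t))) * E t \<partial>lborel) = 0" .
  next
    fix t :: real assume "t \<le> 0"
    then show "E t = 0"
      using \<omega>0[of t] conv0[of \<omega> "\<lambda>s. of_real (k s)" t] conv0[of fh "\<lambda>s. of_real (k s)" t] \<omega>0 fh0 k_nonpos
      by (simp add: E_def)
  qed
  moreover have U\<omega>: "AE t in lborel. 0 < t \<and> t < T \<longrightarrow> fourier (U t) \<xi> = \<omega> t"
  proof -
    have "AE t in lborel. 0 < t \<longrightarrow> fourier_measure (Z t) \<xi> = a t"
      using a(2) by (simp only: AE_completion_iff)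
    then show ?thesis
    proof eventually_elim
      case (elim t)
      show ?case
      proof
        assume t: "0 < t \<and> t < T"
        have Zt: "finite_measure (Z t)" "sets (Z t) = sets borel"
          using Zf t unfolding Z_family_def by (auto simp: prob_space_def)
        have S: "S_op Z t u0 = conv_measure (Z t) u0" using t by (simp add: S_op_def fun_eq_iff)
        have Si: "integrable lborel (S_op Z t u0)" unfolding S by (rule conv_measure_integrable[OF Zt u0])
        have "0 \<le> C" using f(5)[of 0] f(3) by simp
        have Di: "integrable lborel (duhamel f t)"
          by (rule duhamel_L1_real(1)[OF f(1,2) _ f(3,4), where N="\<lambda>_. C" and C=C]) (use f(5) t T \<open>0 \<le> C\<close> in auto)
        note [measurable] = borel_measurable_integrable[OF Si] borel_measurable_integrable[OF Di]
        have [measurable]: "U t \<in> borel_measurable borel" using U t by blast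
        have "fourier (U t) \<xi> = (\<integral>x. exp (- (\<i> * of_real (x \<bullet> \<xi>))) * of_real (S_op Z t u0 x)
            + exp (- (\<i> * of_real (x \<bullet> \<xi>))) * of_real (duhamel f t x) \<partial>lborel)"
          unfolding fourier_def
        proof (rule integral_cong_AE)
          have "AE x in lborel. U t x = S_op Z t u0 x + duhamel f t x" using U t by blast
          then show "AE x in lborel. exp (- (\<i> * of_real (x \<bullet> \<xi>))) * complex_of_real (U t x)
            = exp (- (\<i> * of_real (x \<bullet> \<xi>))) * of_real (S_op Z t u0 x)
            + exp (- (\<i> * of_real (x \<bullet> \<xi>))) * of_real (duhamel f t x)"
            by eventually_elim (simp add: distrib_left)
        qed auto
        also have "\<dots> = fourier (S_op Z t u0) \<xi> + fourier (duhamel f t) \<xi>"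
          unfolding fourier_def
          by (rule Bochner_Integration.integral_add[OF integrable_fourier[OF Si] integrable_fourier[OF Di]])
        also have "fourier (duhamel f t) \<xi> = (\<integral>s. fh (t - s) * b s \<partial>lborel)"
          unfolding fh_def by (rule fourier_duhamel[OF f(1,2) _ f(3,4,5) b0(1) b(1,2)]) (use t T in auto)
        also have "fourier (S_op Z t u0) \<xi> = w0 * a t"
          unfolding S fourier_conv_measure[OF Zt u0] w0_def using elim t by simp
        finally show "fourier (U t) \<xi> = \<omega> t" by (simp add: \<omega>_def)
      qed
    qed
  qed
  ultimately show ?thesis
  proof eventually_elim
    case (elim t)
    show ?case
    proof
      assume t: "0 < t \<and> t < T"
      have [measurable]: "\<omega> \<in> borel_measurable borel"
      proof -
        have m: "(\<lambda>t. of_real (exp (- (1 * t))) * \<omega> t) \<in> borel_measurable borel"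
          using borel_measurable_integrable[OF \<omega>i[of 1]] by simp
        have "(\<lambda>t. of_real (exp t) * (of_real (exp (- (1 * t))) * \<omega> t)) \<in> borel_measurable borel"
          by (rule borel_measurable_times[OF _ m]) simp
        then show ?thesis by (simp flip: mult.assoc of_real_mult exp_add)
      qed
      \<comment> \<open>The convolution at time t uses U on (0, t) only, so agreement with \<omega>
        almost everywhere on (0, T) is enough.\<close>
      have "(\<integral>s. fourier (U (t - s)) \<xi> * of_real (k s) \<partial>lborel) = (\<integral>s. \<omega> (t - s) * of_real (k s) \<partial>lborel)"
      proof (rule integral_cong_AE)
        have "AE s in lborel. 0 < t + - 1 * s \<and> t + - 1 * s < T \<longrightarrow> fourier (U (t + - 1 * s)) \<xi> = \<omega> (t + - 1 * s)"
          by (rule AE_borel_affine[where P="\<lambda>t. 0 < t \<and> t < T \<longrightarrow> fourier (U t) \<xi> = \<omega> t", OF _ _ U\<omega>]) auto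
        then show "AE s in lborel. fourier (U (t - s)) \<xi> * complex_of_real (k s) = \<omega> (t - s) * of_real (k s)"
        proof eventually_elim
          case (elim s)
          consider "s \<le> 0" | "t \<le> s" | "0 < s" "s < t" by linarith
          then show ?case
          proof cases
            case 2
            then have "U (t - s) = (\<lambda>_. 0)" using U0 by simp
            then show ?thesis using 2 \<omega>0[of "t - s"] by (simp add: fourier_def)
          qed (use elim t k_nonpos in auto)
        qed
      qed (use Um in measurable)
      then show "fourier (U t) \<xi> + of_real ((norm \<xi>)\<^sup>2) * (\<integral>s. fourier (U (t - s)) \<xi> * of_real (k s) \<partial>lborel)
          = fourier u0 \<xi> + (\<integral>s. fourier (f (t - s)) \<xi> * of_real (k s) \<partial>lborel)"
        using elim t by (simp add: E_def w0_def fh_def \<rho>_def)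
    qed
  qed
qed

end

section \<open>Testing with Fourier transforms of weighted measures\<close>

lemma integrable_pair_mult:
  fixes f :: "'a \<Rightarrow> real" and g :: "'b \<Rightarrow> real"
  assumes "sigma_finite_measure M" "sigma_finite_measure N" "integrable M f" "integrable N g"
  shows "integrable (M \<Otimes>\<^sub>M N) (\<lambda>(x, y). f x * g y)"
proof -
  interpret M: sigma_finite_measure M by fact
  interpret N: sigma_finite_measure N by fact
  interpret P: pair_sigma_finite M N ..
  have [measurable]: "f \<in> borel_measurable M" "g \<in> borel_measurable N" using assms by auto
  show ?thesis
    by (rule P.Fubini_integrable) (use assms in \<open>auto simp: case_prod_unfold abs_mult\<close>)
qed

text \<open>Parseval's formula without inversion: as m is the Fourier transform of the measure w
  \<gamma>, testing g against m is the same as integrating the Fourier transform of g against w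
  \<gamma>. It is used with w = 1, m = \<chi> and with w = |\<xi>|^2, m = -\<Delta>\<chi>, for one
  and the same \<gamma>.\<close>

locale fourier_weight =
  fixes \<gamma> :: "(real ^ 'n) measure" and w m :: "real ^ 'n \<Rightarrow> real"
  assumes \<gamma>: "prob_space \<gamma>" "sets \<gamma> = sets borel"
    and w: "integrable \<gamma> w" "\<And>\<xi>. 0 \<le> w \<xi>"
    and m_eq: "\<And>x. (\<integral>\<xi>. of_real (w \<xi>) * exp (- (\<i> * of_real (x \<bullet> \<xi>))) \<partial>\<gamma>) = of_real (m x)"
    and m_meas[measurable]: "m \<in> borel_measurable borel"
begin

sublocale \<gamma>: prob_space \<gamma> by (rule \<gamma>)

lemma sets_\<gamma>[measurable_cong]: "sets \<gamma> = sets borel" by (rule \<gamma>)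

lemma w_meas[measurable]: "w \<in> borel_measurable borel"
  using borel_measurable_integrable[OF w(1)] by simp

lemma m_bound: "\<bar>m x\<bar> \<le> (\<integral>\<xi>. w \<xi> \<partial>\<gamma>)"
proof -
  have "\<bar>m x\<bar> = norm (complex_of_real (m x))" by simp
  also have "\<dots> \<le> (\<integral>\<xi>. norm (of_real (w \<xi>) * exp (- (\<i> * complex_of_real (x \<bullet> \<xi>)))) \<partial>\<gamma>)"
    unfolding m_eq[symmetric] by (rule integral_norm_bound)
  also have "\<dots> = (\<integral>\<xi>. w \<xi> \<partial>\<gamma>)" using w by (simp add: norm_mult)
  finally show ?thesis .
qed

lemma m_integrable:
  assumes "integrable lborel g"
  shows "integrable lborel (\<lambda>x. m x * g x)"
proof (rule Bochner_Integration.integrable_bound)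
  show "integrable lborel (\<lambda>x. (\<integral>\<xi>. w \<xi> \<partial>\<gamma>) * g x)" using assms by simp
  have [measurable]: "g \<in> borel_measurable borel" using assms by auto
  show "(\<lambda>x. m x * g x) \<in> borel_measurable lborel" by simp
  have "0 \<le> (\<integral>\<xi>. w \<xi> \<partial>\<gamma>)" using w by simp
  then show "AE x in lborel. norm (m x * g x) \<le> norm ((\<integral>\<xi>. w \<xi> \<partial>\<gamma>) * g x)"
    using m_bound by (auto simp: abs_mult intro!: mult_right_mono)
qed

lemma m_integral_bound:
  assumes "integrable lborel g"
  shows "\<bar>\<integral>x. m x * g x \<partial>lborel\<bar> \<le> (\<integral>\<xi>. w \<xi> \<partial>\<gamma>) * (\<integral>x. \<bar>g x\<bar> \<partial>lborel)"
proof -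
  have "\<bar>\<integral>x. m x * g x \<partial>lborel\<bar> \<le> (\<integral>x. \<bar>m x * g x\<bar> \<partial>lborel)"
    using integral_norm_bound[of lborel "\<lambda>x. m x * g x"] by simp
  also have "\<dots> \<le> (\<integral>x. (\<integral>\<xi>. w \<xi> \<partial>\<gamma>) * \<bar>g x\<bar> \<partial>lborel)"
    using assms m_bound by (intro integral_mono integrable_abs m_integrable integrable_mult_right)
      (auto simp: abs_mult intro!: mult_right_mono)
  finally show ?thesis by simp
qed

lemma
  assumes g: "integrable lborel g"
  shows fourier_weight_integrable: "integrable \<gamma> (\<lambda>\<xi>. of_real (w \<xi>) * fourier g \<xi>)"
    and fourier_weight_integral:
      "(\<integral>\<xi>. of_real (w \<xi>) * fourier g \<xi> \<partial>\<gamma>) = of_real (\<integral>x. m x * g x \<partial>lborel)"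
proof -
  interpret P: pair_sigma_finite \<gamma> "lborel :: (real ^ 'n) measure" ..
  have [measurable]: "g \<in> borel_measurable borel" using g by auto
  have "integrable (\<gamma> \<Otimes>\<^sub>M lborel) (\<lambda>(\<xi>, x). w \<xi> * g x)"
    by (rule integrable_pair_mult[OF _ _ w(1) g]) unfold_locales
  then have int: "integrable (\<gamma> \<Otimes>\<^sub>M lborel)
      (\<lambda>(\<xi>, x). of_real (w \<xi>) * (exp (- (\<i> * of_real (x \<bullet> \<xi>))) * complex_of_real (g x)))"
  proof (rule Bochner_Integration.integrable_bound)
    show "(\<lambda>(\<xi>, x). of_real (w \<xi>) * (exp (- (\<i> * of_real (x \<bullet> \<xi>))) * complex_of_real (g x)))
        \<in> borel_measurable (\<gamma> \<Otimes>\<^sub>M lborel)"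
      by (simp add: case_prod_unfold)
  qed (auto simp: norm_mult abs_mult)
  show "integrable \<gamma> (\<lambda>\<xi>. of_real (w \<xi>) * fourier g \<xi>)"
    using P.integrable_fst[OF int] by (simp add: fourier_def)
  have "(\<integral>\<xi>. of_real (w \<xi>) * fourier g \<xi> \<partial>\<gamma>)
      = (\<integral>\<xi>. (\<integral>x. of_real (w \<xi>) * (exp (- (\<i> * of_real (x \<bullet> \<xi>))) * complex_of_real (g x)) \<partial>lborel) \<partial>\<gamma>)"
    by (simp add: fourier_def)
  also have "\<dots> = (\<integral>x. (\<integral>\<xi>. of_real (w \<xi>) * (exp (- (\<i> * of_real (x \<bullet> \<xi>))) * complex_of_real (g x)) \<partial>\<gamma>) \<partial>lborel)"
    by (rule P.Fubini_integral[OF int, symmetric])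
  also have "\<dots> = (\<integral>x. complex_of_real (m x * g x) \<partial>lborel)"
    by (intro Bochner_Integration.integral_cong refl)
      (simp only: mult.assoc[symmetric] integral_mult_left_zero m_eq of_real_mult)
  also have "\<dots> = of_real (\<integral>x. m x * g x \<partial>lborel)" by (rule integral_complex_of_real)
  finally show "(\<integral>\<xi>. of_real (w \<xi>) * fourier g \<xi> \<partial>\<gamma>) = of_real (\<integral>x. m x * g x \<partial>lborel)" .
qed

end

text \<open>Adds the time kernel, so that memory terms of the Volterra equation can be tested in the
  same way.\<close>

locale fourier_weight_kernel = fourier_weight \<gamma> w m + volterra_kernel \<alpha>1 \<alpha>2 c k
  for \<gamma> :: "(real ^ 'n) measure" and w m \<alpha>1 \<alpha>2 c k
begin

lemma
  fixes g :: "real \<Rightarrow> real ^ 'n \<Rightarrow> real"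
  assumes g: "(\<lambda>(s, x). g s x) \<in> borel_measurable (borel \<Otimes>\<^sub>M borel)" "\<And>s. integrable lborel (g s)"
    "\<And>s. (\<integral>x. \<bar>g s x\<bar> \<partial>lborel) \<le> C" "\<forall>s\<le>0. g s = (\<lambda>_. 0)"
  shows fourier_weight_conv_integrable:
      "integrable \<gamma> (\<lambda>\<xi>. of_real (w \<xi>) * (\<integral>s. fourier (g (t - s)) \<xi> * of_real (k s) \<partial>lborel))"
    and fourier_weight_conv_integral:
      "(\<integral>\<xi>. of_real (w \<xi>) * (\<integral>s. fourier (g (t - s)) \<xi> * of_real (k s) \<partial>lborel) \<partial>\<gamma>)
        = of_real (\<integral>s. indicator {..t} s * k s * (\<integral>x. m x * g (t - s) x \<partial>lborel) \<partial>lborel)"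
proof -
  interpret P: pair_sigma_finite \<gamma> "lborel :: real measure" ..
  have fm: "(\<lambda>p. fourier (g (t - snd p)) (fst p)) \<in> borel_measurable (borel \<Otimes>\<^sub>M borel)"
  proof -
    have "(\<lambda>p :: (real ^ 'n) \<times> real. (t - snd p, fst p)) \<in> (borel \<Otimes>\<^sub>M borel) \<rightarrow>\<^sub>M (borel \<Otimes>\<^sub>M borel)"
      by measurable
    from measurable_compose[OF this fourier_measurable[OF g(1)]] show ?thesis by simp
  qed
  \<comment> \<open>The support of g is made visible as an indicator, since k is known to be
    integrable up to finite times only.\<close>
  have fz: "fourier (g (t - s)) \<xi> * of_real (k s) = of_real (indicator {..t} s * k s) * fourier (g (t - s)) \<xi>" for s \<xi>
    using g(4)[rule_format, of "t - s"] by (cases "s \<le> t") (auto simp: fourier_def)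
  have C: "0 \<le> C" using g(3)[of 0] g(4) by simp
  have "integrable (\<gamma> \<Otimes>\<^sub>M lborel) (\<lambda>(\<xi>, s). w \<xi> * (C * (indicator {..t} s * k s)))"
    by (rule integrable_pair_mult[OF _ _ w(1) integrable_mult_right[OF integrable_indicator_k]]) unfold_locales
  then have int: "integrable (\<gamma> \<Otimes>\<^sub>M lborel)
      (\<lambda>(\<xi>, s). of_real (w \<xi>) * (fourier (g (t - s)) \<xi> * of_real (k s)))"
  proof (rule Bochner_Integration.integrable_bound)
    show "(\<lambda>(\<xi>, s). of_real (w \<xi>) * (fourier (g (t - s)) \<xi> * complex_of_real (k s))) \<in> borel_measurable (\<gamma> \<Otimes>\<^sub>M lborel)"
      using fm by (simp add: case_prod_unfold cong: measurable_cong_sets)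
    have "norm (of_real (w \<xi>) * (fourier (g (t - s)) \<xi> * of_real (k s))) \<le> w \<xi> * (C * (indicator {..t} s * k s))" for \<xi> s
    proof -
      have "norm (fourier (g (t - s)) \<xi>) \<le> C" using norm_fourier_le[OF g(2)] g(3) by (rule order_trans)
      then show ?thesis unfolding fz using w k_nonneg[of s] C
        by (auto simp: norm_mult abs_mult indicator_def mult.commute[of C] intro!: mult_left_mono)
    qed
    then show "AE p in \<gamma> \<Otimes>\<^sub>M lborel. norm (case p of (\<xi>, s) \<Rightarrow> of_real (w \<xi>) * (fourier (g (t - s)) \<xi> * complex_of_real (k s)))
        \<le> norm (case p of (\<xi>, s) \<Rightarrow> w \<xi> * (C * (indicator {..t} s * k s)))"
      by (intro AE_I2) (auto simp: case_prod_unfold intro: order_trans[OF _ abs_ge_self])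
  qed
  show "integrable \<gamma> (\<lambda>\<xi>. of_real (w \<xi>) * (\<integral>s. fourier (g (t - s)) \<xi> * of_real (k s) \<partial>lborel))"
    using P.integrable_fst[OF int] by simp
  have "(\<integral>\<xi>. of_real (w \<xi>) * (\<integral>s. fourier (g (t - s)) \<xi> * of_real (k s) \<partial>lborel) \<partial>\<gamma>)
      = (\<integral>\<xi>. (\<integral>s. of_real (w \<xi>) * (fourier (g (t - s)) \<xi> * of_real (k s)) \<partial>lborel) \<partial>\<gamma>)"
    by (simp only: integral_mult_right_zero)
  also have "\<dots> = (\<integral>s. (\<integral>\<xi>. of_real (w \<xi>) * (fourier (g (t - s)) \<xi> * of_real (k s)) \<partial>\<gamma>) \<partial>lborel)"
    by (rule P.Fubini_integral[OF int, symmetric])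
  also have "\<dots> = (\<integral>s. complex_of_real (indicator {..t} s * k s * (\<integral>x. m x * g (t - s) x \<partial>lborel)) \<partial>lborel)"
  proof (intro Bochner_Integration.integral_cong refl)
    fix s
    have "(\<integral>\<xi>. of_real (w \<xi>) * (fourier (g (t - s)) \<xi> * of_real (k s)) \<partial>\<gamma>)
        = (\<integral>\<xi>. of_real (indicator {..t} s * k s) * (of_real (w \<xi>) * fourier (g (t - s)) \<xi>) \<partial>\<gamma>)"
      unfolding fz by (simp only: mult.left_commute)
    also have "\<dots> = complex_of_real (indicator {..t} s * k s * (\<integral>x. m x * g (t - s) x \<partial>lborel))"
      by (simp only: integral_mult_right_zero fourier_weight_integral[OF g(2)] of_real_mult)
    finally show "(\<integral>\<xi>. of_real (w \<xi>) * (fourier (g (t - s)) \<xi> * of_real (k s)) \<partial>\<gamma>)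
        = complex_of_real (indicator {..t} s * k s * (\<integral>x. m x * g (t - s) x \<partial>lborel))" .
  qed
  also have "\<dots> = of_real (\<integral>s. indicator {..t} s * k s * (\<integral>x. m x * g (t - s) x \<partial>lborel) \<partial>lborel)"
    by (rule integral_complex_of_real)
  finally show "(\<integral>\<xi>. of_real (w \<xi>) * (\<integral>s. fourier (g (t - s)) \<xi> * of_real (k s) \<partial>lborel) \<partial>\<gamma>)
        = of_real (\<integral>s. indicator {..t} s * k s * (\<integral>x. m x * g (t - s) x \<partial>lborel) \<partial>lborel)" .
qed

end

subsection \<open>Upper bound for the existence time\<close>

abbreviation gauss :: "real ^ 'n \<Rightarrow> real" where
  "gauss x \<equiv> exp (- (norm x)\<^sup>2 / 2)"

lemma gauss_mult_integrable: "integrable lborel (g :: real ^ 'n \<Rightarrow> real) \<Longrightarrow> integrable lborel (\<lambda>x. gauss x * g x)"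
  by (rule Bochner_Integration.integrable_bound[of lborel g])
    (auto simp: abs_mult intro!: mult_left_le_one_le borel_measurable_integrable)

lemma gauss_integral_pos: "0 < (\<integral>x. gauss x \<partial>(lborel :: (real ^ 'n) measure))"
proof -
  have "0 \<le> (\<integral>x. gauss x \<partial>(lborel :: (real ^ 'n) measure))" by simp
  moreover have "(\<integral>x. gauss x \<partial>(lborel :: (real ^ 'n) measure)) \<noteq> 0"
  proof
    assume "(\<integral>x. gauss x \<partial>(lborel :: (real ^ 'n) measure)) = 0"
    then have "AE x in (lborel :: (real ^ 'n) measure). gauss x = 0"
      by (subst (asm) integral_nonneg_eq_0_iff_AE[OF gaussian_integrable]) auto
    then have "AE x in (lborel :: (real ^ 'n) measure). False" by simp
    then have "emeasure (lborel :: (real ^ 'n) measure) UNIV = 0"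
      by (subst (asm) AE_iff_measurable[of UNIV]) auto
    then show False by simp
  qed
  ultimately show ?thesis by (metis order_le_imp_less_or_eq)
qed

text \<open>The tangent inequality at the weighted mean m = G / N is integrated, and its linear term
  cancels because G = m N. A separate h stands for the power, since the truncated source equals it
  almost everywhere only.\<close>

lemma gauss_jensen:
  fixes g h :: "real ^ 'n \<Rightarrow> real"
  assumes p: "1 < p" and g: "integrable lborel g" "AE x in lborel. 0 \<le> g x"
    and h: "integrable lborel h" "AE x in lborel. h x = g x powr p"
  shows "(\<integral>x. gauss x \<partial>(lborel :: (real ^ 'n) measure)) powr (1 - p) * (\<integral>x. gauss x * g x \<partial>lborel) powr p
    \<le> (\<integral>x. gauss x * h x \<partial>lborel)"
proof -
  define N where "N = (\<integral>x. gauss x \<partial>(lborel :: (real ^ 'n) measure))"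
  define G where "G = (\<integral>x. gauss x * g x \<partial>lborel)"
  have N: "0 < N" unfolding N_def by (rule gauss_integral_pos)
  have G: "0 \<le> G" unfolding G_def using g(2) by (intro integral_nonneg_AE) (auto elim: eventually_mono)
  show ?thesis
  proof (cases "G = 0")
    case True
    have "0 \<le> (\<integral>x. gauss x * h x \<partial>lborel)"
      using h(2) by (intro integral_nonneg_AE) (auto elim!: eventually_mono)
    then show ?thesis using True by (simp add: G_def)
  next
    case False
    then have G: "0 < G" using G by simp
    define m where "m = G / N"
    have m: "0 < m" using G N by (simp add: m_def)
    have "m powr p * N + p * m powr (p - 1) * (G - m * N)
        = (\<integral>x. (m powr p * gauss x + p * m powr (p - 1) * (gauss x * g x - m * gauss x)) \<partial>lborel)"
      using gaussian_integrable[where 'a="real ^ 'n"] gauss_mult_integrable[OF g(1)]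
      by (simp add: N_def G_def)
    also have "\<dots> \<le> (\<integral>x. gauss x * h x \<partial>lborel)"
    proof (rule integral_mono_AE)
      show "integrable lborel (\<lambda>x. m powr p * gauss x + p * m powr (p - 1) * (gauss x * g x - m * gauss x))"
        by (intro Bochner_Integration.integrable_add integrable_mult_right Bochner_Integration.integrable_diff
            gaussian_integrable gauss_mult_integrable g)
      show "integrable lborel (\<lambda>x. gauss x * h x)" by (rule gauss_mult_integrable[OF h(1)])
      show "AE x in lborel. m powr p * gauss x + p * m powr (p - 1) * (gauss x * g x - m * gauss x) \<le> gauss x * h x"
        using g(2) h(2)
      proof eventually_elim
        case (elim x)
        have "gauss x * (m powr p + p * m powr (p - 1) * (g x - m)) \<le> gauss x * h x"
          using powr_tangent_le[OF p elim(1) m] elim(2) by (intro mult_left_mono) auto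
        then show ?case by (simp add: algebra_simps)
      qed
    qed
    also have "m powr p * N + p * m powr (p - 1) * (G - m * N) = N powr (1 - p) * G powr p"
      using N G by (simp add: m_def powr_divide powr_diff divide_simps)
    finally show ?thesis by (simp add: N_def G_def)
  qed
qed

lemma gaussian_fourier_weights:
  obtains \<gamma> :: "(real ^ 'n) measure" where
    "fourier_weight \<gamma> (\<lambda>_. 1) gauss"
    "fourier_weight \<gamma> (\<lambda>\<xi>. (norm \<xi>)\<^sup>2) (\<lambda>x. (CARD('n) - (norm x)\<^sup>2) * gauss x)"
proof -
  obtain \<gamma> :: "(real ^ 'n) measure" where
    \<gamma>: "prob_space \<gamma>" "sets \<gamma> = sets borel" "integrable \<gamma> (\<lambda>\<xi>. (norm \<xi>)\<^sup>2)"
    "\<And>x. (\<integral>\<xi>. exp (- (\<i> * of_real (x \<bullet> \<xi>))) \<partial>\<gamma>) = of_real (gauss x)"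
    "\<And>x. (\<integral>\<xi>. of_real ((norm \<xi>)\<^sup>2) * exp (- (\<i> * of_real (x \<bullet> \<xi>))) \<partial>\<gamma>)
      = of_real ((DIM(real ^ 'n) - (norm x)\<^sup>2) * gauss x)"
    using gaussian_fourier_representation by blast
  interpret prob_space \<gamma> by fact
  show thesis
  proof (rule that[of \<gamma>])
    show "fourier_weight \<gamma> (\<lambda>_. 1) gauss"
      by unfold_locales (use \<gamma>(2,4) in auto)
    show "fourier_weight \<gamma> (\<lambda>\<xi>. (norm \<xi>)\<^sup>2) (\<lambda>x. (CARD('n) - (norm x)\<^sup>2) * gauss x)"
      by unfold_locales (use \<gamma>(2,3,5) in auto)
  qed
qed

context spacetime_kernel begin

text \<open>The Volterra identity in frequency, integrated against \<gamma>, becomes an identity for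
  Gaussian moments with multiplier (n - |x|^2) \<chi> in the memory term. Dropping -|x|^2 is a
  one-sided estimate because U \<ge> 0 and k \<ge> 0.\<close>

lemma gauss_moment_inequality:
  fixes U f :: "real \<Rightarrow> real ^ 'n \<Rightarrow> real"
  assumes Zf: "Z_family \<alpha>1 \<alpha>2 c Z" and Yf: "Y_family \<alpha>1 \<alpha>2 c Y" and u0: "integrable lborel u0"
    and f: "(\<lambda>(s, x). f s x) \<in> borel_measurable (borel \<Otimes>\<^sub>M borel)" "\<And>s x. \<bar>f s x\<bar> \<le> B"
      "\<And>s x. s \<le> 0 \<Longrightarrow> f s x = 0" "\<And>s. integrable lborel (f s)" "\<And>s. (\<integral>x. \<bar>f s x\<bar> \<partial>lborel) \<le> C"
    and T: "T \<le> 1"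
    and Um: "(\<lambda>(s, x). U s x) \<in> borel_measurable (borel \<Otimes>\<^sub>M borel)"
    and U0: "\<And>s. s \<le> 0 \<Longrightarrow> U s = (\<lambda>_. 0)"
    and Ui: "\<And>s. integrable lborel (U s)" "\<And>s. (\<integral>x. \<bar>U s x\<bar> \<partial>lborel) \<le> C'"
    and Upos: "\<And>s. AE x in lborel. 0 \<le> U s x"
    and U: "\<And>t. 0 < t \<Longrightarrow> t < T \<Longrightarrow> AE x in lborel. U t x = S_op Z t u0 x + duhamel f t x"
  shows "AE t in lborel. 0 < t \<and> t < T \<longrightarrow>
    (\<integral>x. gauss x * u0 x \<partial>lborel) + (\<integral>s. indicator {..t} s * k s * (\<integral>x. gauss x * f (t - s) x \<partial>lborel) \<partial>lborel)
      \<le> (\<integral>x. gauss x * U t x \<partial>lborel)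
        + CARD('n) * (\<integral>s. indicator {..t} s * k s * (\<integral>x. gauss x * U (t - s) x \<partial>lborel) \<partial>lborel)"
proof -
  let ?n = "real CARD('n)"
  let ?q = "\<lambda>x :: real ^ 'n. (?n - (norm x)\<^sup>2) * gauss x"
  obtain \<gamma> :: "(real ^ 'n) measure" where \<gamma>1: "fourier_weight \<gamma> (\<lambda>_. 1) gauss"
    and \<gamma>2: "fourier_weight \<gamma> (\<lambda>\<xi>. (norm \<xi>)\<^sup>2) ?q"
    using gaussian_fourier_weights by blast
  interpret W: fourier_weight_kernel \<gamma> "\<lambda>_. 1" gauss \<alpha>1 \<alpha>2 c k
    by (intro fourier_weight_kernel.intro \<gamma>1 volterra_kernel_axioms)
  interpret V: fourier_weight_kernel \<gamma> "\<lambda>\<xi>. (norm \<xi>)\<^sup>2" ?q \<alpha>1 \<alpha>2 c k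
    by (intro fourier_weight_kernel.intro \<gamma>2 volterra_kernel_axioms)
  interpret P: pair_sigma_finite \<gamma> "lborel :: real measure" ..
  note [measurable_cong] = W.sets_\<gamma>
  define eq where "eq \<xi> t \<longleftrightarrow> (0 < t \<and> t < T \<longrightarrow>
    fourier (U t) \<xi> + of_real ((norm \<xi>)\<^sup>2) * (\<integral>s. fourier (U (t - s)) \<xi> * of_real (k s) \<partial>lborel)
      = fourier u0 \<xi> + (\<integral>s. fourier (f (t - s)) \<xi> * of_real (k s) \<partial>lborel))" for \<xi> t
  have Us[measurable]: "U s \<in> borel_measurable borel" for s using Ui(1)[of s] by auto
  have "AE t in lborel. eq \<xi> t" for \<xi>
    unfolding eq_def
    by (rule volterra_fourier_identity[OF Zf Yf u0 f(1,2) _ f(4,5) T U0])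
      (use f(3) U Us fourier_measurable_time[OF Um] in auto)
  then have "AE \<xi> in \<gamma>. AE t in lborel. eq \<xi> t" by simp
  \<comment> \<open>The exceptional times depend on \<xi>. Joint measurability of the identity in
    (\<xi>, t) yields one null set of times off which it holds for \<gamma>-almost every
    \<xi>.\<close>
  then have "AE t in lborel. AE \<xi> in \<gamma>. eq \<xi> t"
  proof (subst P.AE_commute[symmetric])
    have conv: "(\<lambda>p. \<integral>s. fourier (g (snd p - s)) (fst p) * of_real (k s) \<partial>lborel) \<in> borel_measurable (borel \<Otimes>\<^sub>M borel)"
      if g: "(\<lambda>(s, x). g s x) \<in> borel_measurable (borel \<Otimes>\<^sub>M borel)" for g :: "real \<Rightarrow> real ^ 'n \<Rightarrow> real"
    proof -
      have "(\<lambda>p :: ((real ^ 'n) \<times> real) \<times> real. (snd (fst p) - snd p, fst (fst p)))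
          \<in> ((borel \<Otimes>\<^sub>M borel) \<Otimes>\<^sub>M lborel) \<rightarrow>\<^sub>M (borel \<Otimes>\<^sub>M borel)" by measurable
      from measurable_compose[OF this fourier_measurable[OF g]]
      have [measurable]: "(\<lambda>p. fourier (g (snd (fst p) - snd p)) (fst (fst p))) \<in> borel_measurable ((borel \<Otimes>\<^sub>M borel) \<Otimes>\<^sub>M lborel)"
        by simp
      show ?thesis
        by (rule lborel.borel_measurable_lebesgue_integral) (simp add: case_prod_unfold)
    qed
    have [measurable]: "(\<lambda>p. fourier (U (snd p)) (fst p)) \<in> borel_measurable (borel \<Otimes>\<^sub>M borel)"
    proof -
      have "(\<lambda>p :: (real ^ 'n) \<times> real. (snd p, fst p)) \<in> (borel \<Otimes>\<^sub>M borel) \<rightarrow>\<^sub>M (borel \<Otimes>\<^sub>M borel)" by measurable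
      from measurable_compose[OF this fourier_measurable[OF Um]] show ?thesis by simp
    qed
    have [measurable]: "fourier u0 \<in> borel_measurable borel"
    proof -
      have "(\<lambda>(s :: real, x). u0 x) \<in> borel_measurable (borel \<Otimes>\<^sub>M borel)"
        using u0 by (auto intro!: measurable_compose[OF measurable_snd] simp: case_prod_unfold)
      from measurable_compose[OF _ fourier_measurable[OF this], of "\<lambda>x. (0, x)"] show ?thesis by simp
    qed
    note [measurable] = conv[OF Um] conv[OF f(1)]
    show "{p \<in> space (\<gamma> \<Otimes>\<^sub>M lborel). eq (fst p) (snd p)} \<in> sets (\<gamma> \<Otimes>\<^sub>M lborel)"
      unfolding eq_def by measurable
  qed
  then show ?thesis
  proof eventually_elim
    case (elim t)
    show ?case
    proof
      assume t: "0 < t \<and> t < T"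
      have f0: "\<forall>s\<le>0. f s = (\<lambda>_. 0)" and U0': "\<forall>s\<le>0. U s = (\<lambda>_. 0)"
        using f(3) U0 by auto
      have ae: "AE \<xi> in \<gamma>. 1 * fourier (U t) \<xi> + of_real ((norm \<xi>)\<^sup>2) * (\<integral>s. fourier (U (t - s)) \<xi> * of_real (k s) \<partial>lborel)
          = 1 * fourier u0 \<xi> + 1 * (\<integral>s. fourier (f (t - s)) \<xi> * of_real (k s) \<partial>lborel)"
        using elim by eventually_elim (use t in \<open>simp add: eq_def\<close>)
      note i1 = W.fourier_weight_integrable[OF Ui(1), of t, unfolded of_real_1]
        and i2 = V.fourier_weight_conv_integrable[OF Um Ui U0', of t]
        and i3 = W.fourier_weight_integrable[OF u0, unfolded of_real_1]
        and i4 = W.fourier_weight_conv_integrable[OF f(1,4,5) f0, of t, unfolded of_real_1]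
      have "(\<integral>\<xi>. 1 * fourier (U t) \<xi> + of_real ((norm \<xi>)\<^sup>2) * (\<integral>s. fourier (U (t - s)) \<xi> * of_real (k s) \<partial>lborel) \<partial>\<gamma>)
          = (\<integral>\<xi>. 1 * fourier u0 \<xi> + 1 * (\<integral>s. fourier (f (t - s)) \<xi> * of_real (k s) \<partial>lborel) \<partial>\<gamma>)"
        using borel_measurable_integrable[OF Bochner_Integration.integrable_add[OF i1 i2]]
          borel_measurable_integrable[OF Bochner_Integration.integrable_add[OF i3 i4]] ae
        by (rule integral_cong_AE)
      then have "complex_of_real ((\<integral>x. gauss x * U t x \<partial>lborel)
            + (\<integral>s. indicator {..t} s * k s * (\<integral>x. ?q x * U (t - s) x \<partial>lborel) \<partial>lborel))
          = of_real ((\<integral>x. gauss x * u0 x \<partial>lborel)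
            + (\<integral>s. indicator {..t} s * k s * (\<integral>x. gauss x * f (t - s) x \<partial>lborel) \<partial>lborel))"
        unfolding Bochner_Integration.integral_add[OF i1 i2] Bochner_Integration.integral_add[OF i3 i4]
        using W.fourier_weight_integral[OF Ui(1), of t, unfolded of_real_1]
          V.fourier_weight_conv_integral[OF Um Ui U0', of t]
          W.fourier_weight_integral[OF u0, unfolded of_real_1]
          W.fourier_weight_conv_integral[OF f(1,4,5) f0, of t, unfolded of_real_1]
        by (simp only: of_real_add)
      then have eqr: "(\<integral>x. gauss x * U t x \<partial>lborel)
            + (\<integral>s. indicator {..t} s * k s * (\<integral>x. ?q x * U (t - s) x \<partial>lborel) \<partial>lborel)
          = (\<integral>x. gauss x * u0 x \<partial>lborel)
            + (\<integral>s. indicator {..t} s * k s * (\<integral>x. gauss x * f (t - s) x \<partial>lborel) \<partial>lborel)"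
        by (simp only: of_real_eq_iff)
      have mt: "(\<lambda>s. \<integral>x. m x * U s x \<partial>lborel) \<in> borel_measurable borel"
        if [measurable]: "m \<in> borel_measurable borel" for m :: "real ^ 'n \<Rightarrow> real"
      proof (rule lborel.borel_measurable_lebesgue_integral)
        show "(\<lambda>(s, x). m x * U s x) \<in> borel_measurable (borel \<Otimes>\<^sub>M lborel)"
          using Um by (simp add: case_prod_unfold cong: measurable_cong_sets)
      qed
      have "(\<integral>s. indicator {..t} s * k s * (\<integral>x. ?q x * U (t - s) x \<partial>lborel) \<partial>lborel)
          \<le> (\<integral>s. ?n * (indicator {..t} s * k s * (\<integral>x. gauss x * U (t - s) x \<partial>lborel)) \<partial>lborel)"
      proof (rule integral_mono)
        have b1: "\<bar>\<integral>x. gauss x * U s x \<partial>lborel\<bar> \<le> (\<integral>\<xi>. 1 \<partial>\<gamma>) * C'" for s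
          using W.m_integral_bound[OF Ui(1)[of s]] Ui(2)[of s] by (rule order_trans[OF _ mult_left_mono]) auto
        have b2: "\<bar>\<integral>x. ?q x * U s x \<partial>lborel\<bar> \<le> (\<integral>\<xi>. (norm \<xi>)\<^sup>2 \<partial>\<gamma>) * C'" for s
          using V.m_integral_bound[OF Ui(1)[of s]] Ui(2)[of s] by (rule order_trans[OF _ mult_left_mono]) auto
        show "integrable lborel (\<lambda>s. indicator {..t} s * k s * (\<integral>x. ?q x * U (t - s) x \<partial>lborel))"
          by (rule conv_integrable[OF mt b2]) measurable
        show "integrable lborel (\<lambda>s. ?n * (indicator {..t} s * k s * (\<integral>x. gauss x * U (t - s) x \<partial>lborel)))"
          by (rule integrable_mult_right, rule conv_integrable[OF mt b1]) measurable
        fix s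
        have "(\<integral>x. ?q x * U (t - s) x \<partial>lborel) \<le> (\<integral>x. ?n * (gauss x * U (t - s) x) \<partial>lborel)"
        proof (rule integral_mono_AE)
          show "AE x in lborel. ?q x * U (t - s) x \<le> ?n * (gauss x * U (t - s) x)"
            using Upos[of "t - s"]
          proof eventually_elim
            case (elim x)
            have "(?n - (norm x)\<^sup>2) * (gauss x * U (t - s) x) \<le> ?n * (gauss x * U (t - s) x)"
              using elim by (intro mult_right_mono) auto
            then show ?case by (simp only: mult.assoc)
          qed
        qed (intro V.m_integrable integrable_mult_right gauss_mult_integrable Ui)+
        then have "(indicator {..t} s * k s) * (\<integral>x. ?q x * U (t - s) x \<partial>lborel)
            \<le> (indicator {..t} s * k s) * (?n * (\<integral>x. gauss x * U (t - s) x \<partial>lborel))"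
          using k_nonneg[of s] by (intro mult_left_mono) (simp_all only: integral_mult_right_zero, auto)
        then show "indicator {..t} s * k s * (\<integral>x. ?q x * U (t - s) x \<partial>lborel)
            \<le> ?n * (indicator {..t} s * k s * (\<integral>x. gauss x * U (t - s) x \<partial>lborel))"
          by (simp only: mult_ac)
      qed
      also have "\<dots> = ?n * (\<integral>s. indicator {..t} s * k s * (\<integral>x. gauss x * U (t - s) x \<partial>lborel) \<partial>lborel)"
        by (rule integral_mult_right_zero)
      finally show "(\<integral>x. gauss x * u0 x \<partial>lborel) + (\<integral>s. indicator {..t} s * k s * (\<integral>x. gauss x * f (t - s) x \<partial>lborel) \<partial>lborel)
      \<le> (\<integral>x. gauss x * U t x \<partial>lborel)
        + ?n * (\<integral>s. indicator {..t} s * k s * (\<integral>x. gauss x * U (t - s) x \<partial>lborel) \<partial>lborel)"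
        using eqr by linarith
    qed
  qed
qed

text \<open>The Gaussian moment of the solution satisfies the Volterra inequality with initial value
  A g0, which passes every threshold as A grows. Here g0 > 0, because \<chi> is positive everywhere
  and \<phi> is nonnegative and nonzero.\<close>

lemma mild_existence_time_upper_bound:
  fixes \<phi> :: "real ^ 'n \<Rightarrow> real"
  assumes Zf: "Z_family \<alpha>1 \<alpha>2 c Z" and Yf: "Y_family \<alpha>1 \<alpha>2 c Y" and p: "1 < p"
    and \<phi>: "integrable lborel \<phi>" "AE x in lborel. 0 \<le> \<phi> x" "\<not> (AE x in lborel. \<phi> x = 0)"
  obtains C A0 where "0 < C" "0 < A0"
    "\<And>A T u. A0 \<le> A \<Longrightarrow> 0 < T \<Longrightarrow> T \<le> 1 \<Longrightarrow> mild_solution Z Y p (\<lambda>x. A * \<phi> x) T u \<Longrightarrow>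
      (\<forall>t\<in>{0..T}. AE x in lborel. 0 \<le> u t x) \<Longrightarrow> T \<le> C * A powr (- (p - 1) / \<alpha>1)"
proof -
  define N where "N = (\<integral>x. gauss x \<partial>(lborel :: (real ^ 'n) measure))"
  have N: "0 < N" unfolding N_def by (rule gauss_integral_pos)
  define g0 where "g0 = (\<integral>x. gauss x * \<phi> x \<partial>lborel)"
  have g0: "0 < g0"
  proof -
    have "0 \<le> g0" unfolding g0_def using \<phi>(2) by (intro integral_nonneg_AE) (auto elim: eventually_mono)
    moreover have "g0 \<noteq> 0"
    proof
      assume "g0 = 0"
      then have "AE x in lborel. gauss x * \<phi> x = 0"
        unfolding g0_def using \<phi>(2) gauss_mult_integrable[OF \<phi>(1)]
        by (subst (asm) integral_nonneg_eq_0_iff_AE) (auto elim: eventually_mono)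
      then show False using \<phi>(3) by simp
    qed
    ultimately show ?thesis by simp
  qed
  show thesis
  \<comment> \<open>N^(1-p) is the constant of Jensen's inequality for the unnormalised weight
    \<chi> of total mass N, and n is the constant of the Laplacian bound.\<close>
  proof (rule blow_up_time_bound[of p "N powr (1 - p)" "real CARD('n)"])
    fix C G1
    assume C: "0 < C" "0 < G1" and blow:
    "\<And>G0 T G M. G1 \<le> G0 \<Longrightarrow> 0 < T \<Longrightarrow> T \<le> 1 \<Longrightarrow>
      G \<in> borel_measurable borel \<Longrightarrow> (\<And>t. 0 \<le> G t) \<Longrightarrow> (\<And>t. G t \<le> M) \<Longrightarrow>
      (AE t in lborel. 0 < t \<and> t < T \<longrightarrow>
        G0 + N powr (1 - p) * (\<integral>s. indicator {..t} s * k s * G (t - s) powr p \<partial>lborel)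
          \<le> G t + CARD('n) * (\<integral>s. indicator {..t} s * k s * G (t - s) \<partial>lborel)) \<Longrightarrow>
      T \<le> C * G0 powr (- (p - 1) / \<alpha>1)"
  show thesis
  proof (rule that[of "C * g0 powr (- (p - 1) / \<alpha>1)" "G1 / g0"])
    fix A T u
    assume A: "G1 / g0 \<le> A" and T: "0 < T" "T \<le> 1" and u: "mild_solution Z Y p (\<lambda>x. A * \<phi> x) T u"
      and upos: "\<forall>t\<in>{0..T}. AE x in lborel. 0 \<le> u t x"
    have A0: "0 < A" using A C g0 by (meson divide_pos_pos less_le_trans)
    have L: "L1_curve T u" by (rule mild_solution_L1_curve[OF u])
    obtain M0 where M0: "\<And>M. M0 \<le> M \<Longrightarrow> 0 < M \<Longrightarrow>
      (AE s in lborel. 0 < s \<and> s < T \<longrightarrow> (AE x in lborel. \<bar>u s x\<bar> \<le> M)) \<and>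
      (\<forall>t\<in>{0..T}. AE x in lborel. u t x = S_op Z t (\<lambda>x. A * \<phi> x) x + duhamel (source p M T u) t x)"
      using mild_solution_duhamel[OF u T p] by blast
    define M where "M = max M0 1"
    have M: "0 < M" by (simp add: M_def)
    have bd: "AE s in lborel. 0 < s \<and> s < T \<longrightarrow> (AE x in lborel. \<bar>u s x\<bar> \<le> M)"
      and ueq: "\<forall>t\<in>{0..T}. AE x in lborel. u t x = S_op Z t (\<lambda>x. A * \<phi> x) x + duhamel (source p M T u) t x"
      using M0[of M] M by (auto simp: M_def)
    obtain C1 where C1: "0 \<le> C1" "\<And>t. t \<in> {0..T} \<Longrightarrow> (\<integral>x. \<bar>u t x\<bar> \<partial>lborel) \<le> C1"
      using L1_curve_norm_bound[OF L] by blast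
    define f where "f = source p M T u"
    have f: "(\<lambda>(s, x). f s x) \<in> borel_measurable (borel \<Otimes>\<^sub>M borel)" "\<And>s x. \<bar>f s x\<bar> \<le> M powr p"
      "\<And>s x. s \<le> 0 \<Longrightarrow> f s x = 0" "\<And>s. integrable lborel (f s)"
      "\<And>s. (\<integral>x. \<bar>f s x\<bar> \<partial>lborel) \<le> p * M powr (p - 1) * C1"
      unfolding f_def
      using source_measurable[OF L] source_le[OF M p] source_nonpos source_integrable[OF L p M]
        source_L1_bound[OF L p M C1] by blast+
    define U where "U s x = indicator {0<..T} s * u s x" for s x
    have Um: "(\<lambda>(s, x). U s x) \<in> borel_measurable (borel \<Otimes>\<^sub>M borel)"
      unfolding U_def by (rule L1_curve_extension_measurable[OF L]) (auto simp: greaterThanAtMost_borel)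
    have U0: "U s = (\<lambda>_. 0)" if "s \<le> 0" for s using that by (auto simp: U_def)
    have Ueq: "U s = (if 0 < s \<and> s \<le> T then u s else (\<lambda>_. 0))" for s by (auto simp: U_def)
    have Ui: "integrable lborel (U s)" for s
      using L unfolding Ueq L1_curve_def by auto
    have UC: "(\<integral>x. \<bar>U s x\<bar> \<partial>lborel) \<le> C1" for s
      using C1(1) C1(2)[of s] by (simp add: Ueq)
    have Upos: "AE x in lborel. 0 \<le> U s x" for s
      using upos by (simp add: Ueq)
    have Au: "integrable lborel (\<lambda>x. A * \<phi> x)" using \<phi>(1) by simp
    have ineq: "AE t in lborel. 0 < t \<and> t < T \<longrightarrow>
      (\<integral>x. gauss x * (A * \<phi> x) \<partial>lborel) + (\<integral>s. indicator {..t} s * k s * (\<integral>x. gauss x * f (t - s) x \<partial>lborel) \<partial>lborel)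
      \<le> (\<integral>x. gauss x * U t x \<partial>lborel)
        + CARD('n) * (\<integral>s. indicator {..t} s * k s * (\<integral>x. gauss x * U (t - s) x \<partial>lborel) \<partial>lborel)"
    proof (rule gauss_moment_inequality[OF Zf Yf Au f(1,2) _ f(4,5) T(2) Um U0 Ui UC Upos])
      fix t assume "0 < t" "t < T"
      then show "AE x in lborel. U t x = S_op Z t (\<lambda>x. A * \<phi> x) x + duhamel f t x"
        using ueq by (simp add: Ueq f_def)
    qed (use f(3) in auto)
    define G where "G s = (\<integral>x. gauss x * U s x \<partial>lborel)" for s
    have Gm[measurable]: "G \<in> borel_measurable borel"
      unfolding G_def
    proof (rule lborel.borel_measurable_lebesgue_integral)
      show "(\<lambda>(s, x). gauss x * U s x) \<in> borel_measurable (borel \<Otimes>\<^sub>M lborel)"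
        using Um by (simp add: case_prod_unfold cong: measurable_cong_sets)
    qed
    have Hm: "(\<lambda>s. \<integral>x. gauss x * f s x \<partial>lborel) \<in> borel_measurable borel"
    proof (rule lborel.borel_measurable_lebesgue_integral)
      show "(\<lambda>(s, x). gauss x * f s x) \<in> borel_measurable (borel \<Otimes>\<^sub>M lborel)"
        using f(1) by (simp add: case_prod_unfold cong: measurable_cong_sets)
    qed
    have abs_le: "\<bar>\<integral>x. gauss x * g x \<partial>lborel\<bar> \<le> D"
      if g: "integrable lborel g" "(\<integral>x. \<bar>g x\<bar> \<partial>lborel) \<le> D" for g :: "real ^ 'n \<Rightarrow> real" and D
    proof -
      have "\<bar>\<integral>x. gauss x * g x \<partial>lborel\<bar> \<le> (\<integral>x. \<bar>gauss x * g x\<bar> \<partial>lborel)"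
        using integral_norm_bound[of lborel "\<lambda>x. gauss x * g x"] by simp
      also have "\<dots> \<le> (\<integral>x. \<bar>g x\<bar> \<partial>lborel)"
        using g by (intro integral_mono integrable_abs gauss_mult_integrable)
          (auto simp: abs_mult intro!: mult_left_le_one_le)
      finally show ?thesis using g by simp
    qed
    have G0: "0 \<le> G t" for t
      unfolding G_def using Upos[of t] by (intro integral_nonneg_AE) (auto elim: eventually_mono)
    have GC: "G t \<le> C1" for t
      using abs_le[OF Ui UC, of t] by (simp add: G_def)
    have Gp: "\<bar>G t powr p\<bar> \<le> C1 powr p" for t
      using G0[of t] GC[of t] p by (auto intro!: powr_mono2)
    have H: "AE s in lborel. 0 < s \<and> s < T \<longrightarrow> N powr (1 - p) * G s powr p \<le> (\<integral>x. gauss x * f s x \<partial>lborel)"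
      using bd
    proof eventually_elim
      case (elim s)
      show ?case
      proof
        assume s: "0 < s \<and> s < T"
        then have "AE x in lborel. \<bar>u s x\<bar> \<le> M" using elim by simp
        then have "AE x in lborel. f s x = U s x powr p"
          using Upos[of s]
        proof eventually_elim
          case (elim x)
          then show ?case using s by (auto simp: Ueq f_def source_def intro!: truncated_power_eq)
        qed
        from gauss_jensen[OF p Ui Upos f(4) this]
        show "N powr (1 - p) * G s powr p \<le> (\<integral>x. gauss x * f s x \<partial>lborel)"
          by (simp add: N_def G_def)
      qed
    qed
    have "T \<le> C * (A * g0) powr (- (p - 1) / \<alpha>1)"
    proof (rule blow[OF _ T Gm G0 GC])
      show "G1 \<le> A * g0" using A g0 by (simp add: field_simps)
      show "AE t in lborel. 0 < t \<and> t < T \<longrightarrow>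
        A * g0 + N powr (1 - p) * (\<integral>s. indicator {..t} s * k s * G (t - s) powr p \<partial>lborel)
          \<le> G t + CARD('n) * (\<integral>s. indicator {..t} s * k s * G (t - s) \<partial>lborel)"
        using ineq
      proof eventually_elim
        case (elim t)
        show ?case
        proof
          assume t: "0 < t \<and> t < T"
          have "N powr (1 - p) * (\<integral>s. indicator {..t} s * k s * G (t - s) powr p \<partial>lborel)
              = (\<integral>s. N powr (1 - p) * (indicator {..t} s * k s * G (t - s) powr p) \<partial>lborel)"
            by simp
          also have "\<dots> \<le> (\<integral>s. indicator {..t} s * k s * (\<integral>x. gauss x * f (t - s) x \<partial>lborel) \<partial>lborel)"
          proof (rule integral_mono_AE)
            show "integrable lborel (\<lambda>s. N powr (1 - p) * (indicator {..t} s * k s * G (t - s) powr p))"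
              using conv_integrable[of "\<lambda>t. G t powr p", OF _ Gp] by (intro integrable_mult_right) simp
            show "integrable lborel (\<lambda>s. indicator {..t} s * k s * (\<integral>x. gauss x * f (t - s) x \<partial>lborel))"
              by (rule conv_integrable[OF Hm abs_le[OF f(4,5)]])
            have "AE s in lborel. 0 < t + - 1 * s \<and> t + - 1 * s < T \<longrightarrow>
                N powr (1 - p) * G (t + - 1 * s) powr p \<le> (\<integral>x. gauss x * f (t + - 1 * s) x \<partial>lborel)"
              by (rule AE_borel_affine[where P="\<lambda>s. 0 < s \<and> s < T \<longrightarrow>
                N powr (1 - p) * G s powr p \<le> (\<integral>x. gauss x * f s x \<partial>lborel)", OF _ _ H]) (use Hm in measurable)
            then show "AE s in lborel. N powr (1 - p) * (indicator {..t} s * k s * G (t - s) powr p)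
                \<le> indicator {..t} s * k s * (\<integral>x. gauss x * f (t - s) x \<partial>lborel)"
              using AE_lborel_singleton[of t]
            proof eventually_elim
              case (elim s)
              consider "s \<le> 0" | "t < s" | "0 < s" "s < t" using elim(2) by linarith
              then show ?case
              proof cases
                case 3
                then have "N powr (1 - p) * G (t - s) powr p \<le> (\<integral>x. gauss x * f (t - s) x \<partial>lborel)"
                  using elim(1) t by simp
                from mult_left_mono[OF this k_nonneg[of s]] 3 show ?thesis
                  by (simp add: mult.left_commute)
              qed (simp_all add: k_nonpos)
            qed
          qed
          finally show "A * g0 + N powr (1 - p) * (\<integral>s. indicator {..t} s * k s * G (t - s) powr p \<partial>lborel)
              \<le> G t + CARD('n) * (\<integral>s. indicator {..t} s * k s * G (t - s) \<partial>lborel)"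
            using elim t by (simp add: G_def g0_def mult.left_commute)
        qed
      qed
    qed
    then show "T \<le> C * g0 powr (- (p - 1) / \<alpha>1) * A powr (- (p - 1) / \<alpha>1)"
      using A0 g0 by (simp add: powr_mult mult_ac)
  qed (use C g0 in auto)
  qed (use p N in auto)
qed

end

subsection \<open>Uniqueness and the linear evolution\<close>

lemma L1_curve_subinterval:
  fixes u :: "real \<Rightarrow> real ^ 'n \<Rightarrow> real"
  assumes u: "L1_curve T u" and T': "T' \<le> T"
  shows "L1_curve T' u"
  unfolding L1_curve_def
proof (intro conjI)
  have sub: "{0..T'} \<subseteq> {0..T}" using T' by auto
  show "(\<lambda>(t, x). u t x) \<in> borel_measurable (restrict_space borel ({0..T'} \<times> UNIV))"
    using u unfolding L1_curve_def by (auto elim: measurable_restrict_mono intro: sub[THEN subsetD])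
  show "\<forall>t\<in>{0..T'}. integrable lborel (u t)"
    using u sub unfolding L1_curve_def by blast
  show "\<forall>t\<in>{0..T'}. ((\<lambda>s. LINT x|lborel. \<bar>u s x - u t x\<bar>) \<longlongrightarrow> 0) (at t within {0..T'})"
    using u sub unfolding L1_curve_def by (meson subsetD tendsto_within_subset)
qed

lemma restrict_space_borel_measurable_pair:
  fixes h :: "real \<Rightarrow> real ^ 'n \<Rightarrow> real"
  assumes "(\<lambda>(t, x). h t x) \<in> borel_measurable (borel \<Otimes>\<^sub>M borel)"
  shows "(\<lambda>(t, x). h t x) \<in> borel_measurable (restrict_space borel S)"
  using assms unfolding borel_prod by (rule measurable_restrict_space1)

lemma mild_solution_restrict:
  fixes u :: "real \<Rightarrow> real ^ 'n \<Rightarrow> real"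
  assumes u: "mild_solution Z Y p u0 T u" and T': "T' \<le> T"
  shows "mild_solution Z Y p u0 T' u"
  unfolding mild_solution_def
proof (intro conjI)
  have sub: "{0..T'} \<subseteq> {0..T}" using T' by auto
  show "(\<lambda>(t, x). u t x) \<in> borel_measurable (restrict_space borel ({0..T'} \<times> UNIV))"
    using u unfolding mild_solution_def by (auto elim: measurable_restrict_mono intro: sub[THEN subsetD])
  show "\<forall>t\<in>{0..T'}. in_L1 (u t)"
    using u sub unfolding mild_solution_def by blast
  show "\<forall>t\<in>{0..T'}. ((\<lambda>s. LINT x|lborel. \<bar>u s x - u t x\<bar>) \<longlongrightarrow> 0) (at t within {0..T'})"
    using u sub unfolding mild_solution_def by (meson subsetD tendsto_within_subset)
  obtain M where "AE t in lebesgue. t \<in> {0<..<T} \<longrightarrow> (AE x in lborel. \<bar>u t x\<bar> \<le> M)"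
    using u unfolding mild_solution_def by blast
  then have "AE t in lebesgue. t \<in> {0<..<T'} \<longrightarrow> (AE x in lborel. \<bar>u t x\<bar> \<le> M)"
    by eventually_elim (use T' in auto)
  then show "\<exists>M. AE t in lebesgue. t \<in> {0<..<T'} \<longrightarrow> (AE x in lborel. \<bar>u t x\<bar> \<le> M)" by blast
  show "\<forall>t\<in>{0..T'}. in_L1 (mild_rhs Z Y p u0 u t) \<and> (AE x in lborel. u t x = mild_rhs Z Y p u0 u t x)"
    using u sub unfolding mild_solution_def by blast
  have "AE t in lebesgue. t \<in> {0<..<T} \<longrightarrow> in_Linf (mild_rhs Z Y p u0 u t) \<and>
        (AE x in lborel. u t x = mild_rhs Z Y p u0 u t x)"
    using u unfolding mild_solution_def by blast
  then show "AE t in lebesgue. t \<in> {0<..<T'} \<longrightarrow> in_Linf (mild_rhs Z Y p u0 u t) \<and>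
        (AE x in lborel. u t x = mild_rhs Z Y p u0 u t x)"
    by eventually_elim (use T' in auto)
qed

context spacetime_kernel begin

text \<open>A Gronwall argument in the weighted norm \<open>sup (exp (- l * t) * w t)\<close>, where \<open>l\<close> is so large
  that \<open>L * \<Psi> l \<le> 1 / 2\<close>: each pass through the equation halves the bound.\<close>

lemma mild_solution_unique:
  fixes u v :: "real \<Rightarrow> real ^ 'n \<Rightarrow> real"
  assumes u: "mild_solution Z Y p u0 T u" and v: "mild_solution Z Y p u0 T v"
    and T: "0 < T" "T \<le> 1" and p: "1 < p" and t: "t \<in> {0..T}"
  shows "AE x in lborel. u t x = v t x"
proof -
  note Lu = mild_solution_L1_curve[OF u] and Lv = mild_solution_L1_curve[OF v]
  obtain Mu where Mu: "\<And>M. Mu \<le> M \<Longrightarrow> 0 < M \<Longrightarrow>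
      (AE s in lborel. 0 < s \<and> s < T \<longrightarrow> (AE x in lborel. \<bar>u s x\<bar> \<le> M)) \<and>
      (\<forall>t\<in>{0..T}. AE x in lborel. u t x = S_op Z t u0 x + duhamel (source p M T u) t x)"
    using mild_solution_duhamel[OF u T p] by blast
  obtain Mv where Mv: "\<And>M. Mv \<le> M \<Longrightarrow> 0 < M \<Longrightarrow>
      (AE s in lborel. 0 < s \<and> s < T \<longrightarrow> (AE x in lborel. \<bar>v s x\<bar> \<le> M)) \<and>
      (\<forall>t\<in>{0..T}. AE x in lborel. v t x = S_op Z t u0 x + duhamel (source p M T v) t x)"
    using mild_solution_duhamel[OF v T p] by blast
  \<comment> \<open>One truncation level above both essential bounds, so that both solutions have
    the same Lipschitz nonlinearity.\<close>
  define M where "M = Max {Mu, Mv, 1}"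
  have M: "Mu \<le> M" "Mv \<le> M" "0 < M" by (auto simp: M_def less_max_iff_disj)
  define L where "L = p * M powr (p - 1)"
  have L: "0 < L" using p M by (simp add: L_def)
  define f where "f s x = source p M T u s x - source p M T v s x" for s x
  have fm: "(\<lambda>(s, x). f s x) \<in> borel_measurable (borel \<Otimes>\<^sub>M borel)"
    using source_measurable[OF Lu, of p M] source_measurable[OF Lv, of p M]
    unfolding f_def by (simp add: case_prod_unfold)
  have fB: "\<bar>f s x\<bar> \<le> 2 * M powr p" for s x
    using source_le[OF M(3) p, of T u s x] source_le[OF M(3) p, of T v s x] unfolding f_def by linarith
  have f0: "f s x = 0" if "s \<le> 0" for s x using that by (simp add: f_def source_nonpos)
  have fi: "integrable lborel (f s)" for s
    unfolding f_def by (intro Bochner_Integration.integrable_diff source_integrable Lu Lv p M)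
  have iu: "integrable lborel (u s)" and iv: "integrable lborel (v s)" if "s \<in> {0..T}" for s
    using Lu Lv that unfolding L1_curve_def by auto
  \<comment> \<open>The distance of the solutions, set to 0 outside (0, T] so that it is a Borel
    function on the line and can be convolved with k.\<close>
  define w where "w s = (\<integral>x. \<bar>indicator {0<..T} s * u s x - indicator {0<..T} s * v s x\<bar> \<partial>lborel)" for s
  have wm[measurable]: "w \<in> borel_measurable borel"
    unfolding w_def
  proof (rule lborel.borel_measurable_lebesgue_integral)
    have s: "{0<..T} \<in> sets borel" "{0<..T} \<subseteq> {0..T}" by (auto simp: greaterThanAtMost_borel)
    show "(\<lambda>(s, x). \<bar>indicator {0<..T} s * u s x - indicator {0<..T} s * v s x\<bar>) \<in> borel_measurable (borel \<Otimes>\<^sub>M lborel)"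
      using L1_curve_extension_measurable[OF Lu s] L1_curve_extension_measurable[OF Lv s]
      by (simp add: case_prod_unfold cong: measurable_cong_sets)
  qed
  have w_eq: "w s = (if 0 < s \<and> s \<le> T then \<integral>x. \<bar>u s x - v s x\<bar> \<partial>lborel else 0)" for s
    by (simp add: w_def indicator_def)
  have w0: "0 \<le> w s" for s by (simp add: w_def)
  have fw: "(\<integral>x. \<bar>f s x\<bar> \<partial>lborel) \<le> L * w s" for s
  proof (cases "0 < s \<and> s \<le> T")
    case True
    then have s: "s \<in> {0..T}" by simp
    have "(\<integral>x. \<bar>f s x\<bar> \<partial>lborel) \<le> (\<integral>x. L * \<bar>u s x - v s x\<bar> \<partial>lborel)"
      using source_diff_le[OF p M(3) s, where u=u and v=v] unfolding L_def[symmetric] f_def[symmetric]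
      by (intro integral_mono integrable_abs integrable_mult_right Bochner_Integration.integrable_diff fi iu iv s)
    then show ?thesis using True by (simp add: w_eq)
  next
    case False
    then have "f s = (\<lambda>_. 0)" by (auto simp: f_def source_def)
    then show ?thesis using w0[of s] L by simp
  qed
  have step: "(\<integral>x. \<bar>u t x - v t x\<bar> \<partial>lborel) \<le> (\<integral>s. indicator {..t} s * k s * (L * w (t - s)) \<partial>lborel)"
    "integrable lborel (\<lambda>s. indicator {..t} s * k s * (L * w (t - s)))"
    if t: "t \<in> {0..T}" and wC: "\<And>s. w s \<le> C" for t C
  proof -
    have t1: "t \<le> 1" using t T by simp
    have Nm: "(\<lambda>s. L * w s) \<in> borel_measurable borel" by simp
    have NC: "0 \<le> L * w s" "L * w s \<le> L * C" for s using L w0 wC by (auto intro: mult_left_mono)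
    note D = duhamel_L1_real[OF fm fB t1 f0 fi Nm fw NC]
    have "AE x in lborel. u t x - v t x = duhamel f t x"
    proof -
      have "AE x in lborel. u t x = S_op Z t u0 x + duhamel (source p M T u) t x"
        "AE x in lborel. v t x = S_op Z t u0 x + duhamel (source p M T v) t x"
        using Mu[OF M(1,3)] Mv[OF M(2,3)] t by auto
      then show ?thesis
      proof eventually_elim
        case (elim x)
        have "duhamel (source p M T u) t x - duhamel (source p M T v) t x = duhamel f t x"
          unfolding f_def
          by (rule duhamel_diff[OF source_measurable[OF Lu] source_le[OF M(3) p] source_measurable[OF Lv] source_le[OF M(3) p]])
        then show ?case using elim by simp
      qed
    qed
    then have "(\<integral>x. \<bar>u t x - v t x\<bar> \<partial>lborel) = (\<integral>x. \<bar>duhamel f t x\<bar> \<partial>lborel)"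
      using borel_measurable_integrable[OF iu[OF t]] borel_measurable_integrable[OF iv[OF t]] duhamel_measurable_at[OF fm, of t]
      by (intro integral_cong_AE) (auto elim!: eventually_mono)
    then show "(\<integral>x. \<bar>u t x - v t x\<bar> \<partial>lborel) \<le> (\<integral>s. indicator {..t} s * k s * (L * w (t - s)) \<partial>lborel)"
      using D(2) by simp
    show "integrable lborel (\<lambda>s. indicator {..t} s * k s * (L * w (t - s)))"
      using D(3) by simp
  qed
  obtain Cu where Cu: "0 \<le> Cu" "\<And>t. t \<in> {0..T} \<Longrightarrow> (\<integral>x. \<bar>u t x\<bar> \<partial>lborel) \<le> Cu"
    using L1_curve_norm_bound[OF Lu] by blast
  obtain Cv where Cv: "0 \<le> Cv" "\<And>t. t \<in> {0..T} \<Longrightarrow> (\<integral>x. \<bar>v t x\<bar> \<partial>lborel) \<le> Cv"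
    using L1_curve_norm_bound[OF Lv] by blast
  have wC: "w s \<le> Cu + Cv" for s
  proof (cases "0 < s \<and> s \<le> T")
    case True
    then have s: "s \<in> {0..T}" by simp
    have "(\<integral>x. \<bar>u s x - v s x\<bar> \<partial>lborel) \<le> (\<integral>x. \<bar>u s x\<bar> + \<bar>v s x\<bar> \<partial>lborel)"
      using iu[OF s] iv[OF s] by (intro integral_mono) auto
    also have "\<dots> \<le> Cu + Cv" using iu[OF s] iv[OF s] Cu(2)[OF s] Cv(2)[OF s] by simp
    finally show ?thesis using True by (simp add: w_eq)
  qed (use Cu Cv in \<open>auto simp: w_eq\<close>)
  have "\<forall>\<^sub>F l in at_top. Psi \<alpha>1 \<alpha>2 c l < 1 / (2 * L)"
    using order_tendstoD(2)[OF Psi_tendsto_0, of "1 / (2 * L)"] L by simp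
  then have "\<forall>\<^sub>F l in at_top. Psi \<alpha>1 \<alpha>2 c l < 1 / (2 * L) \<and> 0 < (l :: real)"
    using eventually_gt_at_top by (rule eventually_conj)
  then obtain l :: real where l: "Psi \<alpha>1 \<alpha>2 c l < 1 / (2 * L)" "0 < l"
    by (metis (mono_tags, lifting) eventually_at_top_linorder order_refl)
  have halve: "(\<integral>x. \<bar>u t x - v t x\<bar> \<partial>lborel) \<le> B / 2 * exp (l * t)"
    if B: "\<And>s. w s \<le> B * exp (l * s)" and t: "t \<in> {0..T}" for B t
  proof -
    have B0: "0 \<le> B" using B[of 0] w0[of 0] by simp
    have "(\<integral>x. \<bar>u t x - v t x\<bar> \<partial>lborel) \<le> (\<integral>s. indicator {..t} s * k s * (L * w (t - s)) \<partial>lborel)"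
      by (rule step(1)[OF t wC])
    also have "\<dots> \<le> (\<integral>s. (L * B * exp (l * t)) * (exp (- (l * s)) * k s) \<partial>lborel)"
    proof (rule integral_mono[OF step(2)[OF t wC]])
      show "integrable lborel (\<lambda>s. (L * B * exp (l * t)) * (exp (- (l * s)) * k s))"
        by (rule integrable_mult_right[OF k_laplace_integrable[OF l(2)]])
      fix s
      have "L * w (t - s) \<le> L * (B * exp (l * (t - s)))" using B[of "t - s"] L by simp
      also have "\<dots> = (L * B * exp (l * t)) * exp (- (l * s))"
        by (simp add: algebra_simps flip: exp_add)
      finally have le: "L * w (t - s) \<le> (L * B * exp (l * t)) * exp (- (l * s))" .
      have "indicator {..t} s * k s * (L * w (t - s)) \<le> k s * (L * w (t - s))"
        using k_nonneg[of s] L w0[of "t - s"] by (simp add: indicator_def)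
      also have "\<dots> \<le> k s * ((L * B * exp (l * t)) * exp (- (l * s)))"
        by (rule mult_left_mono[OF le k_nonneg])
      finally show "indicator {..t} s * k s * (L * w (t - s)) \<le> (L * B * exp (l * t)) * (exp (- (l * s)) * k s)"
        by (simp only: mult_ac)
    qed
    also have "\<dots> = (L * B * exp (l * t)) * Psi \<alpha>1 \<alpha>2 c l"
      by (simp only: integral_mult_right_zero k_laplace[OF l(2)])
    also have "\<dots> \<le> (L * B * exp (l * t)) * (1 / (2 * L))"
      using l L B0 by (intro mult_left_mono) auto
    also have "\<dots> = B / 2 * exp (l * t)" using L by simp
    finally show ?thesis .
  qed
  have bound: "w s \<le> (Cu + Cv) / 2 ^ n * exp (l * s)" for n s
  proof (induction n arbitrary: s)
    case 0
    show ?case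
    proof (cases "0 < s")
      case True
      then have "1 \<le> exp (l * s)" using l by simp
      then have "(Cu + Cv) * 1 \<le> (Cu + Cv) * exp (l * s)" using Cu Cv by (intro mult_left_mono) auto
      then show ?thesis using wC[of s] by simp
    qed (use Cu Cv in \<open>simp add: w_eq\<close>)
  next
    case (Suc n)
    show ?case
    proof (cases "0 < s \<and> s \<le> T")
      case True
      then show ?thesis using halve[OF Suc, of s] by (simp add: w_eq mult.commute)
    next
      case False
      then have "w s = 0" unfolding w_eq by (rule if_not_P)
      then show ?thesis using Cu Cv by simp
    qed
  qed
  have "(\<integral>x. \<bar>u t x - v t x\<bar> \<partial>lborel) \<le> 0"
  proof (rule LIMSEQ_le_const)
    have "(\<lambda>n. (Cu + Cv) * exp (l * t) / 2 * (1 / 2) ^ n) \<longlonglongrightarrow> (Cu + Cv) * exp (l * t) / 2 * 0"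
      by (intro tendsto_intros LIMSEQ_realpow_zero) auto
    then show "(\<lambda>n. (Cu + Cv) * exp (l * t) / 2 * (1 / 2) ^ n) \<longlonglongrightarrow> 0" by simp
    show "\<exists>N. \<forall>n\<ge>N. (\<integral>x. \<bar>u t x - v t x\<bar> \<partial>lborel) \<le> (Cu + Cv) * exp (l * t) / 2 * (1 / 2) ^ n"
    proof (intro exI allI impI)
      fix n :: nat
      show "(\<integral>x. \<bar>u t x - v t x\<bar> \<partial>lborel) \<le> (Cu + Cv) * exp (l * t) / 2 * (1 / 2) ^ n"
        using halve[OF bound t, of n] by (simp add: power_one_over field_simps)
    qed
  qed
  then have "(\<integral>x. \<bar>u t x - v t x\<bar> \<partial>lborel) = 0" by (simp add: antisym)
  then have "AE x in lborel. \<bar>u t x - v t x\<bar> = 0"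
    using iu[OF t] iv[OF t] by (subst (asm) integral_nonneg_eq_0_iff_AE) auto
  then show ?thesis by eventually_elim simp
qed

text \<open>One closure property for three uses: clipping the difference of u and its Duhamel term,
  adding a Duhamel term in the Picard iteration, and multiplying a curve by a constant.
  \<open>F 0 0 = 0\<close> turns the Lipschitz bound into integrability.\<close>

lemma L1_curve_lipschitz:
  fixes u h :: "real \<Rightarrow> real ^ 'n \<Rightarrow> real"
  assumes u: "L1_curve T u" and adm: "admissible T f" and T: "T \<le> 1"
    and h: "\<And>t x. h t x = F (u t x) (duhamel f t x)"
    and F: "(\<lambda>(a, b). F a b) \<in> borel_measurable borel" "0 \<le> A"
      "\<And>a b a' b'. \<bar>F a b - F a' b'\<bar> \<le> A * (\<bar>a - a'\<bar> + \<bar>b - b'\<bar>)" "F 0 0 = 0"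
  shows "L1_curve T h"
  unfolding L1_curve_def
proof (intro conjI ballI)
  have fm: "(\<lambda>(s, x). f s x) \<in> borel_measurable (borel \<Otimes>\<^sub>M borel)"
    using adm unfolding admissible_def by blast
  have "(\<lambda>p. (case p of (t, x) \<Rightarrow> u t x, case p of (t, x) \<Rightarrow> duhamel f t x))
      \<in> restrict_space borel ({0..T} \<times> UNIV) \<rightarrow>\<^sub>M borel \<Otimes>\<^sub>M borel"
    using u restrict_space_borel_measurable_pair[OF duhamel_measurable[OF fm]]
    unfolding L1_curve_def by (intro measurable_Pair) auto
  from measurable_compose[OF this, of "\<lambda>(a, b). F a b" borel] F(1)
  show "(\<lambda>(t, x). h t x) \<in> borel_measurable (restrict_space borel ({0..T} \<times> UNIV))"
    unfolding h borel_prod by (simp add: case_prod_unfold)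
  have ui: "integrable lborel (u t)" and di: "integrable lborel (duhamel f t)" if "t \<in> {0..T}" for t
    using u that T admissible_duhamel_integrable[OF adm] unfolding L1_curve_def by auto
  have hm: "h t \<in> borel_measurable borel" if t: "t \<in> {0..T}" for t
  proof -
    have "(\<lambda>x. (u t x, duhamel f t x)) \<in> borel \<rightarrow>\<^sub>M borel \<Otimes>\<^sub>M borel"
      using borel_measurable_integrable[OF ui[OF t]] borel_measurable_integrable[OF di[OF t]] by auto
    from measurable_compose[OF this, of "\<lambda>(a, b). F a b" borel] F(1)
    show ?thesis unfolding h[abs_def] borel_prod by simp
  qed
  show hi: "integrable lborel (h t)" if t: "t \<in> {0..T}" for t
  proof (rule Bochner_Integration.integrable_bound)
    show "integrable lborel (\<lambda>x. A * (\<bar>u t x\<bar> + \<bar>duhamel f t x\<bar>))"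
      using ui[OF t] di[OF t] by (intro integrable_mult_right Bochner_Integration.integrable_add integrable_abs)
    show "AE x in lborel. norm (h t x) \<le> norm (A * (\<bar>u t x\<bar> + \<bar>duhamel f t x\<bar>))"
      using F(3)[of "u t x" "duhamel f t x" 0 0 for x] F(2,4) by (auto simp: h abs_mult)
  qed (use hm t in simp)
  fix t assume t: "t \<in> {0..T}"
  have lim: "((\<lambda>s. A * ((LINT x|lborel. \<bar>u s x - u t x\<bar>) + (\<integral>x. \<bar>duhamel f s x - duhamel f t x\<bar> \<partial>lborel))) \<longlongrightarrow> A * (0 + 0)) (at t within {0..T})"
    using u t duhamel_continuous_L1[OF adm T t] unfolding L1_curve_def by (intro tendsto_intros) auto
  then have lim: "((\<lambda>s. A * ((LINT x|lborel. \<bar>u s x - u t x\<bar>) + (\<integral>x. \<bar>duhamel f s x - duhamel f t x\<bar> \<partial>lborel))) \<longlongrightarrow> 0) (at t within {0..T})"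
    by simp
  show "((\<lambda>s. LINT x|lborel. \<bar>h s x - h t x\<bar>) \<longlongrightarrow> 0) (at t within {0..T})"
  proof (rule Lim_null_comparison[OF eventually_at_withinI lim])
    fix s assume s: "s \<in> {0..T}"
    have "(LINT x|lborel. \<bar>h s x - h t x\<bar>)
        \<le> (\<integral>x. A * (\<bar>u s x - u t x\<bar> + \<bar>duhamel f s x - duhamel f t x\<bar>) \<partial>lborel)"
    proof (intro integral_mono integrable_abs integrable_mult_right Bochner_Integration.integrable_add
        Bochner_Integration.integrable_diff ui di hi s t)
      show "\<bar>h s x - h t x\<bar> \<le> A * (\<bar>u s x - u t x\<bar> + \<bar>duhamel f s x - duhamel f t x\<bar>)" for x
        unfolding h by (rule F(3))
    qed
    also have "\<dots> = A * ((LINT x|lborel. \<bar>u s x - u t x\<bar>) + (\<integral>x. \<bar>duhamel f s x - duhamel f t x\<bar> \<partial>lborel))"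
      using ui[OF s] ui[OF t] di[OF s] di[OF t] by simp
    finally show "norm (LINT x|lborel. \<bar>h s x - h t x\<bar>)
        \<le> A * ((LINT x|lborel. \<bar>u s x - u t x\<bar>) + (\<integral>x. \<bar>duhamel f s x - duhamel f t x\<bar> \<partial>lborel))"
      by simp
  qed
qed

text \<open>A jointly measurable, \<open>L\<^sup>1\<close>-continuous version of \<open>t \<mapsto> S_op Z t \<phi>\<close> is read off from an
  existing mild solution \<open>u\<close> with datum \<open>\<phi>\<close>, as \<open>u\<close> minus its Duhamel term. This avoids proving
  that \<open>Z t\<close> tends to the Dirac measure as \<open>t \<rightarrow> 0\<close>.\<close>

lemma linear_evolution_version:
  fixes \<phi> :: "real ^ 'n \<Rightarrow> real"
  assumes Zf: "Z_family \<alpha>1 \<alpha>2 c Z" and u: "mild_solution Z Y p \<phi> \<tau> u" and \<tau>: "0 < \<tau>" "\<tau> \<le> 1" and p: "1 < p"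
    and \<phi>: "integrable lborel \<phi>" "AE x in lborel. 0 \<le> \<phi> x \<and> \<phi> x \<le> m" and m: "0 \<le> m"
  obtains g where "L1_curve \<tau> g" "\<And>t x. 0 \<le> g t x" "\<And>t x. g t x \<le> m"
    "\<And>t. t \<in> {0..\<tau>} \<Longrightarrow> AE x in lborel. g t x = S_op Z t \<phi> x"
proof -
  note L = mild_solution_L1_curve[OF u]
  obtain M0 where M0: "\<And>M. M0 \<le> M \<Longrightarrow> 0 < M \<Longrightarrow>
      (AE s in lborel. 0 < s \<and> s < \<tau> \<longrightarrow> (AE x in lborel. \<bar>u s x\<bar> \<le> M)) \<and>
      (\<forall>t\<in>{0..\<tau>}. AE x in lborel. u t x = S_op Z t \<phi> x + duhamel (source p M \<tau> u) t x)"
    using mild_solution_duhamel[OF u \<tau> p] by blast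
  define M where "M = max M0 1"
  have M: "M0 \<le> M" "0 < M" by (auto simp: M_def)
  \<comment> \<open>Clipping to [0, m] makes the bounds hold at every point. It alters nothing
    almost everywhere, since \<open>S_op Z t \<phi>\<close> is \<phi> itself or an average of its
    translates under a probability measure.\<close>
  define clip where "clip a b = max 0 (min m (a - b))" for a b :: real
  define g where "g t x = clip (u t x) (duhamel (source p M \<tau> u) t x)" for t x
  show thesis
  proof (rule that[of g])
    show "L1_curve \<tau> g"
    proof (rule L1_curve_lipschitz[OF L source_admissible[OF L p M(2)] \<tau>(2), where F=clip and A=1])
      have "(\<lambda>p. clip (fst p) (snd p)) \<in> borel_measurable (borel \<Otimes>\<^sub>M borel)" unfolding clip_def by measurable
      then show "(\<lambda>(a, b). clip a b) \<in> borel_measurable borel" by (simp add: borel_prod case_prod_unfold)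
      show "\<bar>clip a b - clip a' b'\<bar> \<le> 1 * (\<bar>a - a'\<bar> + \<bar>b - b'\<bar>)" for a b a' b'
        using m unfolding clip_def by (auto simp: max_def min_def abs_if)
    qed (use m in \<open>auto simp: g_def clip_def\<close>)
    show "0 \<le> g t x" "g t x \<le> m" for t x using m by (auto simp: g_def clip_def)
    fix t assume t: "t \<in> {0..\<tau>}"
    have "AE x in lborel. 0 \<le> S_op Z t \<phi> x \<and> S_op Z t \<phi> x \<le> m"
    proof (cases "t = 0")
      case True then show ?thesis using \<phi>(2) by (simp add: S_op_def)
    next
      case False
      then have Zt: "prob_space (Z t)" "sets (Z t) = sets borel" using Zf t unfolding Z_family_def by auto
      interpret Z: prob_space "Z t" by (rule Zt)
      have "S_op Z t \<phi> = conv_measure (Z t) \<phi>" using False by (simp add: S_op_def fun_eq_iff)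
      then show ?thesis
        using conv_measure_AE_bounds[OF Z.finite_measure_axioms Zt(2) \<phi> m] by simp
    qed
    moreover have "AE x in lborel. u t x = S_op Z t \<phi> x + duhamel (source p M \<tau> u) t x"
      using M0[OF M] t by blast
    ultimately show "AE x in lborel. g t x = S_op Z t \<phi> x"
      by eventually_elim (auto simp: g_def clip_def)
  qed
qed

end

subsection \<open>Monotone Picard iteration\<close>

lemma isCont_truncated_power:
  assumes "1 < p" "0 < M" "X \<longlonglongrightarrow> x"
  shows "(\<lambda>n. truncated_power p M (X n)) \<longlonglongrightarrow> truncated_power p M x"
proof -
  have "(\<lambda>n. p * M powr (p - 1) * \<bar>X n - x\<bar>) \<longlonglongrightarrow> p * M powr (p - 1) * \<bar>x - x\<bar>"
    by (intro tendsto_intros assms)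
  then have "(\<lambda>n. p * M powr (p - 1) * \<bar>X n - x\<bar>) \<longlonglongrightarrow> 0" by simp
  then have "(\<lambda>n. truncated_power p M (X n) - truncated_power p M x) \<longlonglongrightarrow> 0"
    by (rule Lim_null_comparison[rotated])
      (use truncated_power_lipschitz[OF assms(1,2)] in auto)
  then show ?thesis by (simp add: LIM_zero_iff)
qed

text \<open>R is twice the bound on the linear part a. The condition \<open>small\<close> has two
  effects: the Duhamel term of an iterate stays below R / 2, and the iteration contracts in L1 by
  the factor 1/2, because p R^(p-1) is a Lipschitz constant of the power cut at R.\<close>

locale picard_iteration = spacetime_kernel \<alpha>1 \<alpha>2 c k Y \<kappa>
  for \<alpha>1 \<alpha>2 c :: real and k :: "real \<Rightarrow> real" and Y \<kappa> :: "real \<Rightarrow> (real ^ 'n) measure" +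
  fixes p R T :: real and a :: "real \<Rightarrow> real ^ 'n \<Rightarrow> real"
  assumes p: "1 < p" and R: "0 < R" and T: "0 < T" "T \<le> 1"
    and small: "2 * (p * R powr (p - 1)) * K T \<le> 1"
    and a: "L1_curve T a" "\<And>t x. 0 \<le> a t x" "\<And>t x. a t x \<le> R / 2"
begin

definition L :: real where "L = p * R powr (p - 1)"

fun iter :: "nat \<Rightarrow> real \<Rightarrow> real ^ 'n \<Rightarrow> real" where
  "iter 0 t x = a t x" |
  "iter (Suc n) t x = a t x + duhamel (source p R T (iter n)) t x"

lemma L_pos: "0 < L" using p R by (simp add: L_def)

lemma LK: "L * K T \<le> 1 / 2" using small by (simp add: L_def)

lemma iter_L1_curve: "L1_curve T (iter n)"
proof (induction n)
  case 0
  have "iter 0 = a" by (simp add: fun_eq_iff)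
  then show ?case using a(1) by simp
next
  case (Suc n)
  show ?case
  proof (rule L1_curve_lipschitz[OF a(1) source_admissible[OF Suc p R] T(2), where F="\<lambda>b d. b + d" and A=1])
    show "(\<lambda>(b :: real, d). b + d) \<in> borel_measurable borel"
      unfolding borel_prod[symmetric] by measurable
  qed auto
qed

lemma iter_integrable: "t \<in> {0..T} \<Longrightarrow> integrable lborel (iter n t)"
  using iter_L1_curve[of n] unfolding L1_curve_def by blast

text \<open>The first step adds a nonnegative term to the linear part, and monotonicity of the
  source preserves the order afterwards.\<close>

lemma iter_mono: "iter n t x \<le> iter (Suc n) t x"
proof (induction n arbitrary: t x)
  case 0
  have "0 \<le> duhamel (source p R T (iter 0)) t x" by (rule duhamel_nonneg) (rule source_nonneg)
  then show ?case by simp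
next
  case (Suc n)
  have "duhamel (source p R T (iter n)) t x \<le> duhamel (source p R T (iter (Suc n))) t x"
  proof (rule duhamel_mono)
    show "source p R T (iter n) s y \<le> source p R T (iter (Suc n)) s y" for s y
      using truncated_power_mono[OF _ Suc, of p R s y] p by (simp add: source_def del: iter.simps)
  qed (rule source_measurable[OF iter_L1_curve] source_le[OF R p])+
  then show ?case by (simp only: iter.simps add_left_mono)
qed

lemma iter_ge_0: "0 \<le> iter n t x"
  by (cases n) (auto intro!: add_nonneg_nonneg a duhamel_nonneg source_nonneg)

text \<open>R^p K T = R (R^(p-1) K T), and R^(p-1) K T \<le> L K T \<le> 1/2 because p > 1. So the
  contraction condition also keeps the iterates in [0, R].\<close>

lemma iter_le: "t \<in> {0..T} \<Longrightarrow> iter n t x \<le> R"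
proof (cases n)
  case 0
  then show ?thesis using a(3)[of t x] R by simp
next
  case (Suc j)
  assume t: "t \<in> {0..T}"
  have "\<bar>duhamel (source p R T (iter j)) t x\<bar> \<le> R powr p * K t"
    by (rule duhamel_bound[OF source_measurable[OF iter_L1_curve] source_le[OF R p]])
      (use t T in \<open>auto simp: source_nonpos\<close>)
  also have "\<dots> \<le> R powr p * K T" using t by (intro mult_left_mono K_mono) auto
  also have "\<dots> = R * (R powr (p - 1) * K T)" using R by (simp add: powr_diff)
  also have "\<dots> \<le> R * (1 / 2)"
  proof (rule mult_left_mono)
    have "1 * (R powr (p - 1) * K T) \<le> p * (R powr (p - 1) * K T)"
      using p K_nonneg by (intro mult_right_mono) auto
    then show "R powr (p - 1) * K T \<le> 1 / 2" using LK by (simp add: L_def)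
  qed (use R in simp)
  finally show ?thesis using a(3)[of t x] Suc by simp
qed

lemma iter_cauchy:
  obtains C where "0 \<le> C" "\<And>n t. t \<in> {0..T} \<Longrightarrow> (\<integral>x. \<bar>iter (Suc n) t x - iter n t x\<bar> \<partial>lborel) \<le> C / 2 ^ n"
proof -
  obtain C where C: "0 \<le> C" "\<And>t. t \<in> {0..T} \<Longrightarrow> (\<integral>x. \<bar>a t x\<bar> \<partial>lborel) \<le> C"
    using L1_curve_norm_bound[OF a(1)] by blast
  \<comment> \<open>A source with L1 norm at most L D has a Duhamel term of L1 norm at most K t L D,
    and K t L \<le> K T L \<le> 1/2.\<close>
  have duh: "(\<integral>x. \<bar>duhamel f t x\<bar> \<partial>lborel) \<le> D / 2"
    if t: "t \<in> {0..T}" and D: "0 \<le> D"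
      and f: "(\<lambda>(s, x). f s x) \<in> borel_measurable (borel \<Otimes>\<^sub>M borel)" "\<And>s x. \<bar>f s x\<bar> \<le> B"
        "\<And>s x. s \<le> 0 \<Longrightarrow> f s x = 0" "\<And>s. integrable lborel (f s)" "\<And>s. (\<integral>x. \<bar>f s x\<bar> \<partial>lborel) \<le> L * D"
    for t D f B
  proof -
    have t1: "t \<le> 1" using t T by simp
    have "(\<integral>x. \<bar>duhamel f t x\<bar> \<partial>lborel) \<le> (\<integral>s. indicator {..t} s * k s * (L * D) \<partial>lborel)"
      by (rule duhamel_L1_real(2)[OF f(1,2) t1 f(3,4), where N="\<lambda>_. L * D" and C="L * D"])
        (use f(5) D L_pos in auto)
    also have "\<dots> = K t * (L * D)" by (simp add: K_def)
    also have "\<dots> \<le> K T * (L * D)" using t D L_pos by (intro mult_right_mono K_mono) auto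
    also have "\<dots> = L * K T * D" by simp
    also have "\<dots> \<le> 1 / 2 * D" using LK D by (rule mult_right_mono)
    finally show ?thesis by simp
  qed
  have "(\<integral>x. \<bar>iter (Suc n) t x - iter n t x\<bar> \<partial>lborel) \<le> C / 2 ^ n" if "t \<in> {0..T}" for n t
    using that
  proof (induction n arbitrary: t)
    case 0
    have e: "iter 0 = a" by (simp add: fun_eq_iff)
    have "(\<integral>x. \<bar>duhamel (source p R T a) t x\<bar> \<partial>lborel) \<le> C / 2"
      by (rule duh[OF 0 C(1) source_measurable[OF a(1)] source_le[OF R p]])
        (use source_L1_bound[OF a(1) p R C] source_integrable[OF a(1) p R] in \<open>auto simp: source_nonpos L_def\<close>)
    then show ?case using C(1) by (simp add: e)
  next
    case (Suc n)
    let ?F = "\<lambda>n. source p R T (iter n)"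
    have eq: "iter (Suc (Suc n)) t x - iter (Suc n) t x = duhamel (\<lambda>s x. ?F (Suc n) s x - ?F n s x) t x" for x
    proof -
      have "duhamel (?F (Suc n)) t x - duhamel (?F n) t x = duhamel (\<lambda>s x. ?F (Suc n) s x - ?F n s x) t x"
        by (rule duhamel_diff[OF source_measurable[OF iter_L1_curve] source_le[OF R p]
          source_measurable[OF iter_L1_curve] source_le[OF R p]])
      then show ?thesis by (simp only: iter.simps add_diff_cancel_left)
    qed
    have "(\<integral>x. \<bar>duhamel (\<lambda>s x. ?F (Suc n) s x - ?F n s x) t x\<bar> \<partial>lborel) \<le> (C / 2 ^ n) / 2"
    proof (rule duh[where B="2 * R powr p"])
      show "(\<lambda>(s, x). ?F (Suc n) s x - ?F n s x) \<in> borel_measurable (borel \<Otimes>\<^sub>M borel)"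
        using source_measurable[OF iter_L1_curve[of "Suc n"]] source_measurable[OF iter_L1_curve[of n]]
        by (simp add: case_prod_unfold del: iter.simps)
      show "\<bar>?F (Suc n) s x - ?F n s x\<bar> \<le> 2 * R powr p" for s x
        using source_le[OF R p, of T "iter (Suc n)" s x] source_le[OF R p, of T "iter n" s x] by linarith
      show int: "integrable lborel (\<lambda>x. ?F (Suc n) s x - ?F n s x)" for s
        by (intro Bochner_Integration.integrable_diff source_integrable iter_L1_curve p R)
      show "(\<integral>x. \<bar>?F (Suc n) s x - ?F n s x\<bar> \<partial>lborel) \<le> L * (C / 2 ^ n)" for s
      proof (cases "0 < s \<and> s \<le> T")
        case True
        then have s: "s \<in> {0..T}" by simp
        have "(\<integral>x. \<bar>?F (Suc n) s x - ?F n s x\<bar> \<partial>lborel) \<le> (\<integral>x. L * \<bar>iter (Suc n) s x - iter n s x\<bar> \<partial>lborel)"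
          using source_diff_le[OF p R s] unfolding L_def
          by (intro integral_mono integrable_abs integrable_mult_right Bochner_Integration.integrable_diff
              source_integrable iter_L1_curve iter_integrable p R s)
        also have "\<dots> = L * (\<integral>x. \<bar>iter (Suc n) s x - iter n s x\<bar> \<partial>lborel)" by (rule integral_mult_right_zero)
        also have "\<dots> \<le> L * (C / 2 ^ n)"
          by (rule mult_left_mono[OF Suc.IH[OF s]]) (use L_pos in simp)
        finally show ?thesis .
      next
        case False
        then have "(\<lambda>x. \<bar>?F (Suc n) s x - ?F n s x\<bar>) = (\<lambda>_. 0)" by (auto simp: source_def)
        then show ?thesis using C(1) L_pos by simp
      qed
    qed (use Suc.prems C(1) in \<open>simp_all add: source_nonpos\<close>)
    then show ?case unfolding eq by simp
  qed
  then show thesis using that C(1) by blast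
qed

text \<open>By monotonicity the limit exists at every point of [0, T], so the fixed-point equation
  holds everywhere there and not just almost everywhere.\<close>

definition sol :: "real \<Rightarrow> real ^ 'n \<Rightarrow> real" where
  "sol t x = lim (\<lambda>n. iter n t x)"

lemma iter_tendsto: "t \<in> {0..T} \<Longrightarrow> (\<lambda>n. iter n t x) \<longlonglongrightarrow> sol t x"
proof -
  assume t: "t \<in> {0..T}"
  have "incseq (\<lambda>n. iter n t x)" by (rule incseq_SucI) (rule iter_mono)
  moreover have "bdd_above (range (\<lambda>n. iter n t x))" using iter_le[OF t] by (auto intro!: bdd_aboveI)
  ultimately have "convergent (\<lambda>n. iter n t x)" by (auto intro: LIMSEQ_incseq_SUP convergentI)
  then show ?thesis unfolding sol_def by (simp add: convergent_LIMSEQ_iff)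
qed

lemma sol_bounds: "t \<in> {0..T} \<Longrightarrow> 0 \<le> sol t x \<and> sol t x \<le> R"
  using LIMSEQ_le_const[OF iter_tendsto] LIMSEQ_le_const2[OF iter_tendsto] iter_ge_0 iter_le by blast

lemma sol_approx:
  obtains C where "0 \<le> C" "\<And>n t. t \<in> {0..T} \<Longrightarrow> integrable lborel (sol t)"
    "\<And>n t. t \<in> {0..T} \<Longrightarrow> (\<integral>x. \<bar>sol t x - iter n t x\<bar> \<partial>lborel) \<le> C / 2 ^ n"
proof -
  obtain C where C: "0 \<le> C" "\<And>n t. t \<in> {0..T} \<Longrightarrow> (\<integral>x. \<bar>iter (Suc n) t x - iter n t x\<bar> \<partial>lborel) \<le> C / 2 ^ n"
    using iter_cauchy by blast
  \<comment> \<open>Telescoping: the sum of C / 2^i over n \<le> i < n + j equals 2 C / 2^n - 2 C /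
    2^(n + j). The iterates increase, so differences equal their absolute values.\<close>
  have I: "(\<integral>x. iter (n + j) t x - iter n t x \<partial>lborel) \<le> 2 * C / 2 ^ n - 2 * C / 2 ^ (n + j)" if t: "t \<in> {0..T}" for n j t
  proof (induction j)
    case (Suc j)
    have "(\<integral>x. iter (n + Suc j) t x - iter n t x \<partial>lborel)
        = (\<integral>x. (iter (Suc (n + j)) t x - iter (n + j) t x) + (iter (n + j) t x - iter n t x) \<partial>lborel)"
      by (simp del: iter.simps)
    also have "\<dots> = (\<integral>x. iter (Suc (n + j)) t x - iter (n + j) t x \<partial>lborel) + (\<integral>x. iter (n + j) t x - iter n t x \<partial>lborel)"
      by (intro Bochner_Integration.integral_add Bochner_Integration.integrable_diff iter_integrable t)
    also have "(\<integral>x. iter (Suc (n + j)) t x - iter (n + j) t x \<partial>lborel) \<le> C / 2 ^ (n + j)"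
    proof -
      have "\<bar>iter (Suc (n + j)) t x - iter (n + j) t x\<bar> = iter (Suc (n + j)) t x - iter (n + j) t x" for x
        using iter_mono[of "n + j" t x] by (simp del: iter.simps)
      then show ?thesis using C(2)[OF t, of "n + j"] by (simp del: iter.simps)
    qed
    finally have "(\<integral>x. iter (n + Suc j) t x - iter n t x \<partial>lborel)
        \<le> C / 2 ^ (n + j) + (\<integral>x. iter (n + j) t x - iter n t x \<partial>lborel)" by simp
    moreover have "2 * C / 2 ^ (n + Suc j) = C / 2 ^ (n + j)" by simp
    ultimately show ?case using Suc by linarith
  qed simp
  have mono: "iter n t x \<le> iter m t x" if "n \<le> m" for n m t x
    using incseq_SucI[of "\<lambda>n. iter n t x"] iter_mono that by (auto simp: incseq_def)
  have *: "integrable lborel (\<lambda>x. sol t x - iter n t x) \<and> (\<integral>x. sol t x - iter n t x \<partial>lborel) \<le> 2 * C / 2 ^ n"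
    if t: "t \<in> {0..T}" for n t
  proof -
    let ?d = "\<lambda>j x. iter (n + j) t x - iter n t x"
    have di: "integrable lborel (?d j)" for j by (intro Bochner_Integration.integrable_diff iter_integrable t)
    have dm: "incseq (\<lambda>j. \<integral>x. ?d j x \<partial>lborel)"
      by (intro incseq_SucI integral_mono di) (use iter_mono in auto)
    have dC: "(\<integral>x. ?d j x \<partial>lborel) \<le> 2 * C / 2 ^ n" for j
    proof -
      have "0 \<le> 2 * C / 2 ^ (n + j)" using C(1) by simp
      then show ?thesis using I[OF t, of n j] by linarith
    qed
    obtain y where y: "(\<lambda>j. \<integral>x. ?d j x \<partial>lborel) \<longlonglongrightarrow> y"
      using incseq_convergent[OF dm] dC by blast
    have lim: "(\<lambda>j. ?d j x) \<longlonglongrightarrow> sol t x - iter n t x" for x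
      using LIMSEQ_ignore_initial_segment[OF iter_tendsto[OF t, of x], of n]
      by (intro tendsto_diff tendsto_const) (simp add: add.commute)
    have um: "(\<lambda>x. sol t x - iter n t x) \<in> borel_measurable lborel"
      by (rule borel_measurable_LIMSEQ_real[OF lim]) (rule borel_measurable_integrable[OF di])
    have ae: "AE x in lborel. mono (\<lambda>j. ?d j x)" "AE x in lborel. (\<lambda>j. ?d j x) \<longlonglongrightarrow> sol t x - iter n t x"
      using lim mono by (auto simp: mono_def)
    have "integrable lborel (\<lambda>x. sol t x - iter n t x)" "(\<integral>x. sol t x - iter n t x \<partial>lborel) = y"
      using integrable_monotone_convergence[OF di ae y um] integral_monotone_convergence[OF di ae y um] by auto
    moreover have "y \<le> 2 * C / 2 ^ n" by (rule LIMSEQ_le_const2[OF y]) (use dC in auto)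
    ultimately show ?thesis by simp
  qed
  show thesis
  proof (rule that[of "2 * C"])
    show "0 \<le> 2 * C" using C by simp
    fix n t assume t: "t \<in> {0..T}"
    have "integrable lborel (\<lambda>x. (sol t x - iter n t x) + iter n t x)"
      using *[OF t, of n] iter_integrable[OF t] by (intro Bochner_Integration.integrable_add) auto
    then show "integrable lborel (sol t)" by simp
    have "iter n t x \<le> sol t x" for x
      by (rule LIMSEQ_le_const[OF iter_tendsto[OF t]]) (use mono in blast)
    then have "\<bar>sol t x - iter n t x\<bar> = sol t x - iter n t x" for x by simp
    then show "(\<integral>x. \<bar>sol t x - iter n t x\<bar> \<partial>lborel) \<le> 2 * C / 2 ^ n" using *[OF t, of n] by simp
  qed
qed

text \<open>The L1 rate is uniform in t, so the limit of continuous curves is continuous.\<close>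

lemma sol_L1_curve: "L1_curve T sol"
  unfolding L1_curve_def
proof (intro conjI ballI)
  obtain C where C: "0 \<le> C" "\<And>n t. t \<in> {0..T} \<Longrightarrow> integrable lborel (sol t)"
    "\<And>n t. t \<in> {0..T} \<Longrightarrow> (\<integral>x. \<bar>sol t x - iter n t x\<bar> \<partial>lborel) \<le> C / 2 ^ n"
    using sol_approx by blast
  show "(\<lambda>(t, x). sol t x) \<in> borel_measurable (restrict_space borel ({0..T} \<times> UNIV))"
  proof (rule borel_measurable_LIMSEQ_real)
    show "(\<lambda>(t, x). iter n t x) \<in> borel_measurable (restrict_space borel ({0..T} \<times> UNIV))" for n
      using iter_L1_curve[of n] unfolding L1_curve_def by blast
    fix z :: "real \<times> (real ^ 'n)" assume "z \<in> space (restrict_space borel ({0..T} \<times> UNIV))"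
    then show "(\<lambda>n. case z of (t, x) \<Rightarrow> iter n t x) \<longlonglongrightarrow> (case z of (t, x) \<Rightarrow> sol t x)"
      by (auto simp: space_restrict_space intro!: iter_tendsto)
  qed
  show si: "integrable lborel (sol t)" if "t \<in> {0..T}" for t by (rule C(2)[OF that])
  fix t assume t: "t \<in> {0..T}"
  show "((\<lambda>s. LINT x|lborel. \<bar>sol s x - sol t x\<bar>) \<longlongrightarrow> 0) (at t within {0..T})"
  proof (rule tendstoI)
    fix e :: real assume e: "0 < e"
    have "(\<lambda>n. C * (1 / 2) ^ n) \<longlonglongrightarrow> C * 0" by (intro tendsto_intros LIMSEQ_realpow_zero) auto
    then have "\<forall>\<^sub>F n in sequentially. C * (1 / 2) ^ n < e / 3" using e by (intro order_tendstoD) auto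
    then obtain n where "C * (1 / 2) ^ n < e / 3" by (auto simp: eventually_sequentially)
    then have n: "C / 2 ^ n < e / 3" by (simp add: power_one_over)
    have "((\<lambda>s. LINT x|lborel. \<bar>iter n s x - iter n t x\<bar>) \<longlongrightarrow> 0) (at t within {0..T})"
      using iter_L1_curve[of n] t unfolding L1_curve_def by blast
    then have "\<forall>\<^sub>F s in at t within {0..T}. (LINT x|lborel. \<bar>iter n s x - iter n t x\<bar>) < e / 3"
      using e by (intro order_tendstoD) auto
    moreover have "\<forall>\<^sub>F s in at t within {0..T}. s \<in> {0..T}" by (rule eventually_at_withinI)
    ultimately show "\<forall>\<^sub>F s in at t within {0..T}. dist (LINT x|lborel. \<bar>sol s x - sol t x\<bar>) 0 < e"
    proof eventually_elim
      case (elim s)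
      have ii: "integrable lborel (\<lambda>x. \<bar>sol r x - iter n r x\<bar>)" if "r \<in> {0..T}" for r
        by (intro integrable_abs Bochner_Integration.integrable_diff si iter_integrable that)
      have i2: "integrable lborel (\<lambda>x. \<bar>iter n s x - iter n t x\<bar>)"
        by (intro integrable_abs Bochner_Integration.integrable_diff iter_integrable t elim(2))
      have "(LINT x|lborel. \<bar>sol s x - sol t x\<bar>)
          \<le> (\<integral>x. \<bar>sol s x - iter n s x\<bar> + \<bar>iter n s x - iter n t x\<bar> + \<bar>sol t x - iter n t x\<bar> \<partial>lborel)"
        by (intro integral_mono integrable_abs Bochner_Integration.integrable_add ii[OF elim(2)] ii[OF t] i2
            Bochner_Integration.integrable_diff si elim(2) t) linarith
      also have "\<dots> = (\<integral>x. \<bar>sol s x - iter n s x\<bar> \<partial>lborel) + (\<integral>x. \<bar>iter n s x - iter n t x\<bar> \<partial>lborel)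
          + (\<integral>x. \<bar>sol t x - iter n t x\<bar> \<partial>lborel)"
        using ii[OF elim(2)] ii[OF t] i2 by (simp del: iter.simps)
      also have "\<dots> < e" using C(3)[OF t, of n] C(3)[OF elim(2), of n] n elim(1) by linarith
      finally show ?case by simp
    qed
  qed
qed

text \<open>The sources of the iterates are bounded by R^p and converge pointwise, so dominated
  convergence passes to the limit in the Duhamel term.\<close>

lemma sol_fixed_point: "t \<in> {0..T} \<Longrightarrow> sol t x = a t x + duhamel (source p R T sol) t x"
proof -
  assume t: "t \<in> {0..T}"
  have "(\<lambda>n. a t x + duhamel (source p R T (iter n)) t x) \<longlonglongrightarrow> a t x + duhamel (source p R T sol) t x"
  proof (intro tendsto_add tendsto_const duhamel_tendsto)
    show "(\<lambda>(s, x). source p R T (iter n) s x) \<in> borel_measurable (borel \<Otimes>\<^sub>M borel)" for n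
      by (rule source_measurable[OF iter_L1_curve])
    show "(\<lambda>(s, x). source p R T sol s x) \<in> borel_measurable (borel \<Otimes>\<^sub>M borel)"
      by (rule source_measurable[OF sol_L1_curve])
    show "\<bar>source p R T (iter n) s x\<bar> \<le> R powr p" for n s x by (rule source_le[OF R p])
    show "(\<lambda>n. source p R T (iter n) s x) \<longlonglongrightarrow> source p R T sol s x" for s x
    proof (cases "0 < s \<and> s \<le> T")
      case True
      then show ?thesis unfolding source_def using isCont_truncated_power[OF p R iter_tendsto, of s x] by simp
    next
      case False
      then have "source p R T v s x = 0" for v :: "real \<Rightarrow> real ^ 'n \<Rightarrow> real" by (auto simp: source_def)
      then show ?thesis by simp
    qed
  qed
  moreover have "(\<lambda>n. a t x + duhamel (source p R T (iter n)) t x) \<longlonglongrightarrow> sol t x"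
    using LIMSEQ_Suc[OF iter_tendsto[OF t, of x]] by simp
  ultimately show ?thesis by (rule LIMSEQ_unique[rotated])
qed

text \<open>The limit takes values in [0, R], where truncation and positive part do nothing, so it
  solves the original equation. The linear part is identified through a.\<close>

lemma sol_mild:
  assumes Zf: "Z_family \<alpha>1 \<alpha>2 c Z" and u0: "integrable lborel u0"
    and aS: "\<And>t. t \<in> {0..T} \<Longrightarrow> AE x in lborel. a t x = S_op Z t u0 x"
  shows "mild_solution Z Y p u0 T sol"
proof -
  note sm = source_measurable[OF sol_L1_curve, of p R]
  have rhs: "mild_rhs Z Y p u0 sol t = (\<lambda>x. S_op Z t u0 x + duhamel (source p R T sol) t x)" if t: "t \<in> {0..T}" for t
  proof
    fix x
    have "(LINT s:{0<..<t}|lebesgue. P_op Y (t - s) (\<lambda>y. max (sol s y) 0 powr p) x)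
        = (LINT s:{0<..<t}|lebesgue. P_op Y (t - s) (source p R T sol s) x)"
    proof (rule set_lebesgue_integral_cong)
      show "\<forall>s. s \<in> {0<..<t} \<longrightarrow> P_op Y (t - s) (\<lambda>y. max (sol s y) 0 powr p) x = P_op Y (t - s) (source p R T sol s) x"
      proof (intro allI impI)
        fix s assume "s \<in> {0<..<t}"
        then have "(\<lambda>y. max (sol s y) 0 powr p) = source p R T sol s"
          using sol_bounds[of s] t by (auto simp: fun_eq_iff source_def truncated_power_eq max_absorb1)
        then show "P_op Y (t - s) (\<lambda>y. max (sol s y) 0 powr p) x = P_op Y (t - s) (source p R T sol s) x" by simp
      qed
    qed simp
    also have "\<dots> = duhamel (source p R T sol) t x"
      by (rule duhamel_eq_P_op[OF sm source_le[OF R p] sm]) (use t T in \<open>auto simp: source_nonpos\<close>)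
    finally show "mild_rhs Z Y p u0 sol t x = S_op Z t u0 x + duhamel (source p R T sol) t x"
      by (simp add: mild_rhs_def)
  qed
  have ae: "AE x in lborel. sol t x = mild_rhs Z Y p u0 sol t x" if t: "t \<in> {0..T}" for t
    using aS[OF t] unfolding rhs[OF t] by eventually_elim (simp add: sol_fixed_point[OF t])
  have Si: "integrable lborel (S_op Z t u0)" if t: "t \<in> {0..T}" for t
  proof (cases "t = 0")
    case True
    then have "S_op Z t u0 = u0" by (simp add: S_op_def fun_eq_iff)
    then show ?thesis using u0 by simp
  next
    case False
    then have "prob_space (Z t)" "sets (Z t) = sets borel" using Zf t unfolding Z_family_def by auto
    moreover have "S_op Z t u0 = conv_measure (Z t) u0" using False by (simp add: S_op_def fun_eq_iff)
    ultimately show ?thesis using conv_measure_integrable[of "Z t" u0] u0 by (simp add: prob_space_def)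
  qed
  have ri: "integrable lborel (mild_rhs Z Y p u0 sol t)" if t: "t \<in> {0..T}" for t
    unfolding rhs[OF t]
    by (intro Bochner_Integration.integrable_add Si t admissible_duhamel_integrable[OF source_admissible[OF sol_L1_curve p R]])
      (use t T in auto)
  show ?thesis
    unfolding mild_solution_def in_L1_def
  proof (intro conjI ballI)
    show "(\<lambda>(t, x). sol t x) \<in> borel_measurable (restrict_space borel ({0..T} \<times> UNIV))"
      using sol_L1_curve unfolding L1_curve_def by blast
    show "integrable lborel (sol t)" if "t \<in> {0..T}" for t
      using sol_L1_curve that unfolding L1_curve_def by blast
    show "((\<lambda>s. LINT x|lborel. \<bar>sol s x - sol t x\<bar>) \<longlongrightarrow> 0) (at t within {0..T})" if "t \<in> {0..T}" for t
      using sol_L1_curve that unfolding L1_curve_def by blast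
    have "AE t in lebesgue. t \<in> {0<..<T} \<longrightarrow> (AE x in lborel. \<bar>sol t x\<bar> \<le> R)"
      using sol_bounds by (intro AE_I2) auto
    then show "\<exists>M. AE t in lebesgue. t \<in> {0<..<T} \<longrightarrow> (AE x in lborel. \<bar>sol t x\<bar> \<le> M)" by blast
    show "AE t in lebesgue. t \<in> {0<..<T} \<longrightarrow> in_Linf (mild_rhs Z Y p u0 sol t) \<and>
        (AE x in lborel. sol t x = mild_rhs Z Y p u0 sol t x)"
    proof (rule AE_I2, rule impI)
      fix t assume "t \<in> {0<..<T}"
      then have t: "t \<in> {0..T}" by simp
      have "AE x in lborel. \<bar>mild_rhs Z Y p u0 sol t x\<bar> \<le> R"
        using ae[OF t]
      proof eventually_elim
        case (elim x)
        then show ?case using sol_bounds[OF t, of x] by simp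
      qed
      then show "in_Linf (mild_rhs Z Y p u0 sol t) \<and> (AE x in lborel. sol t x = mild_rhs Z Y p u0 sol t x)"
        unfolding in_Linf_def using borel_measurable_integrable[OF ri[OF t]] ae[OF t] by blast
    qed
  qed (use ri ae in auto)
qed

end

subsection \<open>Lower bound and the main estimate\<close>

context volterra_kernel begin

lemma K_IVT:
  assumes "0 \<le> y" "y \<le> K 1"
  obtains t where "0 \<le> t" "K t = y"
proof -
  have "\<exists>t\<ge>0. t \<le> 1 \<and> K t = y"
    by (rule IVT') (use assms K_nonpos[of 0] continuous_on_subset[OF K_continuous] in auto)
  then show thesis using that by blast
qed

text \<open>\<open>inv_into\<close> selects some nonnegative preimage, which exists by the
  intermediate value theorem on [0, 1]. Arguments are then compared through values of K, by
  \<open>K_less_imp_less\<close>.\<close>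

lemma K_inv_eq:
  assumes "K_fun \<psi> = K" "0 \<le> y" "y \<le> K 1"
  shows "0 \<le> K_inv \<psi> y" "K (K_inv \<psi> y) = y"
proof -
  have "y \<in> K ` {0..}" using K_IVT[OF assms(2,3)] by (metis atLeast_iff image_eqI)
  from inv_into_into[OF this] f_inv_into_f[OF this]
  show "0 \<le> K_inv \<psi> y" "K (K_inv \<psi> y) = y" unfolding K_inv_def assms(1) by auto
qed

lemma K_less_imp_less: "K s < K t \<Longrightarrow> s < t"
  using K_mono[of t s] by (meson not_le)

end

context spacetime_kernel begin

text \<open>If Tm \<le> T, the Picard solution on [0, T] agrees with u before Tm by uniqueness and
  so extends it, against maximality. The solution u1 with datum \<phi> supplies the linear evolution
  up to \<tau>; by linearity its multiple by A serves the datum A \<phi>, so \<tau> does not depend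
  on A.\<close>

lemma mild_existence_time_lower_bound:
  fixes \<phi> :: "real ^ 'n \<Rightarrow> real"
  assumes Zf: "Z_family \<alpha>1 \<alpha>2 c Z" and p: "1 < p"
    and \<phi>: "integrable lborel \<phi>" "AE x in lborel. 0 \<le> \<phi> x \<and> \<phi> x \<le> m" and m: "0 < m"
    and u1: "mild_solution Z Y p \<phi> \<tau> u1" and \<tau>: "0 < \<tau>" "\<tau> \<le> 1"
    and A: "0 < A" and T: "0 < T" "T \<le> \<tau>"
    and small: "2 * (p * (2 * A * m) powr (p - 1)) * K T \<le> 1"
    and u: "maximal_nonneg_mild_solution Z Y p (\<lambda>x. A * \<phi> x) Tm u"
  shows "ereal T < Tm"
proof (rule ccontr)
  assume "\<not> ereal T < Tm"
  then have Tm: "Tm \<le> ereal T" by simp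
  have Tpos: "0 < Tm" and umild: "\<And>T. 0 < T \<Longrightarrow> ereal T < Tm \<Longrightarrow> mild_solution Z Y p (\<lambda>x. A * \<phi> x) T u"
    and umax: "\<not> (\<exists>T v. Tm \<le> ereal T \<and> mild_solution Z Y p (\<lambda>x. A * \<phi> x) T v \<and>
          (\<forall>t. 0 \<le> t \<and> ereal t < Tm \<longrightarrow> (AE x in lborel. v t x = u t x)))"
    using u unfolding maximal_nonneg_mild_solution_def by auto
  obtain g where g: "L1_curve \<tau> g" "\<And>t x. 0 \<le> g t x" "\<And>t x. g t x \<le> m"
    "\<And>t. t \<in> {0..\<tau>} \<Longrightarrow> AE x in lborel. g t x = S_op Z t \<phi> x"
    using linear_evolution_version[OF Zf u1 \<tau> p \<phi>] m by auto
  have T1: "T \<le> 1" using T \<tau> by simp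
  have gT: "L1_curve T (\<lambda>t x. A * g t x)"
  proof -
    have *: "L1_curve T g" by (rule L1_curve_subinterval[OF g(1) T(2)])
    have "admissible T (\<lambda>s x :: real ^ 'n. 0)" unfolding admissible_def by auto
    then show ?thesis
    proof (rule L1_curve_lipschitz[OF * _ T1, where F="\<lambda>b d. A * b" and A=A])
      show "(\<lambda>(b :: real, d :: real). A * b) \<in> borel_measurable borel"
        unfolding borel_prod[symmetric] by measurable
      show "\<bar>A * b - A * b'\<bar> \<le> A * (\<bar>b - b'\<bar> + \<bar>d - d'\<bar>)" for b b' d d' :: real
        using A by (simp add: right_diff_distrib[symmetric] abs_mult)
    qed (use A in auto)
  qed
  have sub: "{0..T} \<subseteq> {0..\<tau>}" using T(2) by simp
  \<comment> \<open>The linear part is at most A m, whence the radius 2 A m.\<close>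
  interpret picard_iteration \<alpha>1 \<alpha>2 c k Y \<kappa> p "2 * A * m" T "\<lambda>t x. A * g t x"
    by unfold_locales (use p A m T T1 small gT g in auto)
  have v: "mild_solution Z Y p (\<lambda>x. A * \<phi> x) T sol"
  proof (rule sol_mild[OF Zf])
    show "integrable lborel (\<lambda>x. A * \<phi> x)" using \<phi>(1) by simp
    fix t assume t: "t \<in> {0..T}"
    then have "AE x in lborel. g t x = S_op Z t \<phi> x" using g(4) sub by blast
    then show "AE x in lborel. A * g t x = S_op Z t (\<lambda>x. A * \<phi> x) x"
      by eventually_elim (simp add: S_op_def conv_measure_def)
  qed
  have "AE x in lborel. sol t x = u t x" if t: "0 \<le> t" "ereal t < Tm" for t
  proof -
    obtain r where r: "Tm = ereal r" using Tpos Tm by (cases Tm) auto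
    \<comment> \<open>A time strictly between t and Tm: on [0, T'] both functions are mild
      solutions, so uniqueness applies there.\<close>
    define T' where "T' = (t + r) / 2"
    have T': "0 < T'" "ereal T' < Tm" "t \<in> {0..T'}" "T' \<le> T"
      using t Tpos Tm unfolding r T'_def by auto
    have T'1: "T' \<le> 1" using T' T1 by simp
    show ?thesis
      by (rule mild_solution_unique[OF mild_solution_restrict[OF v T'(4)] umild[OF T'(1,2)] T'(1) T'1 p T'(3)])
  qed
  then show False using umax Tm v by blast
qed

end

theorem theorem5p2:
  fixes \<alpha>1 \<alpha>2 c p :: real
    and \<psi> :: "real \<Rightarrow> real"
    and Z Y :: "real \<Rightarrow> (real ^ 'n) measure"
    and \<phi> :: "real ^ 'n \<Rightarrow> real"
    and u :: "real \<Rightarrow> real \<Rightarrow> real ^ 'n \<Rightarrow> real"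
    and T :: "real \<Rightarrow> ereal"
  assumes "0 < \<alpha>1" "\<alpha>1 < 1" "0 < \<alpha>2" "\<alpha>2 < 1" "0 < c"
    and "bernstein_function (\<lambda>s. inverse (Psi \<alpha>1 \<alpha>2 c s))"
    and "Psi_kernel \<alpha>1 \<alpha>2 c \<psi>"
    and "Z_family \<alpha>1 \<alpha>2 c Z"
    and "Y_family \<alpha>1 \<alpha>2 c Y"
    and "in_X \<phi>"
    and "AE x in lborel. 0 \<le> \<phi> x"
    and "\<not> (AE x in lborel. \<phi> x = 0)"
    and "1 < p"
    and "\<And>A. 0 < A \<Longrightarrow> maximal_nonneg_mild_solution Z Y p (\<lambda>x. A * \<phi> x) (T A) (u A)"
  shows "(\<exists>A0 C1 C2. 0 < A0 \<and> 0 < C1 \<and> 0 < C2 \<and>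
            (\<forall>A\<ge>A0. ereal (K_inv \<psi> (C1 * A powr (1 - p))) \<le> T A \<and>
                     T A \<le> ereal (K_inv \<psi> (C2 * A powr (1 - p)))))
         \<and> asymp_at_top T (\<lambda>A. A powr (- (p - 1) / \<alpha>1))"
proof -
  note p = \<open>1 < p\<close> and Zf = \<open>Z_family \<alpha>1 \<alpha>2 c Z\<close> and Yf = \<open>Y_family \<alpha>1 \<alpha>2 c Y\<close>
    and max = \<open>\<And>A. 0 < A \<Longrightarrow> maximal_nonneg_mild_solution Z Y p (\<lambda>x. A * \<phi> x) (T A) (u A)\<close>
  obtain k where vk: "volterra_kernel \<alpha>1 \<alpha>2 c k"
    and mass: "AE t in lebesgue. 0 < t \<longrightarrow>
      finite_measure (Y t) \<and> sets (Y t) = sets borel \<and> emeasure (Y t) UNIV = ennreal (k t)"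
    and K\<psi>: "K_fun \<psi> = volterra_kernel.K k"
    using total_mass_kernel[OF assms(1,2,5,7) Yf] by blast
  obtain \<kappa> where sk: "spacetime_kernel \<alpha>1 \<alpha>2 c k Y \<kappa>"
    using spacetime_kernel_exists[OF vk Yf mass] by blast
  interpret spacetime_kernel \<alpha>1 \<alpha>2 c k Y \<kappa> by (rule sk)
  have \<phi>i: "integrable lborel \<phi>" using \<open>in_X \<phi>\<close> by (simp add: in_X_def in_L1_def)
  obtain m0 where m0: "AE x in lborel. \<bar>\<phi> x\<bar> \<le> m0"
    using \<open>in_X \<phi>\<close> by (auto simp: in_X_def in_Linf_def)
  define m where "m = Max {m0, 1}"
  have m: "0 < m" by (auto simp: m_def less_max_iff_disj)
  have \<phi>m: "AE x in lborel. 0 \<le> \<phi> x \<and> \<phi> x \<le> m"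
    using \<open>AE x in lborel. 0 \<le> \<phi> x\<close> m0 by eventually_elim (auto simp: m_def)
  have max1: "maximal_nonneg_mild_solution Z Y p \<phi> (T 1) (u 1)" using max[of 1] by simp
  \<comment> \<open>The solution with A = 1 exists on a short interval; it serves as the source of
    the linear evolution for all A.\<close>
  obtain \<tau> where \<tau>: "0 < \<tau>" "\<tau> \<le> 1" "ereal \<tau> < T 1"
  proof -
    have "0 < min (T 1) 1" using max1 by (simp add: maximal_nonneg_mild_solution_def)
    then obtain r where r: "0 < r" "r < min (T 1) 1" using dense by blast
    then obtain s where "r = ereal s" by (cases r) auto
    then show thesis using r by (intro that[of s]) (auto simp: one_ereal_def)
  qed
  have u1: "mild_solution Z Y p \<phi> \<tau> (u 1)"
    using max1 \<tau> unfolding maximal_nonneg_mild_solution_def by blast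
  obtain C Au where C: "0 < C" "0 < Au" and upper:
    "\<And>A T u. Au \<le> A \<Longrightarrow> 0 < T \<Longrightarrow> T \<le> 1 \<Longrightarrow> mild_solution Z Y p (\<lambda>x. A * \<phi> x) T u \<Longrightarrow>
      (\<forall>t\<in>{0..T}. AE x in lborel. 0 \<le> u t x) \<Longrightarrow> T \<le> C * A powr (- (p - 1) / \<alpha>1)"
    using mild_existence_time_upper_bound[OF Zf Yf p \<phi>i assms(11,12)] by metis
  obtain c1 c2 t1 where c12: "0 < c1" "0 < c2" "0 < t1"
    "\<And>t. 0 < t \<Longrightarrow> t \<le> t1 \<Longrightarrow> c1 * t powr \<alpha>1 \<le> K t"
    "\<And>t. 0 < t \<Longrightarrow> t \<le> t1 \<Longrightarrow> K t \<le> c2 * t powr \<alpha>1"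
    using K_asymptotics by metis
  \<comment> \<open>With radius R = 2 A m, the smallness condition 2 p R^(p-1) K T \<le> 1 of the
    Picard iteration reads K T \<le> C1 A^(1-p).\<close>
  define C1 where "C1 = 1 / (2 * (p * (2 * m) powr (p - 1)))"
  have C1: "0 < C1" using p m by (simp add: C1_def)
  \<comment> \<open>The upper bound b A for the existence time satisfies K (b A) \<le> c2
    C^\<alpha>1 A^(1-p). The factor 2 makes the comparison strict, as is required to pass from
    values of K to arguments.\<close>
  define C2 where "C2 = 2 * (c2 * C powr \<alpha>1)"
  have C2: "0 < C2" using c12 C by (simp add: C2_def)
  define b where "b A = C * A powr (- (p - 1) / \<alpha>1)" for A
  have lim1: "((\<lambda>A. D * A powr (1 - p)) \<longlongrightarrow> D * 0) at_top" for D
    by (intro tendsto_mult tendsto_const tendsto_neg_powr filterlim_ident) (use p in auto)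
  have lim2: "(b \<longlongrightarrow> C * 0) at_top"
    unfolding b_def using p \<alpha>1
    by (intro tendsto_mult tendsto_const tendsto_neg_powr filterlim_ident) (auto simp: divide_neg_pos)
  \<comment> \<open>Both arguments of \<open>K_inv\<close> lie in the range of K on [0, 1]. The
    lower time s falls below \<tau> and t1, the upper time b A below 1 and t1; below t1 the power
    bounds for K hold.\<close>
  define good where "good A \<longleftrightarrow> Au \<le> A \<and> 1 \<le> A \<and> C1 * A powr (1 - p) < K (min \<tau> t1) \<and>
    C2 * A powr (1 - p) < K 1 \<and> b A < min 1 t1" for A
  have "\<forall>\<^sub>F A in at_top. good A"
    unfolding good_def
    using order_tendstoD(2)[OF lim1, of C1 "K (min \<tau> t1)"] order_tendstoD(2)[OF lim1, of C2 "K 1"]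
      order_tendstoD(2)[OF lim2, of "min 1 t1"] K_pos[of "min \<tau> t1"] K_pos[of 1] \<tau> c12(3)
    by (intro eventually_conj eventually_ge_at_top) auto
  then obtain A1 where A1: "\<And>A. A1 \<le> A \<Longrightarrow> good A" by (auto simp: eventually_at_top_linorder)
  have main: "ereal (K_inv \<psi> (C1 * A powr (1 - p))) \<le> T A \<and> T A \<le> ereal (b A)
      \<and> b A \<le> K_inv \<psi> (C2 * A powr (1 - p))
      \<and> (C1 / c2) powr (1 / \<alpha>1) * A powr (- (p - 1) / \<alpha>1) \<le> K_inv \<psi> (C1 * A powr (1 - p))"
    if "good A" for A
  proof -
    have gA: "Au \<le> A" "0 < A" "C1 * A powr (1 - p) < K (min \<tau> t1)" "C2 * A powr (1 - p) < K 1" "b A < 1" "b A \<le> t1"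
      using that by (auto simp: good_def)
    have bpos: "0 < b A" using C gA by (simp add: b_def)
    define s where "s = K_inv \<psi> (C1 * A powr (1 - p))"
    have "K (min \<tau> t1) \<le> K 1" using \<tau> by (intro K_mono) simp
    then have y: "0 \<le> C1 * A powr (1 - p)" "C1 * A powr (1 - p) \<le> K 1" using C1 gA by auto
    have Ks: "K s = C1 * A powr (1 - p)" unfolding s_def by (rule K_inv_eq(2)[OF K\<psi> y])
    have "0 < K s" using Ks C1 gA by simp
    then have s0: "0 < s" using K_nonpos[of s] by (cases "0 < s") auto
    have s1: "s < min \<tau> t1" using K_less_imp_less[of s "min \<tau> t1"] Ks gA by simp
    have "ereal s < T A"
    proof (rule mild_existence_time_lower_bound[OF Zf p \<phi>i \<phi>m m u1 \<tau>(1,2) gA(2) s0 _ _ max[OF gA(2)]])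
      have "(2 * A * m) powr (p - 1) * A powr (1 - p) = (2 * m) powr (p - 1)"
      proof -
        have "(2 * A * m) powr (p - 1) = (2 * m) powr (p - 1) * A powr (p - 1)"
          using gA m by (simp add: powr_mult)
        moreover have "A powr (p - 1) * A powr (1 - p) = 1" using gA by (simp flip: powr_add)
        ultimately show ?thesis by simp
      qed
      then have "2 * (p * (2 * A * m) powr (p - 1)) * K s = 2 * p * C1 * (2 * m) powr (p - 1)"
        unfolding Ks by (simp add: mult_ac)
      also have "\<dots> = 1" using p m by (simp add: C1_def)
      finally show "2 * (p * (2 * A * m) powr (p - 1)) * K s \<le> 1" by simp
    qed (use s1 in simp)
    then have low: "ereal s \<le> T A" by simp
    have up: "T A \<le> ereal (b A)"
    proof (rule ccontr)
      assume "\<not> T A \<le> ereal (b A)"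
      \<comment> \<open>The upper estimate concerns intervals of length at most 1, and T A may be
        infinite; a time q between b A and both limits suffices for the contradiction.\<close>
      then have "ereal (b A) < min (T A) 1" using gA by (simp add: one_ereal_def)
      then obtain r where r: "ereal (b A) < r" "r < min (T A) 1" using dense by blast
      then obtain q where q: "r = ereal q" by (cases r) auto
      have q': "b A < q" "q < 1" "ereal q < T A" using r unfolding q by (auto simp: one_ereal_def)
      have "mild_solution Z Y p (\<lambda>x. A * \<phi> x) q (u A)"
        using max[OF gA(2)] q' bpos unfolding maximal_nonneg_mild_solution_def by auto
      moreover have "\<forall>t\<in>{0..q}. AE x in lborel. 0 \<le> u A t x"
      proof
        fix t assume "t \<in> {0..q}"
        then have "0 \<le> t" "ereal t < T A" using q'(3) by (auto intro: le_less_trans[of _ "ereal q"])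
        then show "AE x in lborel. 0 \<le> u A t x"
          using max[OF gA(2)] unfolding maximal_nonneg_mild_solution_def by blast
      qed
      ultimately have "q \<le> b A"
        unfolding b_def using q' bpos by (intro upper[OF gA(1)]) auto
      then show False using q' by simp
    qed
    have eA: "(A powr (- (p - 1) / \<alpha>1)) powr \<alpha>1 = A powr (1 - p)"
      using \<alpha>1 by (simp add: powr_powr)
    have "K (b A) \<le> c2 * b A powr \<alpha>1" by (rule c12(5)[OF bpos gA(6)])
    also have "\<dots> = c2 * C powr \<alpha>1 * A powr (1 - p)"
      unfolding b_def using C gA eA by (simp add: powr_mult)
    also have "\<dots> < C2 * A powr (1 - p)"
      using c12 C gA by (simp add: C2_def)
    also have "\<dots> = K (K_inv \<psi> (C2 * A powr (1 - p)))"
      by (rule K_inv_eq(2)[OF K\<psi>, symmetric]) (use C2 gA in auto)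
    finally have "b A < K_inv \<psi> (C2 * A powr (1 - p))" by (rule K_less_imp_less)
    \<comment> \<open>Solves K s \<le> c2 s^\<alpha>1 for s at K s = C1 A^(1-p), which gives the
      lower constant of the asymptotic relation.\<close>
    moreover have "(C1 / c2) powr (1 / \<alpha>1) * A powr (- (p - 1) / \<alpha>1) \<le> s"
    proof -
      have "C1 * A powr (1 - p) \<le> c2 * s powr \<alpha>1" using c12(5)[of s] s0 s1 Ks by simp
      then have "C1 / c2 * A powr (1 - p) \<le> s powr \<alpha>1" using c12 by (simp add: field_simps)
      then have "(C1 / c2 * A powr (1 - p)) powr (1 / \<alpha>1) \<le> (s powr \<alpha>1) powr (1 / \<alpha>1)"
        using C1 c12 \<alpha>1 by (intro powr_mono2) auto
      moreover have "(s powr \<alpha>1) powr (1 / \<alpha>1) = s" using s0 \<alpha>1 by (simp add: powr_powr)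
      moreover have "(C1 / c2 * A powr (1 - p)) powr (1 / \<alpha>1) = (C1 / c2) powr (1 / \<alpha>1) * A powr (- (p - 1) / \<alpha>1)"
      proof -
        have "(C1 / c2 * A powr (1 - p)) powr (1 / \<alpha>1) = (C1 / c2) powr (1 / \<alpha>1) * (A powr (1 - p)) powr (1 / \<alpha>1)"
          by (rule powr_mult)
        also have "(A powr (1 - p)) powr (1 / \<alpha>1) = A powr (- (p - 1) / \<alpha>1)" by (simp add: powr_powr)
        finally show ?thesis .
      qed
      ultimately show ?thesis by simp
    qed
    ultimately show ?thesis using low up by (simp add: s_def)
  qed
  have "asymp_at_top T (\<lambda>A. A powr (- (p - 1) / \<alpha>1))"
    unfolding asymp_at_top_def
  proof (intro exI conjI)
    let ?c = "(C1 / c2) powr (1 / \<alpha>1)"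
    show "0 < ?c" using C1 c12 by simp
    \<comment> \<open>The upper constant is enlarged from C because the relation asks for ordered
      constants.\<close>
    show "?c \<le> Max {?c, C}" by simp
    show "\<forall>\<^sub>F A in at_top. ereal (?c * A powr (- (p - 1) / \<alpha>1)) \<le> T A
        \<and> T A \<le> ereal (Max {?c, C} * A powr (- (p - 1) / \<alpha>1))"
      using \<open>\<forall>\<^sub>F A in at_top. good A\<close>
    proof eventually_elim
      case (elim A)
      note mA = main[OF elim]
      have "ereal (?c * A powr (- (p - 1) / \<alpha>1)) \<le> T A"
        using mA by (meson ereal_less_eq(3) order_trans)
      moreover have "b A \<le> Max {?c, C} * A powr (- (p - 1) / \<alpha>1)"
        unfolding b_def by (intro mult_right_mono) auto
      then have "T A \<le> ereal (Max {?c, C} * A powr (- (p - 1) / \<alpha>1))"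
        using mA by (meson ereal_less_eq(3) order_trans)
      ultimately show ?case by simp
    qed
  qed
  moreover have "\<forall>A\<ge>max A1 1. ereal (K_inv \<psi> (C1 * A powr (1 - p))) \<le> T A \<and>
      T A \<le> ereal (K_inv \<psi> (C2 * A powr (1 - p)))"
  proof (intro allI impI)
    fix A assume "max A1 1 \<le> A"
    then have "good A" using A1 by simp
    note mA = main[OF this]
    then have "T A \<le> ereal (K_inv \<psi> (C2 * A powr (1 - p)))" by (meson ereal_less_eq(3) order_trans)
    then show "ereal (K_inv \<psi> (C1 * A powr (1 - p))) \<le> T A \<and> T A \<le> ereal (K_inv \<psi> (C2 * A powr (1 - p)))"
      using mA by simp
  qed
  ultimately show ?thesis using C1 C2 by (intro conjI exI[of _ "max A1 1"] exI[of _ C1] exI[of _ C2]) auto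
qed

end
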